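(* Let $U\subset\mathbb{R}^m$ be a nonempty open set with nonempty complement $\mathbb{R}^m\setminus U$ and $\overline{U}\subset\mathcal{X}$. Assume that $x_t$ is nonexplosive, and let $x_*\in\partial U$ be regular, i.e. $\mathbf{P}_{x_*}\{\overline{\tau}=0\}=1$. Let $f:U\to\mathbb{R}$ be measurable and bounded on $\mathcal{X}_n\cap U$ for every $n$, and suppose that: (a) for some $\delta>0$ the family of random variables $\{\int_0^\tau f(x_s(x))\,ds: |x-x_*|<\delta,\ x\in U\}$ is uniformly integrable; (b) for every $\delta_1>0$ there exist $n\in\mathbb{N}$ and $\delta_2>0$ such that $\mathbf{P}_x\{\tau_{\mathcal{X}_n}<\tau\}<\delta_1$ for all $x\in U$ with $|x-x_*|<\delta_2$. If $\mathbf{P}_x\{\tau<\infty\}=1$ for every $x\in U$, then $v(x):=\mathbf{E}_x\int_0^\tau f(x_s)\,ds\to0$ as $x\to x_*$, $x\in U$.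
   Context: Let $m,r\in\mathbb{N}$, let $\mathcal{X}\subset\mathbb{R}^m$ be open, $b\in C^\infty(\mathcal{X};\mathbb{R}^m)$, $\sigma\in C^\infty(\mathcal{X};\mathbb{R}^{m\times r})$. Let $x_t$ be the (maximal, pathwise unique) solution in $\mathcal{X}$ of the Itô SDE $dx_t=b(x_t)\,dt+\sigma(x_t)\,d\mathbf{W}_t$, where $\mathbf{W}_t$ is a standard $r$-dimensional Brownian motion; $\mathbf{P}_x,\mathbf{E}_x$ denote probability and expectation when $x_0=x$. Fix bounded open sets $\mathcal{X}_n$ with $\overline{\mathcal{X}_n}\subset\mathcal{X}_{n+1}$ and $\bigcup_n\mathcal{X}_n=\mathcal{X}$, and let $\tau_{\mathcal{X}_n}=\inf\{t>0: x_t\notin\mathcal{X}_n\}$. The process $x_t$ is nonexplosive if $\mathbf{P}_x\{\lim_n\tau_{\mathcal{X}_n}<\infty\}=0$ for all $x\in\mathcal{X}$. $\tau=\inf\{t>0: x_t\notin U\}$ and $\overline{\tau}=\inf\{t\ge0: x_t\notin\overline{U}\}$, with $\inf\emptyset=\infty$. The notation $x_s(x)$ means the process started at $x_0=x$, with $\tau$ in $\int_0^\tau f(x_s(x))\,ds$ being the exit time of that process (all started processes are driven by the same Brownian motion). *)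

theory Defs
  imports "HOL-Probability.Probability"
begin

section \<open>Smooth coefficients\<close>

text \<open>For an open set \<open>S\<close>, all directional derivatives of order at most \<open>k\<close> exist and are
  continuous on \<open>S\<close>.\<close>

primrec Ck_on ::
  "nat \<Rightarrow> ('a::euclidean_space \<Rightarrow> 'b::real_normed_vector) \<Rightarrow> 'a set \<Rightarrow> bool" where
  "Ck_on 0 f S \<longleftrightarrow> continuous_on S f"
| "Ck_on (Suc k) f S \<longleftrightarrow>
     (\<forall>x\<in>S. f differentiable (at x)) \<and>
     (\<forall>v. Ck_on k (\<lambda>x. frechet_derivative f (at x) v) S)"

definition Cinf_on :: "('a::euclidean_space \<Rightarrow> 'b::real_normed_vector) \<Rightarrow> 'a set \<Rightarrow> bool" where
  "Cinf_on f S \<longleftrightarrow> (\<forall>k. Ck_on k f S)"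


section \<open>Brownian motion\<close>

text \<open>Time is \<open>[0,\<infinity>)\<close>: values of processes and of the filtration at negative times are
  irrelevant. The filtration is not assumed to be complete or right-continuous.\<close>

definition filtration_on :: "'w measure \<Rightarrow> (real \<Rightarrow> 'w measure) \<Rightarrow> bool" where
  "filtration_on M F \<longleftrightarrow> filtration (space M) F \<and> (\<forall>t. subalgebra M (F t))"

definition brownian_motion ::
  "'w measure \<Rightarrow> (real \<Rightarrow> 'w measure) \<Rightarrow> (real \<Rightarrow> 'w \<Rightarrow> real^'r) \<Rightarrow> bool" where
  "brownian_motion M F W \<longleftrightarrow>
     prob_space M \<and> filtration_on M F \<and>
     (\<forall>t\<ge>0. W t \<in> borel_measurable (F t)) \<and>
     (\<forall>\<omega>\<in>space M. continuous_on {0..} (\<lambda>t. W t \<omega>)) \<and>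
     (AE \<omega> in M. W 0 \<omega> = 0) \<and>
     (\<forall>s t. 0 \<le> s \<and> s < t \<longrightarrow>
        prob_space.indep_set M (sets (F s))
          {(\<lambda>\<omega>. W t \<omega> - W s \<omega>) -` B \<inter> space M | B. B \<in> sets borel} \<and>
        prob_space.indep_vars M (\<lambda>_. borel) (\<lambda>i \<omega>. (W t \<omega> - W s \<omega>) $ i) UNIV \<and>
        (\<forall>i. distributed M lborel (\<lambda>\<omega>. (W t \<omega> - W s \<omega>) $ i)
               (normal_density 0 (sqrt (t - s)))))"


section \<open>The Ito integral\<close>

definition simple_integrand ::
  "'w measure \<Rightarrow> (real \<Rightarrow> 'w measure) \<Rightarrow> nat \<Rightarrow> (nat \<Rightarrow> real) \<Rightarrow>
     (nat \<Rightarrow> 'w \<Rightarrow> real^'r^'m) \<Rightarrow> bool" where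
  "simple_integrand M F k t \<xi> \<longleftrightarrow>
     0 \<le> t 0 \<and> (\<forall>i<k. t i \<le> t (Suc i)) \<and>
     (\<forall>i<k. \<xi> i \<in> borel_measurable (F (t i))) \<and>
     (\<exists>C. \<forall>i<k. \<forall>\<omega>\<in>space M. norm (\<xi> i \<omega>) \<le> C)"

definition simple_process ::
  "nat \<Rightarrow> (nat \<Rightarrow> real) \<Rightarrow> (nat \<Rightarrow> 'w \<Rightarrow> real^'r^'m) \<Rightarrow> real \<Rightarrow> 'w \<Rightarrow> real^'r^'m" where
  "simple_process k t \<xi> s \<omega> = (\<Sum>i<k. indicator {t i<..t (Suc i)} s *\<^sub>R \<xi> i \<omega>)"

definition simple_integral ::
  "(real \<Rightarrow> 'w \<Rightarrow> real^'r) \<Rightarrow> nat \<Rightarrow> (nat \<Rightarrow> real) \<Rightarrow> (nat \<Rightarrow> 'w \<Rightarrow> real^'r^'m) \<Rightarrow>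
     real \<Rightarrow> 'w \<Rightarrow> real^'m" where
  "simple_integral W k t \<xi> T \<omega> =
     (\<Sum>i<k. \<xi> i \<omega> *v (W (min (t (Suc i)) T) \<omega> - W (min (t i) T) \<omega>))"

definition progressively_measurable ::
  "(real \<Rightarrow> 'w measure) \<Rightarrow> (real \<Rightarrow> 'w \<Rightarrow> 'b::topological_space) \<Rightarrow> bool" where
  "progressively_measurable F H \<longleftrightarrow>
     (\<forall>t\<ge>0. (\<lambda>(s, \<omega>). H s \<omega>) \<in> borel_measurable (restrict_space borel {0..t} \<Otimes>\<^sub>M F t))"

text \<open>\<open>is_ito_integral M F W H T I\<close> says that \<open>I\<close> is a version of \<open>\<integral>\<^sub>0\<^sup>T H dW\<close>: there are simple
  processes \<open>H\<^sub>j\<close> with \<open>\<integral>\<^sub>0\<^sup>T |H\<^sub>j - H|\<^sup>2 ds \<rightarrow> 0\<close> and \<open>\<integral>\<^sub>0\<^sup>T H\<^sub>j dW \<rightarrow> I\<close>, both in probability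
  (Frobenius norm on matrices). Such an \<open>I\<close> exists and is almost surely unique whenever \<open>H\<close> is
  progressively measurable with \<open>\<integral>\<^sub>0\<^sup>T |H|\<^sup>2 ds < \<infinity>\<close> almost surely.\<close>

definition is_ito_integral ::
  "'w measure \<Rightarrow> (real \<Rightarrow> 'w measure) \<Rightarrow> (real \<Rightarrow> 'w \<Rightarrow> real^'r) \<Rightarrow>
     (real \<Rightarrow> 'w \<Rightarrow> real^'r^'m) \<Rightarrow> real \<Rightarrow> ('w \<Rightarrow> real^'m) \<Rightarrow> bool" where
  "is_ito_integral M F W H T I \<longleftrightarrow>
     progressively_measurable F H \<and> I \<in> borel_measurable M \<and>
     (\<exists>k t \<xi>.
        (\<forall>j. simple_integrand M F (k j) (t j) (\<xi> j)) \<and>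
        (\<forall>\<epsilon>>0. (\<lambda>j::nat. \<P>(\<omega> in M.
            (\<integral>\<^sup>+s\<in>{0..T}. ennreal ((norm (simple_process (k j) (t j) (\<xi> j) s \<omega> - H s \<omega>))\<^sup>2) \<partial>lborel)
              > ennreal \<epsilon>)) \<longlonglongrightarrow> 0) \<and>
        (\<forall>\<epsilon>>0. (\<lambda>j. \<P>(\<omega> in M.
            norm (simple_integral W (k j) (t j) (\<xi> j) T \<omega> - I \<omega>) > \<epsilon>)) \<longlonglongrightarrow> 0))"


section \<open>Exit times and maximal solutions\<close>

text \<open>A possibly exploding process is a pair of \<open>X\<close> and its lifetime \<open>\<zeta>\<close>; \<open>X t \<omega>\<close> is meaningless for
  \<open>t \<ge> \<zeta> \<omega>\<close>. From its lifetime on the process sits in a cemetery outside every set, so exit times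
  never exceed \<open>\<zeta>\<close>. The infimum of the empty set is \<open>\<infinity>\<close>.\<close>

definition exit_time ::
  "(real \<Rightarrow> 'w \<Rightarrow> 'a) \<Rightarrow> ('w \<Rightarrow> ereal) \<Rightarrow> 'a set \<Rightarrow> 'w \<Rightarrow> ereal" where
  "exit_time X \<zeta> A \<omega> = Inf (ereal ` {t. 0 < t \<and> (\<zeta> \<omega> \<le> ereal t \<or> X t \<omega> \<notin> A)})"

text \<open>The variant admitting time \<open>0\<close> and applied to the closure.\<close>

definition closure_exit_time ::
  "(real \<Rightarrow> 'w \<Rightarrow> 'a::topological_space) \<Rightarrow> ('w \<Rightarrow> ereal) \<Rightarrow> 'a set \<Rightarrow> 'w \<Rightarrow> ereal" where
  "closure_exit_time X \<zeta> A \<omega> =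
     Inf (ereal ` {t. 0 \<le> t \<and> (\<zeta> \<omega> \<le> ereal t \<or> X t \<omega> \<notin> closure A)})"

text \<open>Maximal solution in \<open>D\<close> of \<open>dX = b(X) dt + \<sigma>(X) dW\<close> with \<open>X\<^sub>0 = x\<close>: an adapted process
  with continuous paths in \<open>D\<close> on \<open>[0,\<zeta>)\<close> which solves the integral equation up to the exit time
  \<open>\<theta>\<close> of every relatively compact open neighbourhood \<open>G\<close> of \<open>x\<close> in \<open>D\<close>, that is
  \<open>X(t \<and> \<theta>) = x + \<integral>\<^sub>0 b(X\<^sub>s) ds + \<integral>\<^sub>0 \<sigma>(X\<^sub>s) dW\<^sub>s\<close> with both integrals up to \<open>t \<and> \<theta>\<close>, and which
  leaves every compact subset of \<open>D\<close> before \<open>\<zeta>\<close> if \<open>\<zeta> < \<infinity>\<close>.\<close>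

definition maximal_solution ::
  "'w measure \<Rightarrow> (real \<Rightarrow> 'w measure) \<Rightarrow> (real \<Rightarrow> 'w \<Rightarrow> real^'r) \<Rightarrow>
     (real^'m \<Rightarrow> real^'m) \<Rightarrow> (real^'m \<Rightarrow> real^'r^'m) \<Rightarrow> (real^'m) set \<Rightarrow> real^'m \<Rightarrow>
     (real \<Rightarrow> 'w \<Rightarrow> real^'m) \<Rightarrow> ('w \<Rightarrow> ereal) \<Rightarrow> bool" where
  "maximal_solution M F W b \<sigma> D x X \<zeta> \<longleftrightarrow>
     (\<forall>\<omega>\<in>space M. 0 < \<zeta> \<omega> \<and> X 0 \<omega> = x \<and>
        continuous_on {t. 0 \<le> t \<and> ereal t < \<zeta> \<omega>} (\<lambda>t. X t \<omega>) \<and>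
        (\<forall>t\<ge>0. ereal t < \<zeta> \<omega> \<longrightarrow> X t \<omega> \<in> D)) \<and>
     (\<forall>t\<ge>0. {\<omega>\<in>space M. ereal t < \<zeta> \<omega>} \<in> sets (F t) \<and>
        X t \<in> borel_measurable (restrict_space (F t) {\<omega>\<in>space M. ereal t < \<zeta> \<omega>})) \<and>
     (\<forall>G t. open G \<and> x \<in> G \<and> compact (closure G) \<and> closure G \<subseteq> D \<and> 0 \<le> t \<longrightarrow>
        (\<exists>I. is_ito_integral M F W
               (\<lambda>s \<omega>. indicator {u. ereal u < exit_time X \<zeta> G \<omega>} s *\<^sub>R \<sigma> (X s \<omega>)) t I \<and>
             (AE \<omega> in M.
               (let T = real_of_ereal (min (ereal t) (exit_time X \<zeta> G \<omega>))
                in X T \<omega> = x + (LINT s:{0..T}|lborel. b (X s \<omega>)) + I \<omega>)))) \<and>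
     (AE \<omega> in M. \<zeta> \<omega> < \<infinity> \<longrightarrow>
        (\<forall>K. compact K \<and> K \<subseteq> D \<longrightarrow> (\<exists>t\<ge>0. ereal t < \<zeta> \<omega> \<and> X t \<omega> \<notin> K)))"

definition nonexplosive ::
  "'w measure \<Rightarrow> 'a set \<Rightarrow> (nat \<Rightarrow> 'a set) \<Rightarrow> ('a \<Rightarrow> real \<Rightarrow> 'w \<Rightarrow> 'a) \<Rightarrow> ('a \<Rightarrow> 'w \<Rightarrow> ereal) \<Rightarrow> bool" where
  "nonexplosive M D Dn X \<zeta> \<longleftrightarrow>
     (\<forall>x\<in>D. \<P>(\<omega> in M. lim (\<lambda>n. exit_time (X x) (\<zeta> x) (Dn n) \<omega>) < \<infinity>) = 0)"

definition exit_integral ::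
  "('a \<Rightarrow> real) \<Rightarrow> (real \<Rightarrow> 'w \<Rightarrow> 'a) \<Rightarrow> ('w \<Rightarrow> ereal) \<Rightarrow> 'a set \<Rightarrow> 'w \<Rightarrow> real" where
  "exit_integral f X \<zeta> U \<omega> =
     (LINT s:{s. 0 < s \<and> ereal s < exit_time X \<zeta> U \<omega>}|lborel. f (X s \<omega>))"


section \<open>Uniform integrability\<close>

definition uniformly_integrable ::
  "'w measure \<Rightarrow> 'i set \<Rightarrow> ('i \<Rightarrow> 'w \<Rightarrow> real) \<Rightarrow> bool" where
  "uniformly_integrable M J Y \<longleftrightarrow>
     (\<forall>i\<in>J. Y i \<in> borel_measurable M) \<and>
     ((\<lambda>c::real. SUP i\<in>J. \<integral>\<^sup>+\<omega>\<in>{\<omega>. \<bar>Y i \<omega>\<bar> > c}. ennreal \<bar>Y i \<omega>\<bar> \<partial>M) \<longlongrightarrow> 0) at_top"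

end

theory Submission
  imports Defs
begin

text \<open>
  Write \<open>\<tau>(x)\<close> for the exit time from \<open>U\<close> of the solution started at \<open>x\<close>. The heart of the matter is
  that \<open>\<tau>(x)\<close> tends to \<open>0\<close> in probability as \<open>x\<close> tends to the regular point
  (\<open>exit_time_small_near_regular_point\<close>). Granting this, hypothesis (b) confines the path before
  \<open>\<tau>(x)\<close> to a set \<open>\<X>\<^sub>n\<close> on which \<open>f\<close> is bounded, up to an event of small probability, so that
  \<open>\<integral>\<^sub>0\<^sup>\<tau> f\<close> is there at most a constant times \<open>\<tau>(x)\<close> and tends to \<open>0\<close> in probability; uniform
  integrability turns this into convergence of the expectations (\<open>expectation_le_split\<close>).

  Regularity means that the solution started at the boundary point is almost surely outside the
  closure of \<open>U\<close> at arbitrarily small rational times (\<open>regular_leaves_early\<close>). Up to a small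
  probability it is so at one of finitely many fixed times, and then at a distance larger than some
  fixed \<open>\<kappa> > 0\<close> from the closure of \<open>U\<close>. A solution started at a point of \<open>U\<close> close to the boundary
  point is within \<open>\<kappa>\<close> of the first one at each of these times with high probability, and hence it
  has left \<open>U\<close> as well.

  What is left is continuous dependence on the starting point, in probability and at fixed short
  times (\<open>short_time_deviation\<close>). Both solutions are stopped on leaving a ball of radius \<open>R\<close> in which
  the coefficients are bounded by \<open>K\<close> and Lipschitz with constant \<open>L\<close>. Let \<open>g(t)\<close> be the second
  moment of their difference on the event that both are still in the ball at time \<open>t\<close>, and \<open>a\<close> the
  distance of the starting points. The integral equations give
  \<open>g(t) \<le> 3 a\<^sup>2 + 9 L\<^sup>2 \<integral>\<^sub>0\<^sup>t g\<close> for \<open>t \<le> 1\<close>, and for short times the integral term is absorbed on the left.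
  The same second moment controls the event that the second solution leaves the ball
  while the first one is still in the ball of half the radius, because then they are at least
  \<open>R/2\<close> apart.

  The integral equations for the two solutions are stopped at two different exit times, but the
  estimate requires the difference of the stochastic integrals stopped at the smaller one. This is
  done on a grid of mesh \<open>t/N\<close>: the increment over a cell is multiplied by the indicator of the event
  that both solutions are alive at the beginning of the cell. That event is known at the beginning
  of the cell, so the weighted sum of increments is again a stochastic integral
  (\<open>window_martingale\<close>), and it telescopes to the difference at a grid point
  (\<open>grid_stopped_difference\<close>). The error comes from the single cell in which an exit happens and
  vanishes as \<open>N\<close> grows.

  Of the stochastic integral itself only linearity, the multiplication of later increments by an
  indicator, and the bound \<open>E|I|\<^sup>2 \<le> 2 E\<integral>|H|\<^sup>2\<close> are used. They are proved for the class \<open>ito_limit\<close> of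
  \<open>L\<^sup>2\<close>-limits of elementary integrals, and \<open>ito_integral_ito_limit\<close> shows that an integral defined by
  convergence in probability belongs to this class when its integrand is bounded.
\<close>

section \<open>Increments of Brownian motion\<close>

abbreviation (in prob_space) second_moment :: "('a \<Rightarrow> 'b::real_normed_vector) \<Rightarrow> ennreal" where
  "second_moment J \<equiv> \<integral>\<^sup>+\<omega>. ennreal ((norm (J \<omega>))\<^sup>2) \<partial>M"

abbreviation square_integral :: "(real \<Rightarrow> 'b::real_normed_vector) \<Rightarrow> ennreal" where
  "square_integral h \<equiv> \<integral>\<^sup>+s. ennreal ((norm (h s))\<^sup>2) \<partial>lborel"

locale brownian =
  fixes M :: "'w measure" and F :: "real \<Rightarrow> 'w measure" and W :: "real \<Rightarrow> 'w \<Rightarrow> real^'r"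
  assumes brownian_motion: "brownian_motion M F W"
begin

sublocale prob_space M
  using brownian_motion unfolding brownian_motion_def by blast

lemma space_F [simp]: "space (F t) = space M"
  and sets_F_mono: "s \<le> t \<Longrightarrow> sets (F s) \<subseteq> sets (F t)"
  and sets_F: "sets (F t) \<subseteq> sets M"
proof -
  have "filtration_on M F"
    using brownian_motion unfolding brownian_motion_def by blast
  then have fil: "filtration (space M) F" and sub: "subalgebra M (F t)" for t
    unfolding filtration_on_def by auto
  show "space (F t) = space M" "sets (F t) \<subseteq> sets M"
    using sub[of t] unfolding subalgebra_def by auto
  show "s \<le> t \<Longrightarrow> sets (F s) \<subseteq> sets (F t)"
    using filtration.sets_F_mono[OF fil] by auto
qed

lemma measurable_F_mono:
  assumes "Y \<in> measurable (F s) N" "s \<le> t" shows "Y \<in> measurable (F t) N"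
  using assms sets_F_mono[of s t] by (auto simp: measurable_def)

lemma measurable_F_M:
  assumes "Y \<in> measurable (F s) N" shows "Y \<in> measurable M N"
  using assms sets_F[of s] by (auto simp: measurable_def)

declare vector_minus_component [simp del]

lemma W_adapted: "0 \<le> t \<Longrightarrow> W t \<in> borel_measurable (F t)"
  using brownian_motion unfolding brownian_motion_def by blast

lemma W_measurable: "0 \<le> t \<Longrightarrow> W t \<in> borel_measurable M"
  using W_adapted measurable_F_M by blast

text \<open>Independence from the past is given for preimages under the increment itself; it passes to any
  Borel function of the increment because its preimages form a smaller intersection-stable family.\<close>

lemma increment_indep_var:
  fixes Y :: "'w \<Rightarrow> real" and g :: "real^'r \<Rightarrow> real"
  assumes st: "0 \<le> s" "s < t" and Y: "Y \<in> borel_measurable (F s)" and g: "g \<in> borel_measurable borel"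
  shows "indep_var borel Y borel (\<lambda>\<omega>. g (W t \<omega> - W s \<omega>))"
proof -
  define \<Delta> where "\<Delta> = (\<lambda>\<omega>. W t \<omega> - W s \<omega>)"
  have \<Delta>m: "\<Delta> \<in> borel_measurable M"
    unfolding \<Delta>_def using st by (intro borel_measurable_diff W_measurable) auto
  have ind: "indep_set (sets (F s)) {\<Delta> -` B \<inter> space M | B. B \<in> sets borel}"
    using brownian_motion st unfolding brownian_motion_def \<Delta>_def by blast
  let ?A = "{Y -` A \<inter> space M | A. A \<in> sets borel}"
  let ?B = "{(\<lambda>\<omega>. g (\<Delta> \<omega>)) -` A \<inter> space M | A. A \<in> sets borel}"
  have A: "?A \<subseteq> sets (F s)" using measurable_sets[OF Y] by auto
  have B: "?B \<subseteq> {\<Delta> -` B \<inter> space M | B. B \<in> sets borel}"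
  proof safe
    fix A :: "real set" assume "A \<in> sets borel"
    then have "g -` A \<in> sets borel" using measurable_sets[OF g, of A] by simp
    then show "\<exists>B. (\<lambda>\<omega>. g (\<Delta> \<omega>)) -` A \<inter> space M = \<Delta> -` B \<inter> space M \<and> B \<in> sets borel"
      by (intro exI[of _ "g -` A"]) auto
  qed
  have "indep_set ?A ?B"
    using ind A B unfolding indep_set_def
    by (elim indep_sets_mono_sets) (auto split: bool.splits)
  moreover have st: "Int_stable {h -` A \<inter> space M | A. A \<in> sets borel}" for h :: "'w \<Rightarrow> real"
  proof (rule Int_stableI)
    fix a b
    assume "a \<in> {h -` A \<inter> space M | A. A \<in> sets borel}" "b \<in> {h -` A \<inter> space M | A. A \<in> sets borel}"
    then obtain A B where "A \<in> sets borel" "B \<in> sets borel" "a = h -` A \<inter> space M" "b = h -` B \<inter> space M"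
      by auto
    then show "a \<inter> b \<in> {h -` A \<inter> space M | A. A \<in> sets borel}"
      by (intro CollectI exI[of _ "A \<inter> B"]) auto
  qed
  ultimately have "indep_set (sigma_sets (space M) ?A) (sigma_sets (space M) ?B)"
    by (intro indep_set_sigma_sets)
  then show ?thesis
    using measurable_F_M[OF Y] g \<Delta>m unfolding indep_var_eq \<Delta>_def by auto
qed

lemma increment_moments:
  assumes st: "0 \<le> s" "s < t"
  defines "\<Delta> \<equiv> \<lambda>\<omega>. W t \<omega> - W s \<omega>"
  shows "integrable M (\<lambda>\<omega>. \<Delta> \<omega> $ k)" and "expectation (\<lambda>\<omega>. \<Delta> \<omega> $ k) = 0"
    and "integrable M (\<lambda>\<omega>. \<Delta> \<omega> $ k * \<Delta> \<omega> $ l)"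
    and "expectation (\<lambda>\<omega>. \<Delta> \<omega> $ k * \<Delta> \<omega> $ l) = (if k = l then t - s else 0)"
proof -
  have dist: "distributed M lborel (\<lambda>\<omega>. \<Delta> \<omega> $ i) (normal_density 0 (sqrt (t - s)))" for i
    using brownian_motion st unfolding brownian_motion_def \<Delta>_def by blast
  have ind: "indep_vars (\<lambda>_. borel) (\<lambda>i \<omega>. \<Delta> \<omega> $ i) UNIV"
    using brownian_motion st unfolding brownian_motion_def \<Delta>_def by blast
  have pos: "0 < sqrt (t - s)" using st by simp
  have e: "expectation (\<lambda>\<omega>. \<Delta> \<omega> $ i) = 0" for i
    using normal_distributed_expectation[OF pos dist] .
  have i1: "integrable M (\<lambda>\<omega>. \<Delta> \<omega> $ i)" for i
    using integrable_normal_moment_nz_1[OF pos, of 0] distributed_integrable[OF dist, of "\<lambda>x. x" i]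
    by (auto simp: mult.commute)
  have i2: "integrable M (\<lambda>\<omega>. \<Delta> \<omega> $ i * \<Delta> \<omega> $ i)" for i
    using integrable_normal_moment[OF pos, of 0 2] distributed_integrable[OF dist, of "\<lambda>x. x * x" i]
    by (auto simp: mult.commute power2_eq_square)
  have v: "expectation (\<lambda>\<omega>. \<Delta> \<omega> $ i * \<Delta> \<omega> $ i) = t - s" for i
    using normal_distributed_variance[OF pos dist, of i] e[of i] st by (simp add: power2_eq_square)
  have iv: "indep_vars (\<lambda>_. borel) (\<lambda>i \<omega>. \<Delta> \<omega> $ i) {k, l}"
    by (rule indep_vars_subset[OF ind]) simp
  show "integrable M (\<lambda>\<omega>. \<Delta> \<omega> $ k)" "expectation (\<lambda>\<omega>. \<Delta> \<omega> $ k) = 0" using i1 e by auto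
  show "integrable M (\<lambda>\<omega>. \<Delta> \<omega> $ k * \<Delta> \<omega> $ l)"
    using i2 indep_vars_integrable[OF _ iv i1] by (cases "k = l") auto
  show "expectation (\<lambda>\<omega>. \<Delta> \<omega> $ k * \<Delta> \<omega> $ l) = (if k = l then t - s else 0)"
    using v indep_vars_lebesgue_integral[OF _ iv i1] e by (cases "k = l") auto
qed

text \<open>The two facts about an increment that the isometry rests on: multiplied by anything known at
  its beginning, it has mean zero, and its second moments are those of the increment times the mean
  of the factor.\<close>

lemma increment_weighted:
  fixes Y :: "'w \<Rightarrow> real"
  assumes st: "0 \<le> s" "s \<le> t" and Y: "Y \<in> borel_measurable (F s)" "integrable M Y"
  defines "\<Delta> \<equiv> \<lambda>\<omega>. W t \<omega> - W s \<omega>"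
  shows "integrable M (\<lambda>\<omega>. Y \<omega> * \<Delta> \<omega> $ k)" and "expectation (\<lambda>\<omega>. Y \<omega> * \<Delta> \<omega> $ k) = 0"
    and "integrable M (\<lambda>\<omega>. Y \<omega> * (\<Delta> \<omega> $ k * \<Delta> \<omega> $ l))"
    and "expectation (\<lambda>\<omega>. Y \<omega> * (\<Delta> \<omega> $ k * \<Delta> \<omega> $ l)) = (if k = l then (t - s) * expectation Y else 0)"
proof (atomize (full), cases "s = t")
  case True
  then show "(integrable M (\<lambda>\<omega>. Y \<omega> * \<Delta> \<omega> $ k) \<and> expectation (\<lambda>\<omega>. Y \<omega> * \<Delta> \<omega> $ k) = 0) \<and>
    integrable M (\<lambda>\<omega>. Y \<omega> * (\<Delta> \<omega> $ k * \<Delta> \<omega> $ l)) \<and>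
    expectation (\<lambda>\<omega>. Y \<omega> * (\<Delta> \<omega> $ k * \<Delta> \<omega> $ l)) = (if k = l then (t - s) * expectation Y else 0)"
    unfolding \<Delta>_def by simp
next
  case False
  with st have st': "0 \<le> s" "s < t" by auto
  have mom: "integrable M (\<lambda>\<omega>. \<Delta> \<omega> $ k)" "expectation (\<lambda>\<omega>. \<Delta> \<omega> $ k) = 0"
    "integrable M (\<lambda>\<omega>. \<Delta> \<omega> $ k * \<Delta> \<omega> $ l)"
    "expectation (\<lambda>\<omega>. \<Delta> \<omega> $ k * \<Delta> \<omega> $ l) = (if k = l then t - s else 0)"
    unfolding \<Delta>_def by (fact increment_moments[OF st'])+
  have 1: "indep_var borel Y borel (\<lambda>\<omega>. \<Delta> \<omega> $ k)"
    unfolding \<Delta>_def by (rule increment_indep_var[OF st' Y(1)]) simp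
  have 2: "indep_var borel Y borel (\<lambda>\<omega>. \<Delta> \<omega> $ k * \<Delta> \<omega> $ l)"
    unfolding \<Delta>_def by (rule increment_indep_var[OF st' Y(1), of "\<lambda>v. v $ k * v $ l"]) simp
  show "(integrable M (\<lambda>\<omega>. Y \<omega> * \<Delta> \<omega> $ k) \<and> expectation (\<lambda>\<omega>. Y \<omega> * \<Delta> \<omega> $ k) = 0) \<and>
    integrable M (\<lambda>\<omega>. Y \<omega> * (\<Delta> \<omega> $ k * \<Delta> \<omega> $ l)) \<and>
    expectation (\<lambda>\<omega>. Y \<omega> * (\<Delta> \<omega> $ k * \<Delta> \<omega> $ l)) = (if k = l then (t - s) * expectation Y else 0)"
    using indep_var_integrable[OF 1 Y(2) mom(1)] indep_var_lebesgue_integral[OF 1 Y(2) mom(1)]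
      indep_var_integrable[OF 2 Y(2) mom(3)] indep_var_lebesgue_integral[OF 2 Y(2) mom(3)]
      mom(2,4) by (auto simp: mult.commute)
qed

definition step_integral :: "real \<Rightarrow> real \<Rightarrow> ('w \<Rightarrow> real^'r^'m) \<Rightarrow> 'w \<Rightarrow> real^'m" where
  "step_integral a b \<xi> \<omega> = \<xi> \<omega> *v (W b \<omega> - W a \<omega>)"

lemma step_integral_split: "step_integral a b \<xi> \<omega> = step_integral a c \<xi> \<omega> + step_integral c b \<xi> \<omega>"
  unfolding step_integral_def by (simp add: matrix_vector_right_distrib[symmetric])

lemma step_integral_nth:
  "step_integral a b \<xi> \<omega> $ i = (\<Sum>k\<in>UNIV. \<xi> \<omega> $ i $ k * (W b \<omega> - W a \<omega>) $ k)"
  by (simp add: step_integral_def matrix_vector_mult_def)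

lemma step_integral_refl [simp]: "step_integral a a \<xi> \<omega> = 0"
  unfolding step_integral_def by simp

text \<open>The integrand of a single step that starts at time \<open>a\<close>.\<close>

definition adapted_bounded :: "real \<Rightarrow> ('w \<Rightarrow> real^'r^'m) \<Rightarrow> bool" where
  "adapted_bounded a \<xi> \<longleftrightarrow> 0 \<le> a \<and> \<xi> \<in> borel_measurable (F a) \<and> (\<exists>C. \<forall>\<omega>\<in>space M. norm (\<xi> \<omega>) \<le> C)"

lemma adapted_bounded_mono: "adapted_bounded a \<xi> \<Longrightarrow> a \<le> b \<Longrightarrow> adapted_bounded b \<xi>"
  unfolding adapted_bounded_def by (metis measurable_F_mono order_trans)

lemma adapted_bounded_nth:
  fixes \<xi> :: "'w \<Rightarrow> real^'r^'m"
  assumes "adapted_bounded a \<xi>"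
  shows "(\<lambda>\<omega>. \<xi> \<omega> $ i $ k) \<in> borel_measurable (F a)"
    and "\<exists>C. \<forall>\<omega>\<in>space M. \<bar>\<xi> \<omega> $ i $ k\<bar> \<le> C"
proof -
  have "(\<lambda>A::real^'r^'m. A $ i $ k) \<in> borel_measurable borel"
    by (intro borel_measurable_continuous_onI continuous_intros)
  then show "(\<lambda>\<omega>. \<xi> \<omega> $ i $ k) \<in> borel_measurable (F a)"
    using assms unfolding adapted_bounded_def by (auto intro: measurable_compose)
  have "\<bar>\<xi> \<omega> $ i $ k\<bar> \<le> norm (\<xi> \<omega>)" for \<omega>
    by (meson component_le_norm_cart order_trans Finite_Cartesian_Product.norm_nth_le)
  then show "\<exists>C. \<forall>\<omega>\<in>space M. \<bar>\<xi> \<omega> $ i $ k\<bar> \<le> C"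
    using assms unfolding adapted_bounded_def by (meson order_trans)
qed

lemma vec_nth_borel: "(\<lambda>v::real^'n. v $ k) \<in> borel_measurable borel"
  by (intro borel_measurable_continuous_onI continuous_intros)

lemma step_integral_measurable:
  fixes \<xi> :: "'w \<Rightarrow> real^'r^'m"
  assumes "adapted_bounded a \<xi>" "a \<le> b"
  shows "step_integral a b \<xi> \<in> borel_measurable (F b)"
proof -
  have "0 \<le> a" "0 \<le> b" using assms unfolding adapted_bounded_def by auto
  then have w: "(\<lambda>\<omega>. W b \<omega> - W a \<omega>) \<in> borel_measurable (F b)"
    using assms(2) by (intro borel_measurable_diff W_adapted measurable_F_mono[OF W_adapted[of a]]) auto
  have wk: "(\<lambda>\<omega>. (W b \<omega> - W a \<omega>) $ k) \<in> borel_measurable (F b)" for k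
    by (rule measurable_compose[OF w vec_nth_borel])
  have "(\<lambda>\<omega>. step_integral a b \<xi> \<omega> $ i) \<in> borel_measurable (F b)" for i
    unfolding step_integral_nth
    using measurable_F_mono[OF adapted_bounded_nth(1)[OF assms(1)] assms(2)] wk
    by (intro borel_measurable_sum borel_measurable_times) 
  then have "(\<lambda>\<omega>. \<Sum>i\<in>UNIV. step_integral a b \<xi> \<omega> $ i *\<^sub>R axis i (1::real)) \<in> borel_measurable (F b)"
    by (intro borel_measurable_sum borel_measurable_scaleR) auto
  moreover have "(\<Sum>i\<in>UNIV. x $ i *\<^sub>R axis i (1::real)) = x" for x :: "real^'m"
    using basis_expansion[of x] by (simp add: scalar_mult_eq_scaleR)
  ultimately show ?thesis by simp
qed

lemma bounded_mult_integrable: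
  fixes f g :: "'w \<Rightarrow> real"
  assumes "f \<in> borel_measurable M" "\<exists>C. \<forall>\<omega>\<in>space M. \<bar>f \<omega>\<bar> \<le> C" "integrable M g"
  shows "integrable M (\<lambda>\<omega>. f \<omega> * g \<omega>)"
proof -
  obtain C where C: "\<And>\<omega>. \<omega> \<in> space M \<Longrightarrow> \<bar>f \<omega>\<bar> \<le> C" using assms(2) by auto
  show ?thesis
  proof (rule Bochner_Integration.integrable_bound[of _ "\<lambda>\<omega>. C * g \<omega>"])
    show "AE \<omega> in M. norm (f \<omega> * g \<omega>) \<le> norm (C * g \<omega>)"
    proof (rule AE_I2)
      fix \<omega> assume "\<omega> \<in> space M"
      from C[OF this] show "norm (f \<omega> * g \<omega>) \<le> norm (C * g \<omega>)"
        by (auto simp: abs_mult intro!: mult_right_mono)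
    qed
  qed (use assms in auto)
qed

lemma sum_product_expand:
  fixes p x :: "'a \<Rightarrow> real" and q y :: "'b \<Rightarrow> real"
  shows "(\<Sum>k\<in>A. p k * x k) * (\<Sum>l\<in>B. q l * y l) = (\<Sum>k\<in>A. \<Sum>l\<in>B. p k * q l * (x k * y l))"
proof -
  have "p k * x k * (q l * y l) = p k * q l * (x k * y l)" for k l by algebra
  then show ?thesis by (simp only: sum_product)
qed

text \<open>The later increment is independent of everything else in the product.\<close>

lemma step_cov_disjoint:
  fixes \<xi> \<eta> :: "'w \<Rightarrow> real^'r^'m"
  assumes ab: "a \<le> b" "b \<le> c" "c \<le> d" and \<xi>: "adapted_bounded a \<xi>" and \<eta>: "adapted_bounded c \<eta>"
  shows "expectation (\<lambda>\<omega>. step_integral a b \<xi> \<omega> \<bullet> step_integral c d \<eta> \<omega>) = 0"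
proof -
  have pos: "0 \<le> a" "0 \<le> c" using \<xi> ab unfolding adapted_bounded_def by auto
  define Y where "Y = (\<lambda>i k l \<omega>. \<eta> \<omega> $ i $ l * (\<xi> \<omega> $ i $ k * (W b \<omega> - W a \<omega>) $ k))"
  have wm: "(\<lambda>\<omega>. (W b \<omega> - W a \<omega>) $ k) \<in> borel_measurable (F c)" for k
  proof -
    have "(\<lambda>\<omega>. W b \<omega> - W a \<omega>) \<in> borel_measurable (F c)"
      using pos ab measurable_F_mono[OF W_adapted] by (intro borel_measurable_diff) auto
    then show ?thesis by (rule measurable_compose[OF _ vec_nth_borel])
  qed
  have Ym: "Y i k l \<in> borel_measurable (F c)" for i k l
    unfolding Y_def
    using adapted_bounded_nth(1)[OF \<eta>] measurable_F_mono[OF adapted_bounded_nth(1)[OF \<xi>]] ab wm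
    by (intro borel_measurable_times) auto
  have Yi: "integrable M (Y i k l)" for i k l
    unfolding Y_def
  proof (rule bounded_mult_integrable[OF measurable_F_M[OF adapted_bounded_nth(1)[OF \<eta>]] adapted_bounded_nth(2)[OF \<eta>]])
    have "integrable M (\<lambda>\<omega>. \<xi> \<omega> $ i $ k)"
      using bounded_mult_integrable[OF measurable_F_M[OF adapted_bounded_nth(1)[OF \<xi>]] adapted_bounded_nth(2)[OF \<xi>], of "\<lambda>_. 1"]
      by simp
    then show "integrable M (\<lambda>\<omega>. \<xi> \<omega> $ i $ k * (W b \<omega> - W a \<omega>) $ k)"
      by (rule increment_weighted(1)[OF pos(1) ab(1) adapted_bounded_nth(1)[OF \<xi>]])
  qed
  have eq: "step_integral a b \<xi> \<omega> \<bullet> step_integral c d \<eta> \<omega> =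
      (\<Sum>i\<in>UNIV. \<Sum>k\<in>UNIV. \<Sum>l\<in>UNIV. Y i k l \<omega> * (W d \<omega> - W c \<omega>) $ l)" for \<omega>
    unfolding inner_vec_def inner_real_def step_integral_nth sum_product_expand Y_def
    by (intro sum.cong refl) (simp only: mult.assoc mult.left_commute mult.commute)
  show ?thesis
    unfolding eq using increment_weighted[OF pos(2) ab(3) Ym Yi]
    by (simp add: Bochner_Integration.integral_sum)
qed

lemma step_cov_same:
  fixes \<xi> \<eta> :: "'w \<Rightarrow> real^'r^'m"
  assumes ab: "a \<le> b" and \<xi>: "adapted_bounded a \<xi>" and \<eta>: "adapted_bounded a \<eta>"
  shows "integrable M (\<lambda>\<omega>. step_integral a b \<xi> \<omega> \<bullet> step_integral a b \<eta> \<omega>)"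
    and "expectation (\<lambda>\<omega>. step_integral a b \<xi> \<omega> \<bullet> step_integral a b \<eta> \<omega>) =
      (b - a) * expectation (\<lambda>\<omega>. \<xi> \<omega> \<bullet> \<eta> \<omega>)"
proof -
  have pos: "0 \<le> a" using \<xi> unfolding adapted_bounded_def by auto
  define Y where "Y = (\<lambda>i k l \<omega>. \<xi> \<omega> $ i $ k * \<eta> \<omega> $ i $ l)"
  have Ym: "Y i k l \<in> borel_measurable (F a)" for i k l
    unfolding Y_def using adapted_bounded_nth(1)[OF \<eta>] adapted_bounded_nth(1)[OF \<xi>]
    by (intro borel_measurable_times) auto
  have Yi: "integrable M (Y i k l)" for i k l
    unfolding Y_def
    using adapted_bounded_nth(2)[OF \<eta>] measurable_F_M[OF adapted_bounded_nth(1)[OF \<eta>]]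
      adapted_bounded_nth(2)[OF \<xi>] measurable_F_M[OF adapted_bounded_nth(1)[OF \<xi>]]
      bounded_mult_integrable[of "\<lambda>\<omega>. \<eta> \<omega> $ i $ l" "\<lambda>_. 1"]
    by (intro bounded_mult_integrable) auto
  have eq: "step_integral a b \<xi> \<omega> \<bullet> step_integral a b \<eta> \<omega> =
      (\<Sum>i\<in>UNIV. \<Sum>k\<in>UNIV. \<Sum>l\<in>UNIV. Y i k l \<omega> * ((W b \<omega> - W a \<omega>) $ k * (W b \<omega> - W a \<omega>) $ l))" for \<omega>
    unfolding inner_vec_def inner_real_def step_integral_nth sum_product_expand Y_def ..
  note iw = increment_weighted[OF pos ab Ym Yi]
  show "integrable M (\<lambda>\<omega>. step_integral a b \<xi> \<omega> \<bullet> step_integral a b \<eta> \<omega>)"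
    unfolding eq using iw(3) by (intro Bochner_Integration.integrable_sum)
  have "expectation (\<lambda>\<omega>. step_integral a b \<xi> \<omega> \<bullet> step_integral a b \<eta> \<omega>) =
      (\<Sum>i\<in>UNIV. \<Sum>k\<in>UNIV. (b - a) * expectation (Y i k k))"
    unfolding eq using iw(3,4) by (simp add: Bochner_Integration.integral_sum)
  also have "\<dots> = (b - a) * expectation (\<lambda>\<omega>. \<Sum>i\<in>UNIV. \<Sum>k\<in>UNIV. Y i k k \<omega>)"
    using Yi by (simp add: Bochner_Integration.integral_sum sum_distrib_left)
  also have "(\<lambda>\<omega>. \<Sum>i\<in>UNIV. \<Sum>k\<in>UNIV. Y i k k \<omega>) = (\<lambda>\<omega>. \<xi> \<omega> \<bullet> \<eta> \<omega>)"
    unfolding Y_def inner_vec_def by simp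
  finally show "expectation (\<lambda>\<omega>. step_integral a b \<xi> \<omega> \<bullet> step_integral a b \<eta> \<omega>) =
      (b - a) * expectation (\<lambda>\<omega>. \<xi> \<omega> \<bullet> \<eta> \<omega>)" .
qed

end

section \<open>Elementary integrands and the isometry\<close>

context brownian begin

definition square_integrable :: "('w \<Rightarrow> 'a::euclidean_space) \<Rightarrow> bool" where
  "square_integrable J \<longleftrightarrow> J \<in> borel_measurable M \<and> integrable M (\<lambda>\<omega>. J \<omega> \<bullet> J \<omega>)"

lemma square_integrable_inner:
  fixes J K :: "'w \<Rightarrow> 'a::euclidean_space"
  assumes "square_integrable J" "square_integrable K"
  shows "integrable M (\<lambda>\<omega>. J \<omega> \<bullet> K \<omega>)"
proof (rule Bochner_Integration.integrable_bound[of _ "\<lambda>\<omega>. J \<omega> \<bullet> J \<omega> + K \<omega> \<bullet> K \<omega>"])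
  have "\<bar>x \<bullet> y\<bar> \<le> x \<bullet> x + y \<bullet> y" for x y :: 'a
    using inner_ge_zero[of "x - y"] inner_ge_zero[of "x + y"] inner_ge_zero[of x] inner_ge_zero[of y]
    by (simp add: inner_simps inner_commute abs_if)
  then show "AE \<omega> in M. norm (J \<omega> \<bullet> K \<omega>) \<le> norm (J \<omega> \<bullet> J \<omega> + K \<omega> \<bullet> K \<omega>)"
    by (auto simp: abs_le_iff intro!: AE_I2 order_trans[OF _ abs_ge_self])
qed (use assms in \<open>auto simp: square_integrable_def\<close>)

lemma square_integrable_add:
  fixes J K :: "'w \<Rightarrow> 'a::euclidean_space"
  assumes "square_integrable J" "square_integrable K"
  shows "square_integrable (\<lambda>\<omega>. J \<omega> + K \<omega>)"
  using assms square_integrable_inner[OF assms] unfolding square_integrable_def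
  by (auto simp: inner_add_left inner_add_right inner_commute)

lemma square_integrable_step:
  fixes \<xi> :: "'w \<Rightarrow> real^'r^'m"
  assumes "a \<le> b" "adapted_bounded a \<xi>"
  shows "square_integrable (step_integral a b \<xi>)"
  unfolding square_integrable_def
  using step_cov_same(1)[OF assms(1,2,2)] measurable_F_M[OF step_integral_measurable[OF assms(2,1)]] by auto

text \<open>For overlapping intervals both integrals are cut at the end points of the overlap; all products
  of integrals over disjoint pieces have mean zero, and only the overlap contributes.\<close>

lemma step_cov_aux:
  fixes \<xi> \<eta> :: "'w \<Rightarrow> real^'r^'m"
  assumes ab: "a \<le> b" "c \<le> d" "a \<le> c" and \<xi>: "adapted_bounded a \<xi>" and \<eta>: "adapted_bounded c \<eta>"
  shows "expectation (\<lambda>\<omega>. step_integral a b \<xi> \<omega> \<bullet> step_integral c d \<eta> \<omega>) =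
    max 0 (min b d - c) * expectation (\<lambda>\<omega>. \<xi> \<omega> \<bullet> \<eta> \<omega>)"
proof (cases "b \<le> c")
  case True
  then show ?thesis using step_cov_disjoint[OF ab(1) True ab(2) \<xi> \<eta>] by auto
next
  case False
  define m where "m = min b d"
  have m: "c \<le> m" "m \<le> b" "m \<le> d" "m = b \<or> m = d" using False ab unfolding m_def by auto
  have \<xi>c: "adapted_bounded c \<xi>" and \<xi>m: "adapted_bounded m \<xi>" and \<eta>m: "adapted_bounded m \<eta>"
    using adapted_bounded_mono[OF \<xi>] adapted_bounded_mono[OF \<eta>] m ab by auto
  note sq = square_integrable_inner[OF square_integrable_step square_integrable_step]
  have last: "step_integral m b \<xi> \<omega> \<bullet> step_integral m d \<eta> \<omega> = 0" for \<omega> using m(4) by auto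
  have eq: "step_integral a b \<xi> \<omega> \<bullet> step_integral c d \<eta> \<omega> =
      step_integral a c \<xi> \<omega> \<bullet> step_integral c d \<eta> \<omega> + step_integral c m \<xi> \<omega> \<bullet> step_integral c m \<eta> \<omega> +
      step_integral c m \<xi> \<omega> \<bullet> step_integral m d \<eta> \<omega> + step_integral c m \<eta> \<omega> \<bullet> step_integral m b \<xi> \<omega>" for \<omega>
    using last[of \<omega>] step_integral_split[of a b \<xi> \<omega> c] step_integral_split[of c b \<xi> \<omega> m]
      step_integral_split[of c d \<eta> \<omega> m]
    by (simp add: inner_add_left inner_add_right inner_commute)
  have 1: "expectation (\<lambda>\<omega>. step_integral a c \<xi> \<omega> \<bullet> step_integral c d \<eta> \<omega>) = 0"
    using step_cov_disjoint[OF ab(3) order_refl ab(2) \<xi> \<eta>] .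
  have 2: "expectation (\<lambda>\<omega>. step_integral c m \<xi> \<omega> \<bullet> step_integral m d \<eta> \<omega>) = 0"
    using step_cov_disjoint[OF m(1) order_refl m(3) \<xi>c \<eta>m] .
  have 3: "expectation (\<lambda>\<omega>. step_integral c m \<eta> \<omega> \<bullet> step_integral m b \<xi> \<omega>) = 0"
    using step_cov_disjoint[OF m(1) order_refl m(2) \<eta> \<xi>m] .
  have i: "integrable M (\<lambda>\<omega>. step_integral a c \<xi> \<omega> \<bullet> step_integral c d \<eta> \<omega>)"
    "integrable M (\<lambda>\<omega>. step_integral c m \<xi> \<omega> \<bullet> step_integral c m \<eta> \<omega>)"
    "integrable M (\<lambda>\<omega>. step_integral c m \<xi> \<omega> \<bullet> step_integral m d \<eta> \<omega>)"
    "integrable M (\<lambda>\<omega>. step_integral c m \<eta> \<omega> \<bullet> step_integral m b \<xi> \<omega>)"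
    by (rule sq; use ab m \<xi> \<eta> \<xi>c \<xi>m \<eta>m in auto)+
  have "expectation (\<lambda>\<omega>. step_integral a b \<xi> \<omega> \<bullet> step_integral c d \<eta> \<omega>) =
      expectation (\<lambda>\<omega>. step_integral c m \<xi> \<omega> \<bullet> step_integral c m \<eta> \<omega>)"
    unfolding eq using i 1 2 3 by simp
  also have "\<dots> = (m - c) * expectation (\<lambda>\<omega>. \<xi> \<omega> \<bullet> \<eta> \<omega>)"
    using step_cov_same(2)[OF m(1) \<xi>c \<eta>] .
  finally show ?thesis using m(1) unfolding m_def by simp
qed

lemma step_cov:
  fixes \<xi> \<eta> :: "'w \<Rightarrow> real^'r^'m"
  assumes ab: "a \<le> b" "c \<le> d" and \<xi>: "adapted_bounded a \<xi>" and \<eta>: "adapted_bounded c \<eta>"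
  shows "expectation (\<lambda>\<omega>. step_integral a b \<xi> \<omega> \<bullet> step_integral c d \<eta> \<omega>) =
    max 0 (min b d - max a c) * expectation (\<lambda>\<omega>. \<xi> \<omega> \<bullet> \<eta> \<omega>)"
proof (cases "a \<le> c")
  case True
  then show ?thesis using step_cov_aux[OF ab True \<xi> \<eta>] by (simp add: max_def)
next
  case False
  then show ?thesis using step_cov_aux[OF ab(2,1) _ \<eta> \<xi>]
    by (simp add: max_def min_def inner_commute split: if_splits)
qed

text \<open>Pairs of an elementary integrand and its stochastic integral. No ordering or disjointness of
  the intervals is imposed, so that the class is closed under addition by definition and the
  bilinear isometry follows by induction from the case of two single steps.\<close>

inductive elementary :: "(real \<Rightarrow> 'w \<Rightarrow> real^'r^'m) \<Rightarrow> ('w \<Rightarrow> real^'m) \<Rightarrow> bool" where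
  step: "a \<le> b \<Longrightarrow> adapted_bounded a \<xi> \<Longrightarrow>
    elementary (\<lambda>s \<omega>. indicator {a<..b} s *\<^sub>R \<xi> \<omega>) (step_integral a b \<xi>)"
| add: "elementary \<Phi> J \<Longrightarrow> elementary \<Psi> K \<Longrightarrow>
    elementary (\<lambda>s \<omega>. \<Phi> s \<omega> + \<Psi> s \<omega>) (\<lambda>\<omega>. J \<omega> + K \<omega>)"

abbreviation "P_time \<equiv> lborel \<Otimes>\<^sub>M M"

lemma elementary_square_integrable: "elementary \<Phi> J \<Longrightarrow> square_integrable J"
  by (induction rule: elementary.induct) (auto intro: square_integrable_step square_integrable_add)

lemma step_integrand_measurable:
  fixes \<xi> :: "'w \<Rightarrow> real^'r^'m"
  assumes "adapted_bounded a \<xi>"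
  shows "(\<lambda>(s, \<omega>). indicator {a<..b} s *\<^sub>R \<xi> \<omega>) \<in> borel_measurable P_time"
proof -
  have [measurable]: "\<xi> \<in> borel_measurable M"
    using assms measurable_F_M unfolding adapted_bounded_def by blast
  show ?thesis by measurable
qed

lemma elementary_measurable:
  "elementary \<Phi> J \<Longrightarrow> (\<lambda>(s, \<omega>). \<Phi> s \<omega>) \<in> borel_measurable P_time"
proof (induction rule: elementary.induct)
  case (step a b \<xi>)
  then show ?case by (intro step_integrand_measurable)
next
  case (add \<Phi> J \<Psi> K)
  then show ?case by (simp add: case_prod_beta')
qed

lemma elementary_inner_step:
  fixes \<xi> \<eta> :: "'w \<Rightarrow> real^'r^'m"
  assumes \<xi>: "adapted_bounded a \<xi>" and \<eta>: "adapted_bounded c \<eta>"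
  shows "integrable P_time (\<lambda>(s, \<omega>). (indicator {a<..b} s *\<^sub>R \<xi> \<omega>) \<bullet> (indicator {c<..d} s *\<^sub>R \<eta> \<omega>))"
    and "(LINT z|P_time. (case z of (s, \<omega>) \<Rightarrow> (indicator {a<..b} s *\<^sub>R \<xi> \<omega>) \<bullet> (indicator {c<..d} s *\<^sub>R \<eta> \<omega>))) =
      max 0 (min b d - max a c) * expectation (\<lambda>\<omega>. \<xi> \<omega> \<bullet> \<eta> \<omega>)"
proof -
  interpret pair_sigma_finite lborel M ..
  define I where "I = {max a c<..min b d}"
  have eq: "(indicator {a<..b} s *\<^sub>R \<xi> \<omega>) \<bullet> (indicator {c<..d} s *\<^sub>R \<eta> \<omega>) = indicator I s * (\<xi> \<omega> \<bullet> \<eta> \<omega>)" for s \<omega>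
    unfolding I_def by (auto simp: indicator_def)
  have [measurable]: "\<xi> \<in> borel_measurable M" "\<eta> \<in> borel_measurable M"
    using \<xi> \<eta> measurable_F_M unfolding adapted_bounded_def by blast+
  obtain C D where CD: "\<And>\<omega>. \<omega> \<in> space M \<Longrightarrow> norm (\<xi> \<omega>) \<le> C" "\<And>\<omega>. \<omega> \<in> space M \<Longrightarrow> norm (\<eta> \<omega>) \<le> D"
    using \<xi> \<eta> unfolding adapted_bounded_def by auto
  have int: "integrable M (\<lambda>\<omega>. \<xi> \<omega> \<bullet> \<eta> \<omega>)"
  proof (rule integrable_const_bound[of _ "C * D"])
    show "AE \<omega> in M. norm (\<xi> \<omega> \<bullet> \<eta> \<omega>) \<le> C * D"
    proof (rule AE_I2)
      fix \<omega> assume "\<omega> \<in> space M"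
      from CD[OF this] show "norm (\<xi> \<omega> \<bullet> \<eta> \<omega>) \<le> C * D"
        using order_trans[OF Cauchy_Schwarz_ineq2[of "\<xi> \<omega>" "\<eta> \<omega>"] mult_mono[of "norm (\<xi> \<omega>)" C "norm (\<eta> \<omega>)" D]]
          order_trans[OF norm_ge_zero[of "\<xi> \<omega>"]] by auto
    qed
  qed simp
  have intI: "integrable lborel (indicator I :: real \<Rightarrow> real)"
    unfolding I_def by (cases "max a c \<le> min b d") (auto intro!: integrable_real_indicator)
  show 1: "integrable P_time (\<lambda>(s, \<omega>). (indicator {a<..b} s *\<^sub>R \<xi> \<omega>) \<bullet> (indicator {c<..d} s *\<^sub>R \<eta> \<omega>))"
    unfolding eq by (rule Fubini_integrable) (use int intI in \<open>auto simp: abs_mult\<close>)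
  have "(LINT z|P_time. (case z of (s, \<omega>) \<Rightarrow> (indicator {a<..b} s *\<^sub>R \<xi> \<omega>) \<bullet> (indicator {c<..d} s *\<^sub>R \<eta> \<omega>))) =
      (LINT s|lborel. LINT \<omega>|M. indicator I s * (\<xi> \<omega> \<bullet> \<eta> \<omega>))"
    using integral_fst'[OF 1] unfolding eq by simp
  also have "\<dots> = max 0 (min b d - max a c) * expectation (\<lambda>\<omega>. \<xi> \<omega> \<bullet> \<eta> \<omega>)"
    unfolding I_def by (cases "max a c \<le> min b d") (auto simp: max_def min_def)
  finally show "(LINT z|P_time. (case z of (s, \<omega>) \<Rightarrow> (indicator {a<..b} s *\<^sub>R \<xi> \<omega>) \<bullet> (indicator {c<..d} s *\<^sub>R \<eta> \<omega>))) =
      max 0 (min b d - max a c) * expectation (\<lambda>\<omega>. \<xi> \<omega> \<bullet> \<eta> \<omega>)" .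
qed

text \<open>Both sides are bilinear, so it suffices to compare two steps, where each side is the length of the
  overlap times the mean of \<open>\<xi> \<bullet> \<eta>\<close>.\<close>

lemma elementary_isometry:
  assumes "elementary \<Phi> J" "elementary \<Psi> K"
  shows "integrable P_time (\<lambda>(s, \<omega>). \<Phi> s \<omega> \<bullet> \<Psi> s \<omega>) \<and>
    expectation (\<lambda>\<omega>. J \<omega> \<bullet> K \<omega>) = (LINT z|P_time. (case z of (s, \<omega>) \<Rightarrow> \<Phi> s \<omega> \<bullet> \<Psi> s \<omega>))"
  using assms(1)
proof (induction rule: elementary.induct)
  case (add \<Phi>1 J1 \<Phi>2 J2)
  then show ?case
    using square_integrable_inner[OF elementary_square_integrable[OF add(1)] elementary_square_integrable[OF assms(2)]]
      square_integrable_inner[OF elementary_square_integrable[OF add(2)] elementary_square_integrable[OF assms(2)]]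
    by (simp add: case_prod_beta' inner_add_left)
next
  case (step a b \<xi>)
  note \<xi> = step
  show ?case using assms(2)
  proof (induction rule: elementary.induct)
    case (step c d \<eta>)
    then show ?case using elementary_inner_step[OF \<xi>(2) step(2)] step_cov[OF \<xi>(1) step(1) \<xi>(2) step(2)] by simp
  next
    case (add \<Phi>1 J1 \<Phi>2 J2)
    then show ?case
      using square_integrable_inner[OF square_integrable_step[OF \<xi>] elementary_square_integrable[OF add(1)]]
        square_integrable_inner[OF square_integrable_step[OF \<xi>] elementary_square_integrable[OF add(2)]]
      by (simp add: case_prod_beta' inner_add_right del: inner_scaleR_left)
  qed
qed

lemma elementary_nn_isometry:
  fixes \<Phi> :: "real \<Rightarrow> 'w \<Rightarrow> real^'r^'m"
  assumes "elementary \<Phi> J"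
  shows "second_moment J = (\<integral>\<^sup>+(s, \<omega>). ennreal ((norm (\<Phi> s \<omega>))\<^sup>2) \<partial>P_time)"
proof -
  have "second_moment J = ennreal (expectation (\<lambda>\<omega>. J \<omega> \<bullet> J \<omega>))"
    using elementary_square_integrable[OF assms] unfolding square_integrable_def
    by (subst nn_integral_eq_integral[symmetric]) (auto simp: power2_norm_eq_inner)
  also have "expectation (\<lambda>\<omega>. J \<omega> \<bullet> J \<omega>) = (LINT z|P_time. (case z of (s, \<omega>) \<Rightarrow> \<Phi> s \<omega> \<bullet> \<Phi> s \<omega>))"
    using elementary_isometry[OF assms assms] by simp
  also have "ennreal \<dots> = (\<integral>\<^sup>+(s, \<omega>). ennreal ((norm (\<Phi> s \<omega>))\<^sup>2) \<partial>P_time)"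
    using elementary_isometry[OF assms assms]
    by (subst nn_integral_eq_integral[symmetric]) (auto simp: power2_norm_eq_inner case_prod_beta')
  finally show ?thesis .
qed

lemma elementary_zero: "elementary (\<lambda>s \<omega>. 0) (\<lambda>\<omega>. 0)"
proof -
  have "adapted_bounded 0 (\<lambda>\<omega>. 0 :: real^'r^'m)" unfolding adapted_bounded_def by auto
  from elementary.step[OF order_refl this] show ?thesis
    by (simp add: step_integral_def[abs_def] zero_vec_def[symmetric])
qed

lemma elementary_uminus: "elementary \<Phi> J \<Longrightarrow> elementary (\<lambda>s \<omega>. - \<Phi> s \<omega>) (\<lambda>\<omega>. - J \<omega>)"
proof (induction rule: elementary.induct)
  case (step a b \<xi>)
  then have "adapted_bounded a (\<lambda>\<omega>. - \<xi> \<omega>)" unfolding adapted_bounded_def by auto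
  moreover have "step_integral a b (\<lambda>\<omega>. - \<xi> \<omega>) = (\<lambda>\<omega>. - step_integral a b \<xi> \<omega>)"
    by (simp add: fun_eq_iff vec_eq_iff step_integral_nth sum_negf)
  ultimately show ?case
    using elementary.step[OF step(1), of "\<lambda>\<omega>. - \<xi> \<omega>"] by simp
next
  case (add \<Phi> J \<Psi> K)
  from elementary.add[OF add.IH] show ?case by (simp add: add.commute)
qed

lemma elementary_diff:
  assumes "elementary \<Phi> J" "elementary \<Psi> K"
  shows "elementary (\<lambda>s \<omega>. \<Phi> s \<omega> - \<Psi> s \<omega>) (\<lambda>\<omega>. J \<omega> - K \<omega>)"
  using elementary.add[OF assms(1) elementary_uminus[OF assms(2)]] by simp

text \<open>Cutting an elementary integral at time \<open>s\<close>: the part after \<open>s\<close> remains an elementary integral when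
  it is multiplied by the indicator of an event known at time \<open>s\<close>.\<close>

lemma elementary_restrict:
  assumes "elementary \<Phi> J" "0 \<le> s" "A \<in> sets (F s)"
  shows "\<exists>J1. elementary (\<lambda>u \<omega>. indicator {..s} u *\<^sub>R \<Phi> u \<omega>) J1 \<and>
    elementary (\<lambda>u \<omega>. (indicator {s<..} u * indicator A \<omega>) *\<^sub>R \<Phi> u \<omega>) (\<lambda>\<omega>. indicator A \<omega> *\<^sub>R (J \<omega> - J1 \<omega>))"
  using assms(1)
proof (induction rule: elementary.induct)
  case (step a b \<xi>)
  have ab: "adapted_bounded (max a s) (\<lambda>\<omega>. indicator A \<omega> *\<^sub>R \<xi> \<omega>)"
  proof -
    have \<xi>: "adapted_bounded (max a s) \<xi>" using adapted_bounded_mono[OF step(2)] by simp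
    have A: "A \<in> sets (F (max a s))" using sets_F_mono[of s "max a s"] assms(3) by auto
    from \<xi> obtain C where C: "\<And>\<omega>. \<omega> \<in> space M \<Longrightarrow> norm (\<xi> \<omega>) \<le> C"
      unfolding adapted_bounded_def by auto
    have "norm (indicator A \<omega> *\<^sub>R \<xi> \<omega>) \<le> C" if "\<omega> \<in> space M" for \<omega>
      using C[OF that] order_trans[OF norm_ge_zero C[OF that]] by (cases "\<omega> \<in> A") auto
    then show ?thesis using \<xi> A unfolding adapted_bounded_def
      by (auto intro!: borel_measurable_scaleR borel_measurable_indicator)
  qed
  have e2: "elementary (\<lambda>u \<omega>. indicator {max a s<..max b s} u *\<^sub>R indicator A \<omega> *\<^sub>R \<xi> \<omega>)
      (step_integral (max a s) (max b s) (\<lambda>\<omega>. indicator A \<omega> *\<^sub>R \<xi> \<omega>))"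
    using elementary.step[OF _ ab] step(1) by (simp add: max.coboundedI1)
  have eq: "indicator {max a s<..max b s} u *\<^sub>R indicator A \<omega> *\<^sub>R \<xi> \<omega> =
      (indicator {s<..} u * indicator A \<omega>) *\<^sub>R (indicator {a<..b} u *\<^sub>R \<xi> \<omega>)" for u \<omega>
    by (auto simp: indicator_def)
  have eqJ: "step_integral (max a s) (max b s) (\<lambda>\<omega>. indicator A \<omega> *\<^sub>R \<xi> \<omega>) \<omega> =
      indicator A \<omega> *\<^sub>R step_integral (max a s) (max b s) \<xi> \<omega>" for \<omega>
    unfolding step_integral_def by (auto simp: indicator_def)
  show ?case
  proof (cases "a \<le> s")
    case True
    have "elementary (\<lambda>u \<omega>. indicator {a<..min b s} u *\<^sub>R \<xi> \<omega>) (step_integral a (min b s) \<xi>)"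
      using step True by (intro elementary.step) auto
    moreover have "indicator {a<..min b s} u *\<^sub>R \<xi> \<omega> = indicator {..s} u *\<^sub>R (indicator {a<..b} u *\<^sub>R \<xi> \<omega>)" for u \<omega>
      by (auto simp: indicator_def)
    moreover have "step_integral (max a s) (max b s) \<xi> \<omega> = step_integral a b \<xi> \<omega> - step_integral a (min b s) \<xi> \<omega>" for \<omega>
      using step_integral_split[of a b \<xi> \<omega> "min b s"] True by (auto simp: max_def min_def)
    ultimately show ?thesis using e2 unfolding eq eqJ by (intro exI[of _ "step_integral a (min b s) \<xi>"]) simp
  next
    case False
    have z: "(\<lambda>u \<omega>. indicator {..s} u *\<^sub>R (indicator {a<..b} u *\<^sub>R \<xi> \<omega>)) = (\<lambda>u \<omega>. 0)"
      using False by (auto simp: indicator_def fun_eq_iff)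
    have m: "max a s = a" "max b s = b" using False step(1) by auto
    have J: "step_integral (max a s) (max b s) (\<lambda>\<omega>. indicator A \<omega> *\<^sub>R \<xi> \<omega>) =
        (\<lambda>\<omega>. indicator A \<omega> *\<^sub>R (step_integral a b \<xi> \<omega> - 0))"
      using eqJ unfolding fun_eq_iff m by simp
    show ?thesis
      using e2[unfolded eq J] elementary_zero unfolding z by (intro exI[of _ "\<lambda>_. 0"] conjI)
  qed
next
  case (add \<Phi> J \<Psi> K)
  then obtain J1 K1 where "elementary (\<lambda>u \<omega>. indicator {..s} u *\<^sub>R \<Phi> u \<omega>) J1"
    "elementary (\<lambda>u \<omega>. (indicator {s<..} u * indicator A \<omega>) *\<^sub>R \<Phi> u \<omega>) (\<lambda>\<omega>. indicator A \<omega> *\<^sub>R (J \<omega> - J1 \<omega>))"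
    "elementary (\<lambda>u \<omega>. indicator {..s} u *\<^sub>R \<Psi> u \<omega>) K1"
    "elementary (\<lambda>u \<omega>. (indicator {s<..} u * indicator A \<omega>) *\<^sub>R \<Psi> u \<omega>) (\<lambda>\<omega>. indicator A \<omega> *\<^sub>R (K \<omega> - K1 \<omega>))"
    by blast
  from elementary.add[OF this(1,3)] elementary.add[OF this(2,4)] show ?case
    by (intro exI[of _ "\<lambda>\<omega>. J1 \<omega> + K1 \<omega>"]) (simp add: algebra_simps)
qed

end

section \<open>Limits of elementary integrals\<close>

lemma nn_integral_square_add:
  fixes f g :: "'a \<Rightarrow> 'b::{real_normed_vector, second_countable_topology}"
  assumes [measurable]: "f \<in> borel_measurable N" "g \<in> borel_measurable N"
  shows "(\<integral>\<^sup>+z. ennreal ((norm (f z + g z))\<^sup>2) \<partial>N) \<le>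
    2 * (\<integral>\<^sup>+z. ennreal ((norm (f z))\<^sup>2) \<partial>N) + 2 * (\<integral>\<^sup>+z. ennreal ((norm (g z))\<^sup>2) \<partial>N)"
proof -
  have le: "(norm (x + y))\<^sup>2 \<le> 2 * (norm x)\<^sup>2 + 2 * (norm y)\<^sup>2" for x y :: 'b
  proof -
    have "(norm (x + y))\<^sup>2 \<le> (norm x + norm y)\<^sup>2"
      by (intro power_mono norm_triangle_ineq norm_ge_zero)
    also have "\<dots> \<le> 2 * (norm x)\<^sup>2 + 2 * (norm y)\<^sup>2"
      using sum_squares_ge_zero[of "norm x - norm y" 0] by (simp add: power2_eq_square algebra_simps)
    finally show ?thesis .
  qed
  have "(\<integral>\<^sup>+z. ennreal ((norm (f z + g z))\<^sup>2) \<partial>N) \<le>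
      (\<integral>\<^sup>+z. 2 * ennreal ((norm (f z))\<^sup>2) + 2 * ennreal ((norm (g z))\<^sup>2) \<partial>N)"
  proof (rule nn_integral_mono)
    fix z
    have "ennreal ((norm (f z + g z))\<^sup>2) \<le> ennreal (2 * (norm (f z))\<^sup>2 + 2 * (norm (g z))\<^sup>2)"
      by (intro ennreal_leI le)
    then show "ennreal ((norm (f z + g z))\<^sup>2) \<le> 2 * ennreal ((norm (f z))\<^sup>2) + 2 * ennreal ((norm (g z))\<^sup>2)"
      by (simp add: ennreal_plus ennreal_mult)
  qed
  also have "\<dots> = 2 * (\<integral>\<^sup>+z. ennreal ((norm (f z))\<^sup>2) \<partial>N) + 2 * (\<integral>\<^sup>+z. ennreal ((norm (g z))\<^sup>2) \<partial>N)"
    by (subst nn_integral_add) (auto simp: nn_integral_cmult)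
  finally show ?thesis .
qed

lemma (in prob_space) prob_gt_le_second_moment:
  fixes J :: "'a \<Rightarrow> 'b::{real_normed_vector, second_countable_topology}"
  assumes [measurable]: "J \<in> borel_measurable M" and "0 < c" "0 \<le> B"
    and B: "second_moment J \<le> ennreal B"
  shows "\<P>(\<omega> in M. norm (J \<omega>) > c) \<le> B / c\<^sup>2"
proof -
  let ?S = "{\<omega>\<in>space M. norm (J \<omega>) > c}"
  have "ennreal (c\<^sup>2 * prob ?S) = (\<integral>\<^sup>+\<omega>. ennreal (c\<^sup>2) * indicator ?S \<omega> \<partial>M)"
    by (subst nn_integral_cmult_indicator) (auto simp: emeasure_eq_measure ennreal_mult)
  also have "\<dots> \<le> second_moment J"
    using assms(2) by (intro nn_integral_mono) (auto simp: indicator_def intro!: ennreal_leI power_mono)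
  also note B
  finally have "c\<^sup>2 * prob ?S \<le> B" using assms(3) by simp
  then show ?thesis using assms(2) by (simp add: field_simps)
qed

context brownian begin

definition energy :: "(real \<Rightarrow> 'w \<Rightarrow> 'b::real_normed_vector) \<Rightarrow> ennreal" where
  "energy H = (\<integral>\<^sup>+z. ennreal ((norm (H (fst z) (snd z)))\<^sup>2) \<partial>P_time)"

definition jointly_measurable :: "(real \<Rightarrow> 'w \<Rightarrow> 'b::topological_space) \<Rightarrow> bool" where
  "jointly_measurable H \<longleftrightarrow> (\<lambda>z. H (fst z) (snd z)) \<in> borel_measurable P_time"

lemma energy_add:
  fixes H K :: "real \<Rightarrow> 'w \<Rightarrow> 'b::{real_normed_vector, second_countable_topology}"
  assumes "jointly_measurable H" "jointly_measurable K"
  shows "energy (\<lambda>s \<omega>. H s \<omega> + K s \<omega>) \<le> 2 * energy H + 2 * energy K"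
  using assms unfolding energy_def jointly_measurable_def by (intro nn_integral_square_add)

lemma energy_uminus: "energy (\<lambda>s \<omega>. - H s \<omega>) = energy H"
  unfolding energy_def by simp

lemma energy_mono:
  assumes "\<And>s \<omega>. \<omega> \<in> space M \<Longrightarrow> norm (H s \<omega>) \<le> norm (K s \<omega>)"
  shows "energy H \<le> energy K"
  unfolding energy_def by (intro nn_integral_mono ennreal_leI power_mono) (auto simp: space_pair_measure assms)

lemma jointly_measurable_add:
  fixes H K :: "real \<Rightarrow> 'w \<Rightarrow> 'b::{real_normed_vector, second_countable_topology}"
  assumes "jointly_measurable H" "jointly_measurable K"
  shows "jointly_measurable (\<lambda>s \<omega>. H s \<omega> + K s \<omega>)"
  using assms unfolding jointly_measurable_def by (intro borel_measurable_add)

lemma jointly_measurable_diff: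
  fixes H K :: "real \<Rightarrow> 'w \<Rightarrow> 'b::{real_normed_vector, second_countable_topology}"
  assumes "jointly_measurable H" "jointly_measurable K"
  shows "jointly_measurable (\<lambda>s \<omega>. H s \<omega> - K s \<omega>)"
  using assms unfolding jointly_measurable_def by (intro borel_measurable_diff)

lemma jointly_measurable_uminus:
  fixes H :: "real \<Rightarrow> 'w \<Rightarrow> 'b::{real_normed_vector, second_countable_topology}"
  assumes "jointly_measurable H"
  shows "jointly_measurable (\<lambda>s \<omega>. - H s \<omega>)"
  using assms unfolding jointly_measurable_def by (intro borel_measurable_uminus)

lemma jointly_measurable_elementary: "elementary \<Phi> J \<Longrightarrow> jointly_measurable \<Phi>"
  using elementary_measurable unfolding jointly_measurable_def by (simp add: case_prod_beta')

lemma elementary_energy: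
  "elementary \<Phi> J \<Longrightarrow> second_moment J = energy \<Phi>"
  using elementary_nn_isometry[of \<Phi> J] unfolding energy_def by (simp add: case_prod_beta')

text \<open>\<open>L\<^sup>2\<close>-approximation of the integrand, but only approximation in probability of the integral. By
  the isometry the elementary integrals converge in \<open>L\<^sup>2\<close> as well; asking for
  less here makes the closure properties and the comparison with the general integral easier.\<close>

definition ito_limit :: "(real \<Rightarrow> 'w \<Rightarrow> real^'r^'m) \<Rightarrow> ('w \<Rightarrow> real^'m) \<Rightarrow> bool" where
  "ito_limit H I \<longleftrightarrow> jointly_measurable H \<and> I \<in> borel_measurable M \<and>
    (\<forall>\<epsilon>>0. \<exists>\<Phi> J. elementary \<Phi> J \<and> energy (\<lambda>s \<omega>. H s \<omega> - \<Phi> s \<omega>) \<le> ennreal \<epsilon> \<and>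
      \<P>(\<omega> in M. norm (I \<omega> - J \<omega>) > \<epsilon>) \<le> \<epsilon>)"

lemma elementary_borel: "elementary \<Phi> J \<Longrightarrow> J \<in> borel_measurable M"
  using elementary_square_integrable unfolding square_integrable_def by blast

lemma ito_limitE:
  assumes "ito_limit H I" "0 < \<epsilon>"
  obtains \<Phi> J where "elementary \<Phi> J" "energy (\<lambda>s \<omega>. H s \<omega> - \<Phi> s \<omega>) \<le> ennreal \<epsilon>"
    "\<P>(\<omega> in M. norm (I \<omega> - J \<omega>) > \<epsilon>) \<le> \<epsilon>"
  using assms unfolding ito_limit_def by blast

lemma ennreal_twice_add:
  assumes "x \<le> ennreal a" "y \<le> ennreal b" "0 \<le> a" "0 \<le> b"
  shows "2 * x + 2 * y \<le> ennreal (2 * a + 2 * b)"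
proof -
  have "2 * x + 2 * y \<le> 2 * ennreal a + 2 * ennreal b"
    using assms by (intro add_mono mult_left_mono) auto
  also have "\<dots> = ennreal (2 * a + 2 * b)"
    using assms by (simp add: ennreal_plus ennreal_mult)
  finally show ?thesis .
qed

lemma prob_gt_add:
  fixes J K :: "'w \<Rightarrow> 'b::{real_normed_vector, second_countable_topology}"
  assumes [measurable]: "J \<in> borel_measurable M" "K \<in> borel_measurable M"
    and le: "\<And>\<omega>. \<omega> \<in> space M \<Longrightarrow> norm (L \<omega>) \<le> norm (J \<omega>) + norm (K \<omega>)" and "a + b \<le> c"
  shows "\<P>(\<omega> in M. norm (L \<omega>) > c) \<le> \<P>(\<omega> in M. norm (J \<omega>) > a) + \<P>(\<omega> in M. norm (K \<omega>) > b)"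
proof -
  have "{\<omega>\<in>space M. norm (L \<omega>) > c} \<subseteq> {\<omega>\<in>space M. norm (J \<omega>) > a} \<union> {\<omega>\<in>space M. norm (K \<omega>) > b}"
  proof safe
    fix \<omega> assume "\<omega> \<in> space M" "c < norm (L \<omega>)" "\<not> b < norm (K \<omega>)"
    then show "a < norm (J \<omega>)" using le[of \<omega>] assms(4) by linarith
  qed
  then have "\<P>(\<omega> in M. norm (L \<omega>) > c) \<le> prob ({\<omega>\<in>space M. norm (J \<omega>) > a} \<union> {\<omega>\<in>space M. norm (K \<omega>) > b})"
    by (intro finite_measure_mono) auto
  also have "\<dots> \<le> \<P>(\<omega> in M. norm (J \<omega>) > a) + \<P>(\<omega> in M. norm (K \<omega>) > b)"
    by (intro measure_Un_le) auto
  finally show ?thesis .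
qed

lemma ito_limit_zero: "ito_limit (\<lambda>s \<omega>. 0 :: real^'r^'m) (\<lambda>\<omega>. 0)"
proof -
  have "energy (\<lambda>s \<omega>. 0 :: real^'r^'m) = 0" unfolding energy_def by simp
  then show ?thesis
    using elementary_zero unfolding ito_limit_def jointly_measurable_def
    by (auto intro!: exI[of _ "\<lambda>s \<omega>. 0"] exI[of _ "\<lambda>\<omega>. 0"])
qed

lemma ito_limit_uminus:
  assumes "ito_limit H I" shows "ito_limit (\<lambda>s \<omega>. - H s \<omega>) (\<lambda>\<omega>. - I \<omega>)"
  unfolding ito_limit_def
proof (intro conjI allI impI)
  show "jointly_measurable (\<lambda>s \<omega>. - H s \<omega>)" "(\<lambda>\<omega>. - I \<omega>) \<in> borel_measurable M"
    using assms unfolding ito_limit_def jointly_measurable_def by auto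
  fix \<epsilon> :: real assume "0 < \<epsilon>"
  then obtain \<Phi> J where "elementary \<Phi> J" "energy (\<lambda>s \<omega>. H s \<omega> - \<Phi> s \<omega>) \<le> ennreal \<epsilon>"
    "\<P>(\<omega> in M. norm (I \<omega> - J \<omega>) > \<epsilon>) \<le> \<epsilon>"
    using ito_limitE[OF assms] by blast
  then show "\<exists>\<Phi> J. elementary \<Phi> J \<and> energy (\<lambda>s \<omega>. - H s \<omega> - \<Phi> s \<omega>) \<le> ennreal \<epsilon> \<and>
      \<P>(\<omega> in M. norm (- I \<omega> - J \<omega>) > \<epsilon>) \<le> \<epsilon>"
    using elementary_uminus[of \<Phi> J] energy_uminus[of "\<lambda>s \<omega>. H s \<omega> - \<Phi> s \<omega>"]
    by (intro exI[of _ "\<lambda>s \<omega>. - \<Phi> s \<omega>"] exI[of _ "\<lambda>\<omega>. - J \<omega>"])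
      (simp add: norm_minus_commute)
qed

lemma ito_limit_add:
  assumes H: "ito_limit H I" and K: "ito_limit K L"
  shows "ito_limit (\<lambda>s \<omega>. H s \<omega> + K s \<omega>) (\<lambda>\<omega>. I \<omega> + L \<omega>)"
  unfolding ito_limit_def
proof (intro conjI allI impI)
  have m: "jointly_measurable H" "jointly_measurable K"
    and [measurable]: "I \<in> borel_measurable M" "L \<in> borel_measurable M"
    using H K unfolding ito_limit_def by auto
  show "jointly_measurable (\<lambda>s \<omega>. H s \<omega> + K s \<omega>)" "(\<lambda>\<omega>. I \<omega> + L \<omega>) \<in> borel_measurable M"
    using m by (auto intro: jointly_measurable_add)
  fix \<epsilon> :: real assume "0 < \<epsilon>"
  then have \<epsilon>: "0 < \<epsilon> / 4" by simp
  obtain \<Phi> J where J: "elementary \<Phi> J" "energy (\<lambda>s \<omega>. H s \<omega> - \<Phi> s \<omega>) \<le> ennreal (\<epsilon> / 4)"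
    "\<P>(\<omega> in M. norm (I \<omega> - J \<omega>) > \<epsilon> / 4) \<le> \<epsilon> / 4"
    using ito_limitE[OF H \<epsilon>] by blast
  obtain \<Psi> N where N: "elementary \<Psi> N" "energy (\<lambda>s \<omega>. K s \<omega> - \<Psi> s \<omega>) \<le> ennreal (\<epsilon> / 4)"
    "\<P>(\<omega> in M. norm (L \<omega> - N \<omega>) > \<epsilon> / 4) \<le> \<epsilon> / 4"
    using ito_limitE[OF K \<epsilon>] by blast
  have [measurable]: "J \<in> borel_measurable M" "N \<in> borel_measurable M"
    using J(1) N(1) elementary_borel by auto
  have "energy (\<lambda>s \<omega>. (H s \<omega> + K s \<omega>) - (\<Phi> s \<omega> + \<Psi> s \<omega>)) =
      energy (\<lambda>s \<omega>. (H s \<omega> - \<Phi> s \<omega>) + (K s \<omega> - \<Psi> s \<omega>))"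
    by (simp add: algebra_simps)
  also have "\<dots> \<le> 2 * energy (\<lambda>s \<omega>. H s \<omega> - \<Phi> s \<omega>) + 2 * energy (\<lambda>s \<omega>. K s \<omega> - \<Psi> s \<omega>)"
    by (rule energy_add[OF jointly_measurable_diff[OF m(1) jointly_measurable_elementary[OF J(1)]]
          jointly_measurable_diff[OF m(2) jointly_measurable_elementary[OF N(1)]]])
  also have "\<dots> \<le> ennreal (2 * (\<epsilon> / 4) + 2 * (\<epsilon> / 4))"
    using \<epsilon> by (intro ennreal_twice_add J N) auto
  finally have e: "energy (\<lambda>s \<omega>. (H s \<omega> + K s \<omega>) - (\<Phi> s \<omega> + \<Psi> s \<omega>)) \<le> ennreal \<epsilon>" by simp
  have "\<P>(\<omega> in M. norm ((I \<omega> + L \<omega>) - (J \<omega> + N \<omega>)) > \<epsilon>) \<le>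
      \<P>(\<omega> in M. norm (I \<omega> - J \<omega>) > \<epsilon> / 4) + \<P>(\<omega> in M. norm (L \<omega> - N \<omega>) > \<epsilon> / 4)"
    using \<epsilon> by (intro prob_gt_add) (auto intro: norm_diff_triangle_ineq)
  also have "\<dots> \<le> \<epsilon>" using J(3) N(3) \<epsilon> by simp
  finally show "\<exists>\<Phi> J. elementary \<Phi> J \<and> energy (\<lambda>s \<omega>. H s \<omega> + K s \<omega> - \<Phi> s \<omega>) \<le> ennreal \<epsilon> \<and>
      \<P>(\<omega> in M. norm (I \<omega> + L \<omega> - J \<omega>) > \<epsilon>) \<le> \<epsilon>"
    using e elementary.add[OF J(1) N(1)] by blast
qed

lemma ito_limit_diff:
  assumes "ito_limit H I" "ito_limit K L"
  shows "ito_limit (\<lambda>s \<omega>. H s \<omega> - K s \<omega>) (\<lambda>\<omega>. I \<omega> - L \<omega>)"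
  using ito_limit_add[OF assms(1) ito_limit_uminus[OF assms(2)]] by simp

lemma ito_limit_sum:
  assumes "\<And>j. j < (N::nat) \<Longrightarrow> ito_limit (H j) (I j)"
  shows "ito_limit (\<lambda>s \<omega>. \<Sum>j<N. H j s \<omega>) (\<lambda>\<omega>. \<Sum>j<N. I j \<omega>)"
  using assms
proof (induction N)
  case 0
  show ?case by (simp add: ito_limit_zero)
next
  case (Suc N)
  then show ?case using ito_limit_add[OF Suc.IH Suc.prems[of N]] by simp
qed

text \<open>The elementary integral \<open>J2\<close> obtained by cutting an approximation of the integral of \<open>H\<close> need
  not be the chosen approximation \<open>K\<close> of the integral up to \<open>s\<close>; the isometry makes their difference
  small, and the second moment bounds its tail.\<close>

lemma ito_limit_restrict:
  assumes H: "ito_limit H I" and H1: "ito_limit (\<lambda>u \<omega>. indicator {..s} u *\<^sub>R H u \<omega>) I1"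
    and s: "0 \<le> s" and A: "A \<in> sets (F s)"
  shows "ito_limit (\<lambda>u \<omega>. (indicator {s<..} u * indicator A \<omega>) *\<^sub>R H u \<omega>) (\<lambda>\<omega>. indicator A \<omega> *\<^sub>R (I \<omega> - I1 \<omega>))"
  unfolding ito_limit_def
proof (intro conjI allI impI)
  have m: "jointly_measurable H" "jointly_measurable (\<lambda>u \<omega>. indicator {..s} u *\<^sub>R H u \<omega>)"
    and [measurable]: "I \<in> borel_measurable M" "I1 \<in> borel_measurable M" "A \<in> sets M"
    using H H1 A sets_F unfolding ito_limit_def by auto
  show "jointly_measurable (\<lambda>u \<omega>. (indicator {s<..} u * indicator A \<omega>) *\<^sub>R H u \<omega>)"
    using m(1) unfolding jointly_measurable_def by simp
  show "(\<lambda>\<omega>. indicator A \<omega> *\<^sub>R (I \<omega> - I1 \<omega>)) \<in> borel_measurable M" by simp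
  fix \<epsilon> :: real assume e0: "0 < \<epsilon>"
  \<comment> \<open>The tail of \<open>K - J2\<close> at \<open>\<epsilon>/3\<close> is at most \<open>4\<delta>/(\<epsilon>/3)\<^sup>2 = 36\<delta>/\<epsilon>\<^sup>2\<close>, which has to be at most \<open>\<epsilon>/3\<close>.\<close>
  define \<delta> where "\<delta> = min (\<epsilon> / 3) (\<epsilon>^3 / 108)"
  have \<delta>: "0 < \<delta>" "\<delta> \<le> \<epsilon> / 3" "\<delta> \<le> \<epsilon>^3 / 108" using e0 unfolding \<delta>_def by auto
  obtain \<Phi> J where J: "elementary \<Phi> J" "energy (\<lambda>s \<omega>. H s \<omega> - \<Phi> s \<omega>) \<le> ennreal \<delta>"
    "\<P>(\<omega> in M. norm (I \<omega> - J \<omega>) > \<delta>) \<le> \<delta>"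
    using ito_limitE[OF H \<delta>(1)] by blast
  obtain \<Psi> K where K: "elementary \<Psi> K" "energy (\<lambda>u \<omega>. indicator {..s} u *\<^sub>R H u \<omega> - \<Psi> u \<omega>) \<le> ennreal \<delta>"
    "\<P>(\<omega> in M. norm (I1 \<omega> - K \<omega>) > \<delta>) \<le> \<delta>"
    using ito_limitE[OF H1 \<delta>(1)] by blast
  obtain J2 where J2: "elementary (\<lambda>u \<omega>. indicator {..s} u *\<^sub>R \<Phi> u \<omega>) J2"
    "elementary (\<lambda>u \<omega>. (indicator {s<..} u * indicator A \<omega>) *\<^sub>R \<Phi> u \<omega>) (\<lambda>\<omega>. indicator A \<omega> *\<^sub>R (J \<omega> - J2 \<omega>))"
    using elementary_restrict[OF J(1) s A] by blast
  have [measurable]: "J \<in> borel_measurable M" "K \<in> borel_measurable M" "J2 \<in> borel_measurable M"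
    using J(1) K(1) J2(1) elementary_borel by auto
  have "energy (\<lambda>u \<omega>. (indicator {s<..} u * indicator A \<omega>) *\<^sub>R H u \<omega> - (indicator {s<..} u * indicator A \<omega>) *\<^sub>R \<Phi> u \<omega>) \<le>
      energy (\<lambda>s \<omega>. H s \<omega> - \<Phi> s \<omega>)"
    by (intro energy_mono) (auto simp: indicator_def)
  also have "\<dots> \<le> ennreal \<epsilon>" using order_trans[OF J(2) ennreal_leI[of \<delta> \<epsilon>]] \<delta>(2) e0 by simp
  finally have e: "energy (\<lambda>u \<omega>. (indicator {s<..} u * indicator A \<omega>) *\<^sub>R H u \<omega> -
      (indicator {s<..} u * indicator A \<omega>) *\<^sub>R \<Phi> u \<omega>) \<le> ennreal \<epsilon>" .
  have d: "elementary (\<lambda>u \<omega>. \<Psi> u \<omega> - indicator {..s} u *\<^sub>R \<Phi> u \<omega>) (\<lambda>\<omega>. K \<omega> - J2 \<omega>)"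
    by (rule elementary_diff[OF K(1) J2(1)])
  have "second_moment (\<lambda>\<omega>. K \<omega> - J2 \<omega>) = energy (\<lambda>u \<omega>. \<Psi> u \<omega> - indicator {..s} u *\<^sub>R \<Phi> u \<omega>)"
    by (rule elementary_energy[OF d])
  also have "\<dots> = energy (\<lambda>u \<omega>. - (indicator {..s} u *\<^sub>R H u \<omega> - \<Psi> u \<omega>) + (indicator {..s} u *\<^sub>R H u \<omega> - indicator {..s} u *\<^sub>R \<Phi> u \<omega>))"
    by (simp add: algebra_simps)
  also have "\<dots> \<le> 2 * energy (\<lambda>u \<omega>. - (indicator {..s} u *\<^sub>R H u \<omega> - \<Psi> u \<omega>)) +
      2 * energy (\<lambda>u \<omega>. indicator {..s} u *\<^sub>R H u \<omega> - indicator {..s} u *\<^sub>R \<Phi> u \<omega>)"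
    by (rule energy_add[OF jointly_measurable_uminus[OF jointly_measurable_diff[OF m(2) jointly_measurable_elementary[OF K(1)]]]
          jointly_measurable_diff[OF m(2) jointly_measurable_elementary[OF J2(1)]]])
  also have "\<dots> \<le> ennreal (2 * \<delta> + 2 * \<delta>)"
  proof (intro ennreal_twice_add)
    show "energy (\<lambda>u \<omega>. - (indicator {..s} u *\<^sub>R H u \<omega> - \<Psi> u \<omega>)) \<le> ennreal \<delta>"
      using K(2) unfolding energy_uminus .
    have "energy (\<lambda>u \<omega>. indicator {..s} u *\<^sub>R H u \<omega> - indicator {..s} u *\<^sub>R \<Phi> u \<omega>) \<le> energy (\<lambda>s \<omega>. H s \<omega> - \<Phi> s \<omega>)"
      by (intro energy_mono) (auto simp: indicator_def)
    then show "energy (\<lambda>u \<omega>. indicator {..s} u *\<^sub>R H u \<omega> - indicator {..s} u *\<^sub>R \<Phi> u \<omega>) \<le> ennreal \<delta>"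
      using J(2) by simp
  qed (use \<delta> in auto)
  finally have "\<P>(\<omega> in M. norm (K \<omega> - J2 \<omega>) > \<epsilon> / 3) \<le> (2 * \<delta> + 2 * \<delta>) / (\<epsilon> / 3)\<^sup>2"
    using \<delta> e0 by (intro prob_gt_le_second_moment) auto
  also have "\<dots> = 36 * \<delta> / \<epsilon>\<^sup>2" by (simp add: power2_eq_square)
  also have "\<dots> \<le> 36 * (\<epsilon>^3 / 108) / \<epsilon>\<^sup>2" using \<delta>(3) by (intro divide_right_mono) auto
  also have "\<dots> = \<epsilon> / 3" using e0 by (simp add: power2_eq_square power3_eq_cube)
  finally have p3: "\<P>(\<omega> in M. norm (K \<omega> - J2 \<omega>) > \<epsilon> / 3) \<le> \<epsilon> / 3" .
  have "\<P>(\<omega> in M. norm (indicator A \<omega> *\<^sub>R (I \<omega> - I1 \<omega>) - indicator A \<omega> *\<^sub>R (J \<omega> - J2 \<omega>)) > \<epsilon>) \<le>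
      \<P>(\<omega> in M. norm (norm (I \<omega> - J \<omega>) + norm (I1 \<omega> - K \<omega>)) > \<delta> + \<delta>) + \<P>(\<omega> in M. norm (norm (K \<omega> - J2 \<omega>)) > \<epsilon> / 3)"
  proof (intro prob_gt_add)
    fix \<omega>
    have eq: "I \<omega> - I1 \<omega> - (J \<omega> - J2 \<omega>) = (I \<omega> - J \<omega>) - (I1 \<omega> - K \<omega>) - (K \<omega> - J2 \<omega>)" by simp
    have "norm (I \<omega> - I1 \<omega> - (J \<omega> - J2 \<omega>)) \<le> norm (I \<omega> - J \<omega>) + norm (I1 \<omega> - K \<omega>) + norm (K \<omega> - J2 \<omega>)"
      using norm_triangle_ineq4[of "(I \<omega> - J \<omega>) - (I1 \<omega> - K \<omega>)" "K \<omega> - J2 \<omega>"]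
        norm_triangle_ineq4[of "I \<omega> - J \<omega>" "I1 \<omega> - K \<omega>"] unfolding eq by linarith
    then show "norm (indicator A \<omega> *\<^sub>R (I \<omega> - I1 \<omega>) - indicator A \<omega> *\<^sub>R (J \<omega> - J2 \<omega>)) \<le>
        norm (norm (I \<omega> - J \<omega>) + norm (I1 \<omega> - K \<omega>)) + norm (norm (K \<omega> - J2 \<omega>))"
      by (auto simp: indicator_def)
  qed (use \<delta> in auto)
  also have "\<P>(\<omega> in M. norm (norm (I \<omega> - J \<omega>) + norm (I1 \<omega> - K \<omega>)) > \<delta> + \<delta>) \<le>
      \<P>(\<omega> in M. norm (I \<omega> - J \<omega>) > \<delta>) + \<P>(\<omega> in M. norm (I1 \<omega> - K \<omega>) > \<delta>)"
    by (intro prob_gt_add) auto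
  finally have "\<P>(\<omega> in M. norm (indicator A \<omega> *\<^sub>R (I \<omega> - I1 \<omega>) - indicator A \<omega> *\<^sub>R (J \<omega> - J2 \<omega>)) > \<epsilon>) \<le> \<epsilon>"
    using p3 J(3) K(3) \<delta>(2) by simp
  with e J2(2) show "\<exists>\<Phi> J. elementary \<Phi> J \<and>
      energy (\<lambda>u \<omega>. (indicator {s<..} u * indicator A \<omega>) *\<^sub>R H u \<omega> - \<Phi> u \<omega>) \<le> ennreal \<epsilon> \<and>
      \<P>(\<omega> in M. norm (indicator A \<omega> *\<^sub>R (I \<omega> - I1 \<omega>) - J \<omega>) > \<epsilon>) \<le> \<epsilon>"
    by blast
qed

text \<open>Fatou's lemma along approximations that converge almost surely by Borel--Cantelli. The factor
  \<open>2\<close> comes from comparing the energies of \<open>H\<close> and of its approximations by \<open>(a + b)\<^sup>2 \<le> 2 a\<^sup>2 + 2 b\<^sup>2\<close>.\<close>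

lemma ito_limit_second_moment:
  assumes H: "ito_limit H I"
  shows "second_moment I \<le> 2 * energy H"
proof -
  have m: "jointly_measurable H" and [measurable]: "I \<in> borel_measurable M"
    using H unfolding ito_limit_def by auto
  define \<epsilon> :: "nat \<Rightarrow> real" where "\<epsilon> n = (1/2)^n" for n
  have pos: "0 < \<epsilon> n" for n unfolding \<epsilon>_def by simp
  define P where "P n \<Phi> J \<longleftrightarrow> elementary \<Phi> J \<and> energy (\<lambda>s \<omega>. H s \<omega> - \<Phi> s \<omega>) \<le> ennreal (\<epsilon> n) \<and>
      \<P>(\<omega> in M. norm (I \<omega> - J \<omega>) > \<epsilon> n) \<le> \<epsilon> n" for n \<Phi> J
  have "\<forall>n. \<exists>\<Phi> J. P n \<Phi> J"
    using H pos unfolding ito_limit_def P_def by blast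
  then have "\<exists>\<Phi>. \<forall>n. \<exists>J. P n (\<Phi> n) J" by (rule choice)
  then obtain \<Phi> where "\<forall>n. \<exists>J. P n (\<Phi> n) J" ..
  then have "\<exists>J. \<forall>n. P n (\<Phi> n) (J n)" by (rule choice)
  then obtain J where J': "\<forall>n. P n (\<Phi> n) (J n)" ..
  have J: "elementary (\<Phi> n) (J n)" "energy (\<lambda>s \<omega>. H s \<omega> - \<Phi> n s \<omega>) \<le> ennreal (\<epsilon> n)"
    "\<P>(\<omega> in M. norm (I \<omega> - J n \<omega>) > \<epsilon> n) \<le> \<epsilon> n" for n
    using J' unfolding P_def by auto
  have [measurable]: "J n \<in> borel_measurable M" for n using elementary_borel[OF J(1)] .
  have sum: "summable \<epsilon>" unfolding \<epsilon>_def by (intro summable_geometric) simp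
  have "AE \<omega> in M. eventually (\<lambda>n. \<omega> \<in> space M - {\<omega>\<in>space M. norm (I \<omega> - J n \<omega>) > \<epsilon> n}) sequentially"
  proof (rule borel_cantelli_AE1)
    show "summable (\<lambda>n. \<P>(\<omega> in M. norm (I \<omega> - J n \<omega>) > \<epsilon> n))"
      using J(3) by (intro summable_comparison_test[OF _ sum]) auto
  qed (auto simp: emeasure_eq_measure)
  then have conv: "AE \<omega> in M. (\<lambda>n. J n \<omega>) \<longlonglongrightarrow> I \<omega>"
  proof eventually_elim
    case (elim \<omega>)
    then have "eventually (\<lambda>n. dist (J n \<omega>) (I \<omega>) \<le> \<epsilon> n) sequentially"
      by eventually_elim (auto simp: dist_norm norm_minus_commute)
    then have "eventually (\<lambda>n. norm (dist (J n \<omega>) (I \<omega>)) \<le> \<epsilon> n) sequentially" by simp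
    then have "(\<lambda>n. dist (J n \<omega>) (I \<omega>)) \<longlonglongrightarrow> 0"
      by (rule Lim_null_comparison) (rule summable_LIMSEQ_zero[OF sum])
    then show ?case by (rule tendsto_dist_iff[THEN iffD2])
  qed
  have bd: "second_moment (\<lambda>\<omega>. J n \<omega>) \<le> 2 * energy H + 2 * ennreal (\<epsilon> n)" for n
  proof -
    have "second_moment (\<lambda>\<omega>. J n \<omega>) = energy (\<lambda>s \<omega>. H s \<omega> + - (H s \<omega> - \<Phi> n s \<omega>))"
      using elementary_energy[OF J(1)] by simp
    also have "\<dots> \<le> 2 * energy H + 2 * energy (\<lambda>s \<omega>. - (H s \<omega> - \<Phi> n s \<omega>))"
      by (rule energy_add[OF m jointly_measurable_uminus[OF jointly_measurable_diff[OF m jointly_measurable_elementary[OF J(1)]]]])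
    also have "\<dots> \<le> 2 * energy H + 2 * ennreal (\<epsilon> n)"
      unfolding energy_uminus using J(2) by (intro add_mono mult_left_mono) auto
    finally show ?thesis .
  qed
  have "second_moment I = (\<integral>\<^sup>+\<omega>. liminf (\<lambda>n. ennreal ((norm (J n \<omega>))\<^sup>2)) \<partial>M)"
  proof (rule nn_integral_cong_AE, use conv in eventually_elim)
    case (elim \<omega>)
    then have "(\<lambda>n. ennreal ((norm (J n \<omega>))\<^sup>2)) \<longlonglongrightarrow> ennreal ((norm (I \<omega>))\<^sup>2)"
      by (intro tendsto_ennrealI tendsto_intros)
    then show ?case by (simp add: lim_imp_Liminf del: tendsto_ennreal_iff)
  qed
  also have "\<dots> \<le> liminf (\<lambda>n. \<integral>\<^sup>+\<omega>. ennreal ((norm (J n \<omega>))\<^sup>2) \<partial>M)"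
    by (intro nn_integral_liminf) simp
  also have "\<dots> \<le> liminf (\<lambda>n. 2 * energy H + 2 * ennreal (\<epsilon> n))"
    using bd by (intro Liminf_mono) auto
  also have "\<dots> = 2 * energy H"
  proof -
    have "(\<lambda>n. 2 * energy H + 2 * ennreal (\<epsilon> n)) \<longlonglongrightarrow> 2 * energy H + 2 * ennreal 0"
      using summable_LIMSEQ_zero[OF sum] by (intro tendsto_add tendsto_const ennreal_tendsto_cmult tendsto_ennrealI) auto
    then show ?thesis by (simp add: lim_imp_Liminf)
  qed
  finally show ?thesis .
qed

end

section \<open>Ito integrals of bounded integrands\<close>

lemma partition_mono:
  fixes t :: "nat \<Rightarrow> real"
  assumes "\<forall>i<k. t i \<le> t (Suc i)" "i \<le> j" "j \<le> k"
  shows "t i \<le> t j"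
  using assms(2,3)
proof (induction j)
  case (Suc j)
  show ?case
  proof (cases "i \<le> j")
    case True
    then have "t i \<le> t j" using Suc by simp
    moreover have "t j \<le> t (Suc j)" using Suc.prems assms(1) by simp
    ultimately show ?thesis by simp
  next
    case False
    then show ?thesis using Suc.prems by (simp add: le_Suc_eq)
  qed
qed simp

text \<open>The cells of a partition are disjoint, so at most one summand is not zero.\<close>

lemma partition_sum_map:
  fixes t :: "nat \<Rightarrow> real" and g :: "'a::real_vector \<Rightarrow> 'b::real_vector"
  assumes "\<forall>i<k. t i \<le> t (Suc i)" and "g 0 = 0"
  shows "g (\<Sum>i<k. indicator {t i<..t (Suc i)} s *\<^sub>R x i) = (\<Sum>i<k. indicator {t i<..t (Suc i)} s *\<^sub>R g (x i))"
  using assms(1)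
proof (induction k)
  case (Suc k)
  show ?case
  proof (cases "t k < s")
    case True
    have "indicator {t i<..t (Suc i)} s = (0::real)" if "i < k" for i
      using partition_mono[OF Suc.prems, of "Suc i" k] that True by (auto simp: indicator_def)
    then have z: "(\<Sum>i<k. indicator {t i<..t (Suc i)} s *\<^sub>R y i) = (0 :: 'c::real_vector)" for y
      by (intro sum.neutral) simp
    show ?thesis
      unfolding sum.lessThan_Suc z using assms(2) by (simp add: indicator_def)
  next
    case False
    then show ?thesis using Suc by simp
  qed
qed (simp add: assms(2))

text \<open>Summation stops before the partial sums exceed \<open>\<delta>\<close>.\<close>

lemma truncated_sum_le:
  fixes a :: "nat \<Rightarrow> real"
  assumes "\<And>i. i < k \<Longrightarrow> 0 \<le> a i" "0 \<le> \<delta>"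
  shows "(\<Sum>i<k. if (\<Sum>l\<le>i. a l) \<le> \<delta> then a i else 0) \<le> \<delta>"
  using assms(1)
proof (induction k)
  case (Suc k)
  show ?case
  proof (cases "(\<Sum>l\<le>k. a l) \<le> \<delta>")
    case True
    have "(\<Sum>i<Suc k. if (\<Sum>l\<le>i. a l) \<le> \<delta> then a i else 0) \<le> (\<Sum>i<Suc k. a i)"
      using Suc.prems by (intro sum_mono) auto
    also have "\<dots> = (\<Sum>l\<le>k. a l)" by (simp add: lessThan_Suc_atMost)
    finally show ?thesis using True by simp
  next
    case False
    then show ?thesis using Suc by simp
  qed
qed (simp add: assms(2))

context brownian begin

lemma elementary_sum:
  assumes "\<And>i. i < (k::nat) \<Longrightarrow> elementary (\<Phi> i) (J i)"
  shows "elementary (\<lambda>s \<omega>. \<Sum>i<k. \<Phi> i s \<omega>) (\<lambda>\<omega>. \<Sum>i<k. J i \<omega>)"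
  using assms
proof (induction k)
  case 0
  show ?case by (simp add: elementary_zero)
next
  case (Suc k)
  then show ?case using elementary.add[OF Suc.IH Suc.prems[of k]] by simp
qed

text \<open>Steps that start after \<open>T\<close> contribute nothing up to time \<open>T\<close>; they have to be discarded because
  their values are not known at time \<open>T\<close>.\<close>

lemma simple_integrand_elementary:
  fixes \<xi> :: "nat \<Rightarrow> 'w \<Rightarrow> real^'r^'m"
  assumes si: "simple_integrand M F k t \<xi>" and T: "0 \<le> T"
  shows "elementary (simple_process k (\<lambda>i. min (t i) T) \<xi>) (simple_integral W k t \<xi> T)"
proof -
  have t: "0 \<le> t 0" "\<forall>i<k. t i \<le> t (Suc i)"
    and \<xi>: "\<And>i. i < k \<Longrightarrow> \<xi> i \<in> borel_measurable (F (t i))" "\<exists>C. \<forall>i<k. \<forall>\<omega>\<in>space M. norm (\<xi> i \<omega>) \<le> C"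
    using si unfolding simple_integrand_def by auto
  have "elementary (\<lambda>s \<omega>. indicator {min (t i) T<..min (t (Suc i)) T} s *\<^sub>R \<xi> i \<omega>)
      (step_integral (min (t i) T) (min (t (Suc i)) T) (\<xi> i))" if i: "i < k" for i
  proof (cases "t i \<le> T")
    case True
    have "0 \<le> t i" using partition_mono[OF t(2), of 0 i] t(1) i by simp
    then have "adapted_bounded (t i) (\<xi> i)"
      using \<xi>(1)[OF i] \<xi>(2) i unfolding adapted_bounded_def by blast
    then show ?thesis using True t(2) i by (intro elementary.step) (auto simp: min_def)
  next
    case False
    moreover have "t i \<le> t (Suc i)" using t(2) i by simp
    ultimately have "min (t i) T = T" "min (t (Suc i)) T = T" by auto
    moreover have "step_integral T T (\<xi> i) = (\<lambda>\<omega>. 0)" by (simp add: fun_eq_iff)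
    ultimately show ?thesis using elementary_zero by simp
  qed
  from elementary_sum[OF this] show ?thesis
    unfolding simple_process_def[abs_def] simple_integral_def[abs_def] step_integral_def .
qed

lemma energy_eq_iterated:
  assumes "jointly_measurable H"
  shows "energy H = (\<integral>\<^sup>+\<omega>. \<integral>\<^sup>+s. ennreal ((norm (H s \<omega>))\<^sup>2) \<partial>lborel \<partial>M)"
    and "energy H = (\<integral>\<^sup>+s. \<integral>\<^sup>+\<omega>. ennreal ((norm (H s \<omega>))\<^sup>2) \<partial>M \<partial>lborel)"
proof -
  interpret pair_sigma_finite lborel M ..
  have m: "(\<lambda>z. ennreal ((norm (H (fst z) (snd z)))\<^sup>2)) \<in> borel_measurable P_time"
    using assms unfolding jointly_measurable_def by simp
  show "energy H = (\<integral>\<^sup>+\<omega>. \<integral>\<^sup>+s. ennreal ((norm (H s \<omega>))\<^sup>2) \<partial>lborel \<partial>M)"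
    unfolding energy_def using nn_integral_snd[OF m] by simp
  show "energy H = (\<integral>\<^sup>+s. \<integral>\<^sup>+\<omega>. ennreal ((norm (H s \<omega>))\<^sup>2) \<partial>M \<partial>lborel)"
    unfolding energy_def using sigma_finite_measure.nn_integral_fst[OF prob_space_imp_sigma_finite[OF prob_space_axioms] m] by simp
qed

lemma path_energy_measurable:
  assumes "jointly_measurable H"
  shows "(\<lambda>\<omega>. \<integral>\<^sup>+s. ennreal ((norm (H s \<omega>))\<^sup>2) \<partial>lborel) \<in> borel_measurable M"
proof -
  have "(\<lambda>z. ennreal ((norm (H (fst z) (snd z)))\<^sup>2)) \<in> borel_measurable P_time"
    using assms unfolding jointly_measurable_def by simp
  then have "(\<lambda>(\<omega>, s). ennreal ((norm (H s \<omega>))\<^sup>2)) \<in> borel_measurable (M \<Otimes>\<^sub>M lborel)"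
    by (subst measurable_pair_swap_iff) (simp add: case_prod_beta')
  then show ?thesis
    by (rule lborel.borel_measurable_nn_integral)
qed

lemma simple_process_energy:
  fixes \<xi> :: "nat \<Rightarrow> 'w \<Rightarrow> real^'r^'m"
  assumes "\<forall>i<k. t i \<le> t (Suc i)"
  shows "square_integral (\<lambda>s. simple_process k t \<xi> s \<omega>) =
    ennreal (\<Sum>i<k. (norm (\<xi> i \<omega>))\<^sup>2 * (t (Suc i) - t i))"
proof -
  have le: "t i \<le> t (Suc i)" if "i < k" for i using assms that by simp
  have pm: "(norm (simple_process k t \<xi> s \<omega>))\<^sup>2 = (\<Sum>i<k. indicator {t i<..t (Suc i)} s *\<^sub>R (norm (\<xi> i \<omega>))\<^sup>2)" for s
    using partition_sum_map[OF assms, of "\<lambda>x :: real^'r^'m. (norm x)\<^sup>2" s "\<lambda>i. \<xi> i \<omega>"]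
    unfolding simple_process_def by (simp only: norm_zero power_zero_numeral simp_thms)
  have "square_integral (\<lambda>s. simple_process k t \<xi> s \<omega>) =
      (\<integral>\<^sup>+s. (\<Sum>i<k. ennreal ((norm (\<xi> i \<omega>))\<^sup>2) * indicator {t i<..t (Suc i)} s) \<partial>lborel)"
    unfolding pm by (intro nn_integral_cong, subst sum_ennreal[symmetric])
      (auto simp: indicator_def intro!: sum.cong)
  also have "\<dots> = (\<Sum>i<k. ennreal ((norm (\<xi> i \<omega>))\<^sup>2) * ennreal (t (Suc i) - t i))"
    using le by (subst nn_integral_sum) (auto simp: nn_integral_cmult_indicator)
  also have "\<dots> = (\<Sum>i<k. ennreal ((norm (\<xi> i \<omega>))\<^sup>2 * (t (Suc i) - t i)))"
    by (intro sum.cong refl) (simp add: ennreal_mult' le)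
  also have "\<dots> = ennreal (\<Sum>i<k. (norm (\<xi> i \<omega>))\<^sup>2 * (t (Suc i) - t i))"
    using le by (intro sum_ennreal) simp
  finally show ?thesis .
qed

text \<open>A Lenglart inequality. The integrand is switched off as soon as its accumulated energy exceeds
  \<open>\<delta>\<close>. Whether a cell is switched off is known at its beginning, so the new integrand is simple with
  energy at most \<open>\<delta>\<close>, and its integral agrees with the given one where the full energy is at most \<open>\<delta>\<close>.\<close>

lemma simple_integral_tail:
  fixes \<xi> :: "nat \<Rightarrow> 'w \<Rightarrow> real^'r^'m"
  assumes si: "simple_integrand M F k t \<xi>" and T: "0 \<le> T" and \<delta>: "0 \<le> \<delta>" and \<epsilon>: "0 < \<epsilon>"
  shows "\<P>(\<omega> in M. norm (simple_integral W k t \<xi> T \<omega>) > \<epsilon>) \<le>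
    \<P>(\<omega> in M. square_integral (\<lambda>s. simple_process k (\<lambda>i. min (t i) T) \<xi> s \<omega>) > ennreal \<delta>) + \<delta> / \<epsilon>\<^sup>2"
proof -
  define t' where "t' i = min (t i) T" for i
  have t: "\<forall>i<k. t i \<le> t (Suc i)"
    and \<xi>: "\<And>i. i < k \<Longrightarrow> \<xi> i \<in> borel_measurable (F (t i))"
    using si unfolding simple_integrand_def by auto
  then have t': "\<forall>i<k. t' i \<le> t' (Suc i)" unfolding t'_def by (intro allI impI min.mono order_refl) simp
  define a where "a i \<omega> = (norm (\<xi> i \<omega>))\<^sup>2 * (t' (Suc i) - t' i)" for i \<omega>
  have a0: "0 \<le> a i \<omega>" if "i < k" for i \<omega> using t' that unfolding a_def by simp
  define \<eta> where "\<eta> i \<omega> = (if (\<Sum>l\<le>i. a l \<omega>) \<le> \<delta> then \<xi> i \<omega> else 0)" for i \<omega>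
  have am: "(\<lambda>\<omega>. \<Sum>l\<le>i. a l \<omega>) \<in> borel_measurable (F (t i))" if "i < k" for i
    unfolding a_def using that \<xi> measurable_F_mono[OF \<xi>] partition_mono[OF t]
    by (intro borel_measurable_sum borel_measurable_times borel_measurable_power borel_measurable_norm borel_measurable_const) auto
  have \<eta>: "simple_integrand M F k t \<eta>"
    unfolding simple_integrand_def
  proof (intro conjI allI impI)
    fix i assume i: "i < k"
    have "{\<omega>\<in>space (F (t i)). (\<Sum>l\<le>i. a l \<omega>) \<le> \<delta>} \<in> sets (F (t i))"
      using am[OF i] by measurable
    then show "\<eta> i \<in> borel_measurable (F (t i))"
      unfolding \<eta>_def using \<xi>[OF i] by (intro measurable_If) auto
  next
    obtain C where C: "\<forall>i<k. \<forall>\<omega>\<in>space M. norm (\<xi> i \<omega>) \<le> C"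
      using si unfolding simple_integrand_def by auto
    have "norm (\<eta> i \<omega>) \<le> C" if "i < k" "\<omega> \<in> space M" for i \<omega>
      using C that order_trans[OF norm_ge_zero, of "\<xi> i \<omega>" C] unfolding \<eta>_def by auto
    then show "\<exists>C. \<forall>i<k. \<forall>\<omega>\<in>space M. norm (\<eta> i \<omega>) \<le> C" by blast
  qed (use si in \<open>auto simp: simple_integrand_def\<close>)
  define J where "J = simple_integral W k t \<eta> T"
  have elt: "elementary (simple_process k t' \<eta>) J" "elementary (simple_process k t' \<xi>) (simple_integral W k t \<xi> T)"
    unfolding J_def t'_def using simple_integrand_elementary[OF \<eta> T] simple_integrand_elementary[OF si T] .
  have [measurable]: "J \<in> borel_measurable M" "simple_integral W k t \<xi> T \<in> borel_measurable M"
    using elt elementary_borel by auto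
  have le: "square_integral (\<lambda>s. simple_process k t' \<eta> s \<omega>) \<le> ennreal \<delta>" for \<omega>
  proof -
    have "(norm (\<eta> i \<omega>))\<^sup>2 * (t' (Suc i) - t' i) = (if (\<Sum>l\<le>i. a l \<omega>) \<le> \<delta> then a i \<omega> else 0)" for i
      unfolding \<eta>_def a_def by simp
    then show ?thesis
      unfolding simple_process_energy[OF t'] using truncated_sum_le[of k "\<lambda>i. a i \<omega>" \<delta>] a0 \<delta>
      by (intro ennreal_leI) simp
  qed
  have "second_moment J = energy (simple_process k t' \<eta>)"
    by (rule elementary_energy[OF elt(1)])
  also have "\<dots> = (\<integral>\<^sup>+\<omega>. \<integral>\<^sup>+s. ennreal ((norm (simple_process k t' \<eta> s \<omega>))\<^sup>2) \<partial>lborel \<partial>M)"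
    by (rule energy_eq_iterated(1)[OF jointly_measurable_elementary[OF elt(1)]])
  also have "\<dots> \<le> (\<integral>\<^sup>+\<omega>. ennreal \<delta> \<partial>M)" by (intro nn_integral_mono le)
  also have "\<dots> = ennreal \<delta>" by (simp add: emeasure_space_1)
  finally have J2: "\<P>(\<omega> in M. norm (J \<omega>) > \<epsilon>) \<le> \<delta> / \<epsilon>\<^sup>2"
    by (rule prob_gt_le_second_moment[OF \<open>J \<in> borel_measurable M\<close> \<epsilon> \<delta>])
  define Q where "Q = {\<omega>\<in>space M. square_integral (\<lambda>s. simple_process k t' \<xi> s \<omega>) > ennreal \<delta>}"
  have [measurable]: "Q \<in> sets M"
    unfolding Q_def using path_energy_measurable[OF jointly_measurable_elementary[OF elt(2)]] by measurable
  have eq: "J \<omega> = simple_integral W k t \<xi> T \<omega>" if "\<omega> \<in> space M" "\<omega> \<notin> Q" for \<omega>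
  proof -
    have s: "(\<Sum>i<k. a i \<omega>) \<le> \<delta>"
      using that \<delta> unfolding Q_def simple_process_energy[OF t'] a_def[symmetric] by (simp add: not_less ennreal_le_iff)
    have "\<eta> i \<omega> = \<xi> i \<omega>" if "i < k" for i
    proof -
      have "(\<Sum>l\<le>i. a l \<omega>) \<le> (\<Sum>i<k. a i \<omega>)" using that a0 by (intro sum_mono2) auto
      then show ?thesis using s unfolding \<eta>_def by simp
    qed
    then show ?thesis unfolding J_def simple_integral_def by simp
  qed
  have "{\<omega>\<in>space M. norm (simple_integral W k t \<xi> T \<omega>) > \<epsilon>} \<subseteq> Q \<union> {\<omega>\<in>space M. norm (J \<omega>) > \<epsilon>}"
    using eq by auto
  then have "\<P>(\<omega> in M. norm (simple_integral W k t \<xi> T \<omega>) > \<epsilon>) \<le> prob (Q \<union> {\<omega>\<in>space M. norm (J \<omega>) > \<epsilon>})"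
    by (intro finite_measure_mono) auto
  also have "\<dots> \<le> prob Q + \<P>(\<omega> in M. norm (J \<omega>) > \<epsilon>)"
    by (intro measure_Un_le) auto
  finally show ?thesis using J2 unfolding Q_def t'_def by simp
qed

text \<open>The approximating simple integrands need not have finite energy. Projecting their values to
  the ball of radius \<open>K\<close> brings them closer to \<open>H\<close> and makes them bounded, so that convergence in
  probability of the energies becomes convergence in \<open>L\<^sup>1\<close>. The integrals of the projections have the
  same limit by \<open>simple_integral_tail\<close>, since a point is at least as far from \<open>H\<close> as from its
  projection.\<close>

lemma ito_integral_ito_limit:
  fixes H :: "real \<Rightarrow> 'w \<Rightarrow> real^'r^'m"
  assumes ito: "is_ito_integral M F W H T I" and T: "0 \<le> T" and K: "0 \<le> K"
    and bound: "\<And>s \<omega>. \<omega> \<in> space M \<Longrightarrow> 0 \<le> s \<Longrightarrow> s \<le> T \<Longrightarrow> norm (H s \<omega>) \<le> K"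
  shows "ito_limit (\<lambda>s \<omega>. indicator {0<..T} s *\<^sub>R H s \<omega>) I"
proof -
  define H' where "H' s \<omega> = indicator {0<..T} s *\<^sub>R H s \<omega>" for s \<omega>
  have H'K: "norm (H' s \<omega>) \<le> K" if "\<omega> \<in> space M" for s \<omega>
    using bound[OF that, of s] K unfolding H'_def by (auto simp: indicator_def)
  have prog: "(\<lambda>(s, \<omega>). H s \<omega>) \<in> borel_measurable (restrict_space borel {0..T} \<Otimes>\<^sub>M F T)"
    and [measurable]: "I \<in> borel_measurable M"
    using ito T unfolding is_ito_integral_def progressively_measurable_def by auto
  have H'm: "jointly_measurable H'"
  proof -
    have c: "(\<lambda>s. max 0 (min s T)) \<in> measurable borel (restrict_space borel {0..T})"
      using T by (intro measurable_restrict_space2) auto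
    have id: "(\<lambda>\<omega>. \<omega>) \<in> measurable M (F T)"
      using sets_F[of T] by (auto simp: measurable_def intro: sets.Int_space_eq2)
    have "(\<lambda>z. (max 0 (min (fst z) T), snd z)) \<in> measurable P_time (restrict_space borel {0..T} \<Otimes>\<^sub>M F T)"
      by (intro measurable_Pair measurable_compose[OF _ c] measurable_compose[OF _ id]) auto
    from measurable_compose[OF this prog]
    have "(\<lambda>z. H (max 0 (min (fst z) T)) (snd z)) \<in> borel_measurable P_time" by simp
    then have "(\<lambda>z. indicator {0<..T} (fst z) *\<^sub>R H (max 0 (min (fst z) T)) (snd z)) \<in> borel_measurable P_time"
      by (intro borel_measurable_scaleR) auto
    also have "(\<lambda>z. indicator {0<..T} (fst z) *\<^sub>R H (max 0 (min (fst z) T)) (snd z)) = (\<lambda>z. H' (fst z) (snd z))"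
      unfolding H'_def by (auto simp: indicator_def fun_eq_iff max_def min_def)
    finally show ?thesis unfolding jointly_measurable_def .
  qed
  obtain k t \<xi> where si': "\<forall>j. simple_integrand M F (k j) (t j) (\<xi> j)"
    and c1': "\<forall>\<epsilon>>0. (\<lambda>j::nat. prob {\<omega>\<in>space M.
            (\<integral>\<^sup>+s\<in>{0..T}. ennreal ((norm (simple_process (k j) (t j) (\<xi> j) s \<omega> - H s \<omega>))\<^sup>2) \<partial>lborel)
              > ennreal \<epsilon>}) \<longlonglongrightarrow> 0"
    and c2': "\<forall>\<epsilon>>0. (\<lambda>j. prob {\<omega>\<in>space M.
            norm (simple_integral W (k j) (t j) (\<xi> j) T \<omega> - I \<omega>) > \<epsilon>}) \<longlonglongrightarrow> 0"
    using ito unfolding is_ito_integral_def by (elim conjE exE) (rule that)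
  have si: "simple_integrand M F (k j) (t j) (\<xi> j)" for j
    using si' by blast
  \<comment> \<open>The projection is nonexpansive, and no point of the ball is closer to \<open>y\<close> than \<open>clip y\<close>.\<close>
  define clip :: "real^'r^'m \<Rightarrow> real^'r^'m" where "clip = closest_point (cball 0 K)"
  have ne: "cball (0::real^'r^'m) K \<noteq> {}" using K by simp
  have clip_norm: "norm (clip y) \<le> K" for y
    using closest_point_in_set[OF closed_cball ne, of y] unfolding clip_def by simp
  have clip_id: "clip y = y" if "norm y \<le> K" for y
    unfolding clip_def using that by (intro closest_point_self) simp
  have clip_dist: "norm (clip y - h) \<le> norm (y - h)" if "norm h \<le> K" for y h
    using closest_point_lipschitz[OF convex_cball closed_cball ne, of y h] clip_id[OF that]
    unfolding clip_def dist_norm by simp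
  have clip_le: "norm (y - clip y) \<le> norm (y - h)" if "norm h \<le> K" for y h
    using closest_point_le[OF closed_cball, of h 0 K y] that unfolding clip_def dist_norm by simp
  have clip_m: "clip \<in> borel_measurable borel"
    unfolding clip_def by (intro borel_measurable_continuous_onI continuous_on_closest_point convex_cball closed_cball ne)
  define t' where "t' j i = min (t j i) T" for j i
  define \<Psi> where "\<Psi> j = simple_process (k j) (t' j) (\<xi> j)" for j
  define \<eta> where "\<eta> j i \<omega> = clip (\<xi> j i \<omega>)" for j i \<omega>
  define \<Phi> where "\<Phi> j = simple_process (k j) (t' j) (\<eta> j)" for j
  define J where "J j = simple_integral W (k j) (t j) (\<eta> j) T" for j
  have t0: "0 \<le> t j 0" and tm: "\<forall>i<k j. t j i \<le> t j (Suc i)"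
    and \<xi>m: "\<And>i. i < k j \<Longrightarrow> \<xi> j i \<in> borel_measurable (F (t j i))"
    and \<xi>b: "\<exists>C. \<forall>i<k j. \<forall>\<omega>\<in>space M. norm (\<xi> j i \<omega>) \<le> C" for j
    using si[of j] unfolding simple_integrand_def by auto
  have t'm: "\<forall>i<k j. t' j i \<le> t' j (Suc i)" for j
    unfolding t'_def using tm by (intro allI impI min.mono order_refl) simp
  have si\<eta>: "simple_integrand M F (k j) (t j) (\<eta> j)" for j
    unfolding simple_integrand_def \<eta>_def
    using t0 tm measurable_compose[OF \<xi>m clip_m] clip_norm by (auto intro!: exI[of _ K])
  have si\<zeta>: "simple_integrand M F (k j) (t j) (\<lambda>i \<omega>. \<xi> j i \<omega> - \<eta> j i \<omega>)" for j
  proof -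
    obtain C where C: "\<forall>i<k j. \<forall>\<omega>\<in>space M. norm (\<xi> j i \<omega>) \<le> C" using \<xi>b by blast
    have "\<forall>i<k j. \<forall>\<omega>\<in>space M. norm (\<xi> j i \<omega> - \<eta> j i \<omega>) \<le> C + K"
      using C clip_norm unfolding \<eta>_def by (intro allI impI ballI order_trans[OF norm_triangle_ineq4] add_mono) auto
    then show ?thesis
      using si\<eta>[of j] t0 tm \<xi>m unfolding simple_integrand_def by (auto intro!: borel_measurable_diff)
  qed
  have el\<Psi>: "elementary (\<Psi> j) (simple_integral W (k j) (t j) (\<xi> j) T)"
    and el\<Phi>: "elementary (\<Phi> j) (J j)" for j
    unfolding \<Psi>_def \<Phi>_def J_def t'_def
    using simple_integrand_elementary[OF si T] simple_integrand_elementary[OF si\<eta> T] .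
  have clip0: "clip 0 = 0" by (rule clip_id) (simp add: K)
  have \<Phi>clip: "\<Phi> j s \<omega> = clip (\<Psi> j s \<omega>)" for j s \<omega>
    unfolding \<Phi>_def \<Psi>_def simple_process_def \<eta>_def
    by (rule partition_sum_map[OF t'm, of clip, OF clip0, symmetric])
  have \<Psi>diff: "simple_process (k j) (t' j) (\<lambda>i \<omega>. \<xi> j i \<omega> - \<eta> j i \<omega>) s \<omega> = \<Psi> j s \<omega> - \<Phi> j s \<omega>" for j s \<omega>
    unfolding \<Phi>_def \<Psi>_def simple_process_def by (simp add: sum_subtractf scaleR_diff_right)
  have Jdiff: "simple_integral W (k j) (t j) (\<lambda>i \<omega>. \<xi> j i \<omega> - \<eta> j i \<omega>) T \<omega> =
      simple_integral W (k j) (t j) (\<xi> j) T \<omega> - J j \<omega>" for j \<omega>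
    unfolding J_def simple_integral_def by (simp add: sum_subtractf matrix_vector_mult_diff_rdistrib)
  define Q where "Q j \<omega> = square_integral (\<lambda>s. \<Psi> j s \<omega> - H' s \<omega>)" for j \<omega>
  have Qm [measurable]: "Q j \<in> borel_measurable M" for j
    unfolding Q_def
    by (rule path_energy_measurable[OF jointly_measurable_diff[OF jointly_measurable_elementary[OF el\<Psi>] H'm]])
  have Qeq: "(\<integral>\<^sup>+s\<in>{0..T}. ennreal ((norm (simple_process (k j) (t j) (\<xi> j) s \<omega> - H s \<omega>))\<^sup>2) \<partial>lborel) = Q j \<omega>" for j \<omega>
    unfolding Q_def
  proof (rule nn_integral_cong_AE, rule AE_mp[OF AE_lborel_singleton[of 0]], rule AE_I2, rule impI)
    fix s :: real assume s: "s \<noteq> 0"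
    have "\<Psi> j s \<omega> = indicator {0<..T} s *\<^sub>R simple_process (k j) (t j) (\<xi> j) s \<omega>"
      unfolding \<Psi>_def simple_process_def scaleR_sum_right
    proof (intro sum.cong refl)
      fix i assume "i \<in> {..<k j}"
      then have "0 \<le> t j i" using partition_mono[OF tm, of 0 i j] t0[of j] by simp
      then show "indicator {t' j i<..t' j (Suc i)} s *\<^sub>R \<xi> j i \<omega> =
          indicator {0<..T} s *\<^sub>R indicator {t j i<..t j (Suc i)} s *\<^sub>R \<xi> j i \<omega>"
        unfolding t'_def using s by (auto simp: indicator_def)
    qed
    then show "ennreal ((norm (simple_process (k j) (t j) (\<xi> j) s \<omega> - H s \<omega>))\<^sup>2) * indicator {0..T} s =
        ennreal ((norm (\<Psi> j s \<omega> - H' s \<omega>))\<^sup>2)"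
      unfolding H'_def using s by (auto simp: indicator_def)
  qed
  have cQ: "(\<lambda>j. \<P>(\<omega> in M. Q j \<omega> > ennreal \<epsilon>)) \<longlonglongrightarrow> 0" if "0 < \<epsilon>" for \<epsilon>
    using c1'[rule_format, OF that] unfolding Qeq .
  have Jm [measurable]: "J j \<in> borel_measurable M" "simple_integral W (k j) (t j) (\<xi> j) T \<in> borel_measurable M" for j
    using el\<Phi> el\<Psi> elementary_borel by auto
  have energy_le: "energy (\<lambda>s \<omega>. H' s \<omega> - \<Phi> j s \<omega>) \<le> ennreal (\<delta> + 4 * K\<^sup>2 * T * \<P>(\<omega> in M. Q j \<omega> > ennreal \<delta>))"
    if \<delta>: "0 \<le> \<delta>" for \<delta> j
  proof -
    let ?S = "{\<omega>\<in>space M. Q j \<omega> > ennreal \<delta>}"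
    have R: "square_integral (\<lambda>s. H' s \<omega> - \<Phi> j s \<omega>) \<le> ennreal \<delta> + ennreal (4 * K\<^sup>2 * T) * indicator ?S \<omega>"
      if \<omega>: "\<omega> \<in> space M" for \<omega>
    proof (cases "\<omega> \<in> ?S")
      case True
      have "norm (H' s \<omega> - \<Phi> j s \<omega>) \<le> 2 * K * indicator {0..T} s" for s
      proof (cases "0 < s \<and> s \<le> T")
        case True
        then show ?thesis
          using norm_triangle_ineq4[of "H' s \<omega>" "\<Phi> j s \<omega>"] H'K[OF \<omega>, of s] clip_norm[of "\<Psi> j s \<omega>"] unfolding \<Phi>clip by simp
      next
        case False
        have "s \<notin> {t' j i<..t' j (Suc i)}" if "i < k j" for i
          using partition_mono[OF tm, of 0 i j] t0[of j] T that False unfolding t'_def by auto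
        then have "\<Phi> j s \<omega> = 0"
          unfolding \<Phi>_def simple_process_def by (intro sum.neutral) simp
        moreover have "H' s \<omega> = 0" using False unfolding H'_def by auto
        ultimately show ?thesis using K by (simp add: indicator_def)
      qed
      then have "(norm (H' s \<omega> - \<Phi> j s \<omega>))\<^sup>2 \<le> (2 * K * indicator {0..T} s)\<^sup>2" for s
        by (intro power_mono) auto
      then have sq: "(norm (H' s \<omega> - \<Phi> j s \<omega>))\<^sup>2 \<le> 4 * K\<^sup>2 * indicator {0..T} s" for s
        by (rule order_trans) (auto simp: indicator_def power2_eq_square)
      have "square_integral (\<lambda>s. H' s \<omega> - \<Phi> j s \<omega>) \<le> (\<integral>\<^sup>+s. ennreal (4 * K\<^sup>2) * indicator {0..T} s \<partial>lborel)"
      proof (rule nn_integral_mono)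
        fix s
        show "ennreal ((norm (H' s \<omega> - \<Phi> j s \<omega>))\<^sup>2) \<le> ennreal (4 * K\<^sup>2) * indicator {0..T} s"
          using ennreal_leI[OF sq[of s]] by (auto simp: indicator_def)
      qed
      also have "\<dots> = ennreal (4 * K\<^sup>2 * T)"
        using T by (subst nn_integral_cmult_indicator) (auto simp: ennreal_mult)
      finally show ?thesis using True by (simp add: add_increasing)
    next
      case False
      have "square_integral (\<lambda>s. H' s \<omega> - \<Phi> j s \<omega>) \<le> Q j \<omega>"
        unfolding Q_def \<Phi>clip using clip_dist[OF H'K[OF \<omega>]]
        by (intro nn_integral_mono ennreal_leI power_mono) (subst norm_minus_commute, auto)
      also have "Q j \<omega> \<le> ennreal \<delta>" using False \<omega> by auto
      finally show ?thesis using False by simp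
    qed
    have "energy (\<lambda>s \<omega>. H' s \<omega> - \<Phi> j s \<omega>) = (\<integral>\<^sup>+\<omega>. \<integral>\<^sup>+s. ennreal ((norm (H' s \<omega> - \<Phi> j s \<omega>))\<^sup>2) \<partial>lborel \<partial>M)"
      by (rule energy_eq_iterated(1)[OF jointly_measurable_diff[OF H'm jointly_measurable_elementary[OF el\<Phi>]]])
    also have "\<dots> \<le> (\<integral>\<^sup>+\<omega>. ennreal \<delta> + ennreal (4 * K\<^sup>2 * T) * indicator ?S \<omega> \<partial>M)"
      by (intro nn_integral_mono R)
    also have "\<dots> = ennreal \<delta> + ennreal (4 * K\<^sup>2 * T) * emeasure M ?S"
      by (subst nn_integral_add) (auto simp: emeasure_space_1 nn_integral_cmult_indicator)
    also have "\<dots> = ennreal (\<delta> + 4 * K\<^sup>2 * T * prob ?S)"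
      using \<delta> T by (simp add: emeasure_eq_measure ennreal_mult[symmetric] ennreal_plus[symmetric] del: ennreal_plus)
    finally show ?thesis .
  qed
  have prob_le: "\<P>(\<omega> in M. norm (I \<omega> - J j \<omega>) > \<epsilon>) \<le>
      \<P>(\<omega> in M. norm (simple_integral W (k j) (t j) (\<xi> j) T \<omega> - I \<omega>) > \<epsilon> / 2) +
      (\<P>(\<omega> in M. Q j \<omega> > ennreal \<delta>) + \<delta> / (\<epsilon> / 2)\<^sup>2)" if \<epsilon>: "0 < \<epsilon>" and \<delta>: "0 \<le> \<delta>" for \<epsilon> \<delta> j
  proof -
    have "\<P>(\<omega> in M. norm (I \<omega> - J j \<omega>) > \<epsilon>) \<le>
      \<P>(\<omega> in M. norm (simple_integral W (k j) (t j) (\<xi> j) T \<omega> - I \<omega>) > \<epsilon> / 2) +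
      \<P>(\<omega> in M. norm (simple_integral W (k j) (t j) (\<xi> j) T \<omega> - J j \<omega>) > \<epsilon> / 2)"
      by (intro prob_gt_add) (auto intro: norm_diff_triangle_le simp: norm_minus_commute)
    also have "\<P>(\<omega> in M. norm (simple_integral W (k j) (t j) (\<xi> j) T \<omega> - J j \<omega>) > \<epsilon> / 2) \<le>
       \<P>(\<omega> in M. square_integral (\<lambda>s. \<Psi> j s \<omega> - \<Phi> j s \<omega>) > ennreal \<delta>) + \<delta> / (\<epsilon> / 2)\<^sup>2"
      using simple_integral_tail[OF si\<zeta>[of j] T \<delta>, of "\<epsilon> / 2"] \<epsilon>
      unfolding Jdiff t'_def[symmetric] \<Psi>diff by simp
    also have "\<P>(\<omega> in M. square_integral (\<lambda>s. \<Psi> j s \<omega> - \<Phi> j s \<omega>) > ennreal \<delta>) \<le>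
       \<P>(\<omega> in M. Q j \<omega> > ennreal \<delta>)"
    proof (rule finite_measure_mono)
      have "square_integral (\<lambda>s. \<Psi> j s \<omega> - \<Phi> j s \<omega>) \<le> Q j \<omega>" if \<omega>: "\<omega> \<in> space M" for \<omega>
        unfolding Q_def \<Phi>clip using clip_le[OF H'K[OF \<omega>]]
        by (intro nn_integral_mono ennreal_leI power_mono) auto
      then show "{\<omega>\<in>space M. square_integral (\<lambda>s. \<Psi> j s \<omega> - \<Phi> j s \<omega>) > ennreal \<delta>} \<subseteq>
          {\<omega>\<in>space M. Q j \<omega> > ennreal \<delta>}"
        by (auto intro: less_le_trans)
    qed simp
    finally show ?thesis by simp
  qed
  have "ito_limit H' I"
    unfolding ito_limit_def
  proof (intro conjI allI impI H'm)
    fix \<epsilon> :: real assume e0: "0 < \<epsilon>"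
    \<comment> \<open>The energy is at most \<open>\<delta> + 4 K\<^sup>2 T \<gamma>\<close>, the tail at most \<open>\<epsilon>/4 + \<gamma> + 4\<delta>/\<epsilon>\<^sup>2\<close>.\<close>
    define \<delta> where "\<delta> = min (\<epsilon> / 2) (\<epsilon>^3 / 16)"
    have \<delta>: "0 < \<delta>" "\<delta> \<le> \<epsilon> / 2" "\<delta> \<le> \<epsilon>^3 / 16" using e0 unfolding \<delta>_def by auto
    define \<gamma> where "\<gamma> = min (\<epsilon> / 4) (\<epsilon> / (2 * (4 * K\<^sup>2 * T + 1)))"
    have cpos: "0 < 4 * K\<^sup>2 * T + 1" using T by (intro add_nonneg_pos mult_nonneg_nonneg) auto
    have \<gamma>: "0 < \<gamma>" using e0 cpos unfolding \<gamma>_def by auto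
    have \<gamma>2: "\<gamma> \<le> \<epsilon> / 4" "\<gamma> \<le> \<epsilon> / (2 * (4 * K\<^sup>2 * T + 1))" unfolding \<gamma>_def by (rule min.cobounded1, rule min.cobounded2)
    have e2: "0 < \<epsilon> / 2" "0 < \<epsilon> / 4" using e0 by auto
    have "eventually (\<lambda>j. \<P>(\<omega> in M. Q j \<omega> > ennreal \<delta>) < \<gamma> \<and>
        \<P>(\<omega> in M. norm (simple_integral W (k j) (t j) (\<xi> j) T \<omega> - I \<omega>) > \<epsilon> / 2) < \<epsilon> / 4) sequentially"
      using order_tendstoD(2)[OF cQ[OF \<delta>(1)] \<gamma>] order_tendstoD(2)[OF c2'[rule_format, OF e2(1)] e2(2)]
      by eventually_elim simp
    then obtain j where j: "\<P>(\<omega> in M. Q j \<omega> > ennreal \<delta>) < \<gamma>"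
        "\<P>(\<omega> in M. norm (simple_integral W (k j) (t j) (\<xi> j) T \<omega> - I \<omega>) > \<epsilon> / 2) < \<epsilon> / 4"
      by (auto simp: eventually_sequentially)
    have "4 * K\<^sup>2 * T * \<P>(\<omega> in M. Q j \<omega> > ennreal \<delta>) \<le> (4 * K\<^sup>2 * T + 1) * (\<epsilon> / (2 * (4 * K\<^sup>2 * T + 1)))"
      using j(1) \<gamma>2(2) cpos T by (intro mult_mono) auto
    also have "\<dots> = \<epsilon> / 2" using cpos by (simp add: field_simps)
    finally have "energy (\<lambda>s \<omega>. H' s \<omega> - \<Phi> j s \<omega>) \<le> ennreal \<epsilon>"
      using \<delta> by (intro order_trans[OF energy_le[of \<delta> j]] ennreal_leI) auto
    moreover have "\<P>(\<omega> in M. norm (I \<omega> - J j \<omega>) > \<epsilon>) \<le> \<epsilon>"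
    proof -
      have "\<delta> / (\<epsilon> / 2)\<^sup>2 \<le> (\<epsilon>^3 / 16) / (\<epsilon> / 2)\<^sup>2" using \<delta>(3) by (intro divide_right_mono) auto
      also have "\<dots> = \<epsilon> / 4" using e0 by (simp add: power2_eq_square power3_eq_cube)
      finally show ?thesis using prob_le[OF e0 less_imp_le[OF \<delta>(1)], of j] j \<gamma>2(1) e0 by linarith
    qed
    ultimately show "\<exists>\<Phi> J. elementary \<Phi> J \<and> energy (\<lambda>s \<omega>. H' s \<omega> - \<Phi> s \<omega>) \<le> ennreal \<epsilon> \<and>
        \<P>(\<omega> in M. norm (I \<omega> - J \<omega>) > \<epsilon>) \<le> \<epsilon>"
      using el\<Phi> by blast
  qed simp
  then show ?thesis unfolding H'_def[abs_def] .
qed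

end

section \<open>Exit times and killed processes\<close>

lemma ereal_less_Inf_image_iff:
  "ereal t < Inf (ereal ` S) \<longleftrightarrow> (\<exists>r>t. \<forall>u\<in>S. r \<le> u)"
proof
  assume "ereal t < Inf (ereal ` S)"
  then obtain r where r: "ereal t < ereal r" "ereal r < Inf (ereal ` S)"
    by (metis ereal_dense2)
  then show "\<exists>r>t. \<forall>u\<in>S. r \<le> u"
    by (metis INF_lower ereal_less_eq(3) less_ereal.simps(1) less_imp_le order_trans)
next
  assume "\<exists>r>t. \<forall>u\<in>S. r \<le> u"
  then obtain r where "r > t" "\<forall>u\<in>S. r \<le> u" by blast
  then have "ereal r \<le> Inf (ereal ` S)" by (intro INF_greatest) auto
  with \<open>r > t\<close> show "ereal t < Inf (ereal ` S)" by (meson less_ereal.simps(1) less_le_trans)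
qed

lemma exit_time_le:
  assumes "0 < t" "\<zeta> \<omega> \<le> ereal t \<or> X t \<omega> \<notin> A"
  shows "exit_time X \<zeta> A \<omega> \<le> ereal t"
  unfolding exit_time_def using assms by (intro INF_lower) auto

lemma exit_time_nonneg: "0 \<le> exit_time X \<zeta> A \<omega>"
  unfolding exit_time_def by (intro INF_greatest) auto

lemma exit_time_mono: "A \<subseteq> B \<Longrightarrow> exit_time X \<zeta> A \<omega> \<le> exit_time X \<zeta> B \<omega>"
  unfolding exit_time_def by (intro INF_superset_mono) auto

lemma exit_time_le_lifetime:
  assumes "0 < \<zeta> \<omega>" shows "exit_time X \<zeta> A \<omega> \<le> \<zeta> \<omega>"
proof (cases "\<zeta> \<omega>")
  case (real z)
  then show ?thesis using exit_time_le[of z \<zeta> \<omega> X A] assms by auto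
qed (use assms in auto)

lemma less_exit_timeD:
  assumes "ereal t < exit_time X \<zeta> A \<omega>" "0 < s" "s \<le> t"
  shows "ereal s < \<zeta> \<omega> \<and> X s \<omega> \<in> A"
proof (rule ccontr)
  assume "\<not> (ereal s < \<zeta> \<omega> \<and> X s \<omega> \<in> A)"
  then have "exit_time X \<zeta> A \<omega> \<le> ereal s" using exit_time_le[OF assms(2), of \<zeta> \<omega> X A] by (auto simp: not_less)
  also have "\<dots> \<le> ereal t" using assms(3) by simp
  finally show False using assms(1) by simp
qed

text \<open>Continuity keeps the path in the open set for some time after \<open>t\<close>, so the infimum defining the
  exit time lies strictly beyond \<open>t\<close>.\<close>

lemma less_exit_timeI:
  fixes X :: "real \<Rightarrow> 'w \<Rightarrow> 'a::topological_space"
  assumes cont: "continuous_on {t. 0 \<le> t \<and> ereal t < \<zeta> \<omega>} (\<lambda>t. X t \<omega>)"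
    and A: "open A" and t: "0 \<le> t" "ereal t < \<zeta> \<omega>" "X t \<omega> \<in> A"
    and before: "\<And>s. 0 < s \<Longrightarrow> s \<le> t \<Longrightarrow> X s \<omega> \<in> A"
  shows "ereal t < exit_time X \<zeta> A \<omega>"
proof -
  have "((\<lambda>s. X s \<omega>) \<longlongrightarrow> X t \<omega>) (at t within {t. 0 \<le> t \<and> ereal t < \<zeta> \<omega>})"
    using cont t unfolding continuous_on_def by auto
  then have ev: "eventually (\<lambda>s. X s \<omega> \<in> A) (at t within {t. 0 \<le> t \<and> ereal t < \<zeta> \<omega>})"
    using A t(3) by (rule topological_tendstoD)
  then obtain d where d: "0 < d" "\<And>s. 0 \<le> s \<Longrightarrow> ereal s < \<zeta> \<omega> \<Longrightarrow> s \<noteq> t \<Longrightarrow> dist s t < d \<Longrightarrow> X s \<omega> \<in> A"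
    unfolding eventually_at by blast
  obtain z where z: "t < z" "ereal z < \<zeta> \<omega>"
    using t(2) by (metis ereal_dense2 less_ereal.simps(1))
  define r where "r = min z (t + d / 2)"
  have r: "t < r" using z d unfolding r_def by simp
  have "r \<le> u" if u: "0 < u" "\<zeta> \<omega> \<le> ereal u \<or> X u \<omega> \<notin> A" for u
  proof (rule ccontr)
    assume "\<not> r \<le> u"
    then have ur: "u < z" "u < t + d" using d unfolding r_def by auto
    then have uz: "ereal u < \<zeta> \<omega>" using z(2) by (meson less_ereal.simps(1) less_trans)
    have "X u \<omega> \<in> A"
    proof (cases "u \<le> t")
      case True
      then show ?thesis using before u(1) by simp
    next
      case False
      then show ?thesis using d(2)[of u] uz ur t(1) by (auto simp: dist_real_def)
    qed
    then show False using u(2) uz by auto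
  qed
  then show ?thesis unfolding exit_time_def ereal_less_Inf_image_iff using r by auto
qed

lemma closure_Ioo_rationals:
  fixes a b :: real
  assumes "a < b" shows "closure ({a<..<b} \<inter> \<rat>) = {a..b}"
proof -
  have "{a<..<b} \<subseteq> closure \<rat>" by (simp add: Rats_closure_real)
  then show ?thesis
    using closure_open_Int_superset[of "{a<..<b}" \<rat>] assms by (simp add: closure_greaterThanLessThan)
qed

context brownian begin

text \<open>The part of the definition of a maximal solution that matters for the measurability of exit
  times.\<close>

definition continuous_adapted :: "(real \<Rightarrow> 'w \<Rightarrow> 'a::euclidean_space) \<Rightarrow> ('w \<Rightarrow> ereal) \<Rightarrow> bool" where
  "continuous_adapted X \<zeta> \<longleftrightarrow>
    (\<forall>\<omega>\<in>space M. 0 < \<zeta> \<omega> \<and> continuous_on {t. 0 \<le> t \<and> ereal t < \<zeta> \<omega>} (\<lambda>t. X t \<omega>)) \<and>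
    (\<forall>t\<ge>0. {\<omega>\<in>space M. ereal t < \<zeta> \<omega>} \<in> sets (F t) \<and>
       X t \<in> borel_measurable (restrict_space (F t) {\<omega>\<in>space M. ereal t < \<zeta> \<omega>}))"

lemma alive_in_set_measurable:
  assumes X: "continuous_adapted X \<zeta>" and t: "0 \<le> s" "s \<le> t" and B: "B \<in> sets borel"
  shows "{\<omega>\<in>space M. ereal s < \<zeta> \<omega> \<and> X s \<omega> \<in> B} \<in> sets (F t)"
proof -
  let ?\<Omega> = "{\<omega>\<in>space M. ereal s < \<zeta> \<omega>}"
  have m: "?\<Omega> \<in> sets (F s)" "X s \<in> borel_measurable (restrict_space (F s) ?\<Omega>)"
    using X t unfolding continuous_adapted_def by auto
  have "X s -` B \<inter> space (restrict_space (F s) ?\<Omega>) \<in> sets (restrict_space (F s) ?\<Omega>)"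
    using m(2) B by (rule measurable_sets)
  then have "X s -` B \<inter> space (restrict_space (F s) ?\<Omega>) \<in> sets (F s)"
    using sets_restrict_space_iff[of ?\<Omega> "F s"] m(1) sets.Int_space_eq2[OF m(1)] by simp
  also have "X s -` B \<inter> space (restrict_space (F s) ?\<Omega>) = {\<omega>\<in>space M. ereal s < \<zeta> \<omega> \<and> X s \<omega> \<in> B}"
    by (auto simp: space_restrict_space)
  finally show ?thesis using sets_F_mono[OF t(2)] by blast
qed

text \<open>A continuous path stays in the open set \<open>A\<close> over a compact time interval exactly when it keeps a
  distance \<open>1/(n + 1)\<close> from the complement for some \<open>n\<close>, and this can be tested at rational times.\<close>

lemma stays_measurable:
  assumes X: "continuous_adapted X \<zeta>" and ab: "0 \<le> a" "a \<le> b" and A: "open A" "- A \<noteq> {}"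
  shows "{\<omega>\<in>space M. ereal b < \<zeta> \<omega> \<and> (\<forall>s\<in>{a..b}. X s \<omega> \<in> A)} \<in> sets (F b)"
proof (cases "a = b")
  case True
  have "0 \<le> b" using ab by linarith
  then have "{\<omega>\<in>space M. ereal b < \<zeta> \<omega> \<and> X b \<omega> \<in> A} \<in> sets (F b)"
    by (rule alive_in_set_measurable[OF X _ order_refl borel_open[OF A(1)]])
  then show ?thesis using True by simp
next
  case False
  with ab have ab': "a < b" by simp
  define g where "g y = infdist y (- A)" for y
  have cl: "closed (- A)" using A by auto
  have g0: "0 < g y \<longleftrightarrow> y \<in> A" for y
    using in_closed_iff_infdist_zero[OF cl A(2), of y] infdist_nonneg[of y "- A"] unfolding g_def by auto
  define C where "C n = {y. 1 / real (Suc n) \<le> g y}" for n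
  have gc: "continuous_on UNIV g" unfolding g_def by (intro continuous_intros)
  have C: "C n \<in> sets borel" for n
  proof -
    have "closed (C n)" unfolding C_def by (intro closed_Collect_le continuous_intros gc)
    then show ?thesis by simp
  qed
  define Q where "Q = {a<..<b} \<inter> \<rat>"
  have Q: "countable Q" "closure Q = {a..b}" "Q \<noteq> {}"
    unfolding Q_def using closure_Ioo_rationals[OF ab'] countable_rat ab' by (auto simp: closure_def[of "{}"])
  have iff: "(\<forall>s\<in>{a..b}. X s \<omega> \<in> A) \<longleftrightarrow> (\<exists>n. \<forall>q\<in>Q. X q \<omega> \<in> C n)"
    if \<omega>: "\<omega> \<in> space M" "ereal b < \<zeta> \<omega>" for \<omega>
  proof -
    have "{a..b} \<subseteq> {t. 0 \<le> t \<and> ereal t < \<zeta> \<omega>}"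
      using ab \<omega>(2) by (auto intro: le_less_trans[of _ "ereal b"])
    then have "continuous_on {a..b} (\<lambda>t. X t \<omega>)"
      using X \<omega> unfolding continuous_adapted_def by (blast intro: continuous_on_subset)
    then have cont: "continuous_on {a..b} (\<lambda>t. g (X t \<omega>))"
      by (intro continuous_on_compose2[OF gc]) auto
    show ?thesis
    proof
      assume all: "\<forall>s\<in>{a..b}. X s \<omega> \<in> A"
      obtain u where u: "u \<in> {a..b}" "\<forall>s\<in>{a..b}. g (X u \<omega>) \<le> g (X s \<omega>)"
        using continuous_attains_inf[OF _ _ cont] ab by auto
      have "0 < g (X u \<omega>)" using all u(1) g0 by blast
      then obtain n where "1 / real (Suc n) < g (X u \<omega>)" using nat_approx_posE by blast
      moreover have "g (X u \<omega>) \<le> g (X q \<omega>)" if "q \<in> Q" for q using u(2) that unfolding Q_def by auto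
      ultimately have "\<forall>q\<in>Q. X q \<omega> \<in> C n" unfolding C_def by (auto intro: less_imp_le less_le_trans)
      then show "\<exists>n. \<forall>q\<in>Q. X q \<omega> \<in> C n" ..
    next
      assume "\<exists>n. \<forall>q\<in>Q. X q \<omega> \<in> C n"
      then obtain n where n: "\<forall>q\<in>Q. X q \<omega> \<in> C n" ..
      show "\<forall>s\<in>{a..b}. X s \<omega> \<in> A"
      proof
        fix s assume "s \<in> {a..b}"
        then have "1 / real (Suc n) \<le> g (X s \<omega>)"
          using continuous_ge_on_closure[of Q "\<lambda>t. g (X t \<omega>)" s "1 / real (Suc n)"] cont n
          unfolding Q(2) C_def by auto
        then have "0 < g (X s \<omega>)" by (rule less_le_trans[rotated]) simp
        then show "X s \<omega> \<in> A" using g0 by simp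
      qed
    qed
  qed
  have "{\<omega>\<in>space M. ereal b < \<zeta> \<omega> \<and> (\<forall>s\<in>{a..b}. X s \<omega> \<in> A)} =
      {\<omega>\<in>space M. ereal b < \<zeta> \<omega> \<and> X b \<omega> \<in> UNIV} \<inter> (\<Union>n. \<Inter>q\<in>Q. {\<omega>\<in>space M. ereal q < \<zeta> \<omega> \<and> X q \<omega> \<in> C n})"
    using iff Q(3) by (fastforce simp: Q_def intro: less_trans[of _ "ereal b"])
  also have "\<dots> \<in> sets (F b)"
  proof -
    have C': "{\<omega>\<in>space M. ereal q < \<zeta> \<omega> \<and> X q \<omega> \<in> C n} \<in> sets (F b)" if "q \<in> Q" for n q
      using alive_in_set_measurable[OF X _ _ C, of q b] ab that unfolding Q_def by simp
    have "(\<Inter>q\<in>Q. {\<omega>\<in>space M. ereal q < \<zeta> \<omega> \<and> X q \<omega> \<in> C n}) \<in> sets (F b)" for n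
      using C' by (intro sets.countable_INT' Q) auto
    then have "(\<Union>n. \<Inter>q\<in>Q. {\<omega>\<in>space M. ereal q < \<zeta> \<omega> \<and> X q \<omega> \<in> C n}) \<in> sets (F b)"
      by (intro sets.countable_UN) auto
    moreover have "{\<omega>\<in>space M. ereal b < \<zeta> \<omega> \<and> X b \<omega> \<in> UNIV} \<in> sets (F b)"
      using alive_in_set_measurable[OF X _ order_refl, of b UNIV] ab by simp
    ultimately show ?thesis by blast
  qed
  finally show ?thesis .
qed

lemma less_exit_time_iff:
  fixes X :: "real \<Rightarrow> 'w \<Rightarrow> 'a::euclidean_space"
  assumes X: "continuous_adapted X \<zeta>" and \<omega>: "\<omega> \<in> space M" and A: "open A" "X 0 \<omega> \<in> A" and t: "0 \<le> t"
  shows "ereal t < exit_time X \<zeta> A \<omega> \<longleftrightarrow> ereal t < \<zeta> \<omega> \<and> (\<forall>s\<in>{0..t}. X s \<omega> \<in> A)"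
proof
  have 0: "0 < \<zeta> \<omega>" and cont: "continuous_on {t. 0 \<le> t \<and> ereal t < \<zeta> \<omega>} (\<lambda>t. X t \<omega>)"
    using X \<omega> unfolding continuous_adapted_def by auto
  {
    assume e: "ereal t < exit_time X \<zeta> A \<omega>"
    then have "ereal t < \<zeta> \<omega>" using exit_time_le_lifetime[of \<zeta> \<omega> X A, OF 0] by simp
    moreover have "X s \<omega> \<in> A" if "s \<in> {0..t}" for s
      using less_exit_timeD[OF e, of s] that A(2) by (cases "s = 0") auto
    ultimately show "ereal t < \<zeta> \<omega> \<and> (\<forall>s\<in>{0..t}. X s \<omega> \<in> A)" by blast
  next
    assume "ereal t < \<zeta> \<omega> \<and> (\<forall>s\<in>{0..t}. X s \<omega> \<in> A)"
    then show "ereal t < exit_time X \<zeta> A \<omega>" using t by (intro less_exit_timeI[where X = X and \<zeta> = \<zeta> and \<omega> = \<omega>, OF cont A(1)]) auto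
  }
qed

text \<open>As the path is continuous and \<open>A\<close> open, a path in \<open>A\<close> up to and including time \<open>t\<close> exits strictly
  later; so the strict inequality depends on the path up to time \<open>t\<close> only.\<close>

lemma less_exit_time_adapted:
  fixes X :: "real \<Rightarrow> 'w \<Rightarrow> 'a::euclidean_space"
  assumes X: "continuous_adapted X \<zeta>" and A: "open A" "- A \<noteq> {}"
    and start: "\<And>\<omega>. \<omega> \<in> space M \<Longrightarrow> X 0 \<omega> \<in> A" and t: "0 \<le> t"
  shows "{\<omega>\<in>space M. ereal t < exit_time X \<zeta> A \<omega>} \<in> sets (F t)"
proof -
  have "{\<omega>\<in>space M. ereal t < exit_time X \<zeta> A \<omega>} = {\<omega>\<in>space M. ereal t < \<zeta> \<omega> \<and> (\<forall>s\<in>{0..t}. X s \<omega> \<in> A)}"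
    using less_exit_time_iff[OF X _ A(1) start t] by blast
  also have "\<dots> \<in> sets (F t)" by (rule stays_measurable[OF X order_refl t A])
  finally show ?thesis .
qed

text \<open>The starting point may lie outside \<open>A\<close>, and time \<open>0\<close> does not count for the exit time; therefore
  the path is tested on the intervals from \<open>t/(k + 1)\<close> to \<open>t\<close>.\<close>

lemma exit_time_measurable:
  fixes X :: "real \<Rightarrow> 'w \<Rightarrow> 'a::euclidean_space"
  assumes X: "continuous_adapted X \<zeta>" and A: "open A" "- A \<noteq> {}"
  shows "(\<lambda>\<omega>. exit_time X \<zeta> A \<omega>) \<in> borel_measurable M"
proof (rule borel_measurableI_greater)
  have pos: "{\<omega>\<in>space M. ereal t < exit_time X \<zeta> A \<omega>} \<in> sets M" if t: "0 < t" for t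
  proof -
    define a where "a k = t / real (Suc k)" for k
    have a: "0 < a k" "a k \<le> t" for k using t unfolding a_def by (auto simp: field_simps)
    have "ereal t < exit_time X \<zeta> A \<omega> \<longleftrightarrow> (\<forall>k. ereal t < \<zeta> \<omega> \<and> (\<forall>s\<in>{a k..t}. X s \<omega> \<in> A))" if \<omega>: "\<omega> \<in> space M" for \<omega>
    proof
      assume e: "ereal t < exit_time X \<zeta> A \<omega>"
      show "\<forall>k. ereal t < \<zeta> \<omega> \<and> (\<forall>s\<in>{a k..t}. X s \<omega> \<in> A)"
        using less_exit_timeD[OF e] a t by (metis atLeastAtMost_iff less_le_trans order_refl)
    next
      assume all: "\<forall>k. ereal t < \<zeta> \<omega> \<and> (\<forall>s\<in>{a k..t}. X s \<omega> \<in> A)"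
      have "X s \<omega> \<in> A" if s: "0 < s" "s \<le> t" for s
      proof -
        obtain k where "1 / real (Suc k) < s / t" using nat_approx_posE[of "s / t"] s t by auto
        then have "a k \<le> s" using t unfolding a_def by (simp add: field_simps)
        then show ?thesis using all s by auto
      qed
      moreover have "continuous_on {t. 0 \<le> t \<and> ereal t < \<zeta> \<omega>} (\<lambda>t. X t \<omega>)"
        using X \<omega> unfolding continuous_adapted_def by auto
      ultimately show "ereal t < exit_time X \<zeta> A \<omega>" using all t
        by (intro less_exit_timeI[where X = X and \<zeta> = \<zeta> and \<omega> = \<omega>] A(1)) auto
    qed
    then have "{\<omega>\<in>space M. ereal t < exit_time X \<zeta> A \<omega>} =
        (\<Inter>k. {\<omega>\<in>space M. ereal t < \<zeta> \<omega> \<and> (\<forall>s\<in>{a k..t}. X s \<omega> \<in> A)})" by auto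
    also have "\<dots> \<in> sets M"
      using stays_measurable[OF X less_imp_le[OF a(1)] a(2) A] sets_F[of t] by (intro sets.countable_INT') auto
    finally show ?thesis .
  qed
  fix y :: ereal
  show "{\<omega>\<in>space M. y < exit_time X \<zeta> A \<omega>} \<in> sets M"
  proof (cases y)
    case (real t)
    consider "0 < t" | "t = 0" | "t < 0" by linarith
    then show ?thesis
    proof cases
      case 1
      then show ?thesis using pos real by simp
    next
      case 2
      have "(0 < exit_time X \<zeta> A \<omega>) \<longleftrightarrow> (\<exists>n. ereal (1 / real (Suc n)) < exit_time X \<zeta> A \<omega>)" for \<omega>
      proof
        assume "0 < exit_time X \<zeta> A \<omega>"
        then obtain r where r: "ereal 0 < ereal r" "ereal r < exit_time X \<zeta> A \<omega>"
          by (metis ereal_dense2 zero_ereal_def)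
        then obtain n where "1 / real (Suc n) < r" using nat_approx_posE[of r] by auto
        then show "\<exists>n. ereal (1 / real (Suc n)) < exit_time X \<zeta> A \<omega>"
          using r(2) by (meson less_ereal.simps(1) less_trans)
      next
        assume "\<exists>n. ereal (1 / real (Suc n)) < exit_time X \<zeta> A \<omega>"
        then obtain n where "ereal (1 / real (Suc n)) < exit_time X \<zeta> A \<omega>" ..
        moreover have "0 < ereal (1 / real (Suc n))" by simp
        ultimately show "0 < exit_time X \<zeta> A \<omega>" by (rule less_trans[rotated])
      qed
      then have "{\<omega>\<in>space M. y < exit_time X \<zeta> A \<omega>} = (\<Union>n. {\<omega>\<in>space M. ereal (1 / real (Suc n)) < exit_time X \<zeta> A \<omega>})"
        using 2 real by (auto simp: zero_ereal_def)
      also have "\<dots> \<in> sets M" by (intro sets.countable_UN'' pos) auto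
      finally show ?thesis .
    next
      case 3
      then have "y < exit_time X \<zeta> A \<omega>" for \<omega>
        using real exit_time_nonneg[of X \<zeta> A \<omega>] by (auto intro: less_le_trans[of _ 0])
      then show ?thesis by simp
    qed
  next
    case MInf
    then have "y < exit_time X \<zeta> A \<omega>" for \<omega>
      using exit_time_nonneg[of X \<zeta> A \<omega>] by (auto intro: less_le_trans[of _ 0])
    then show ?thesis by simp
  qed simp
qed

text \<open>Approximation by the value at the next point of the grid of mesh \<open>1/(n + 1)\<close>.\<close>

lemma right_continuous_jointly_measurable:
  fixes Z :: "real \<Rightarrow> 'w \<Rightarrow> 'a::euclidean_space"
  assumes Z: "\<And>s. Z s \<in> borel_measurable M"
    and right: "\<And>\<omega> s. \<omega> \<in> space M \<Longrightarrow> ((\<lambda>u. Z u \<omega>) \<longlongrightarrow> Z s \<omega>) (at_right s)"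
  shows "jointly_measurable Z"
  unfolding jointly_measurable_def
proof (rule borel_measurable_LIMSEQ_metric)
  define r where "r n s = (of_int \<lfloor>real (Suc n) * s\<rfloor> + 1) / real (Suc n)" for n s
  have r: "s < r n s" "r n s \<le> s + inverse (real (Suc n))" for n s
  proof -
    have m: "0 < real (Suc n)" by simp
    have f: "s * real (Suc n) < of_int \<lfloor>real (Suc n) * s\<rfloor> + 1" "of_int \<lfloor>real (Suc n) * s\<rfloor> \<le> s * real (Suc n)"
      using floor_correct[of "real (Suc n) * s"] by (auto simp: mult.commute)
    show "s < r n s" unfolding r_def pos_less_divide_eq[OF m] by (rule f(1))
    have "of_int \<lfloor>real (Suc n) * s\<rfloor> / real (Suc n) \<le> s"
      unfolding pos_divide_le_eq[OF m] by (rule f(2))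
    then show "r n s \<le> s + inverse (real (Suc n))"
      unfolding r_def add_divide_distrib inverse_eq_divide by (rule add_right_mono)
  qed
  have lim: "filterlim (\<lambda>n. r n s) (at_right s) sequentially" for s
  proof (rule tendsto_imp_filterlim_at_right)
    have "(\<lambda>n. s + inverse (real (Suc n))) \<longlonglongrightarrow> s + 0"
      by (intro tendsto_add tendsto_const LIMSEQ_inverse_real_of_nat)
    then have up: "(\<lambda>n. s + inverse (real (Suc n))) \<longlonglongrightarrow> s" by simp
    have "eventually (\<lambda>n. s \<le> r n s) sequentially"
      by (intro always_eventually allI less_imp_le r(1))
    moreover have "eventually (\<lambda>n. r n s \<le> s + inverse (real (Suc n))) sequentially"
      by (intro always_eventually allI r(2))
    ultimately show "(\<lambda>n. r n s) \<longlonglongrightarrow> s"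
      by (rule tendsto_sandwich[OF _ _ tendsto_const up])
    show "eventually (\<lambda>n. s < r n s) sequentially" using r(1) by (intro always_eventually allI)
  qed
  show "(\<lambda>n. Z (r n (fst z)) (snd z)) \<longlonglongrightarrow> Z (fst z) (snd z)" if "z \<in> space P_time" for z
    using that by (intro filterlim_compose[OF right lim]) (auto simp: space_pair_measure)
  fix n
  have "(\<lambda>z. Z ((of_int i + 1) / real (Suc n)) (snd z)) \<in> borel_measurable P_time" for i :: int
    by (rule measurable_compose[OF measurable_snd Z])
  moreover have "(\<lambda>z. \<lfloor>real (Suc n) * fst z\<rfloor>) \<in> measurable P_time (count_space UNIV)"
    by measurable
  ultimately have "(\<lambda>z. Z ((of_int \<lfloor>real (Suc n) * fst z\<rfloor> + 1) / real (Suc n)) (snd z)) \<in> borel_measurable P_time"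
    by (rule measurable_compose_countable[where f="\<lambda>i z. Z ((of_int i + 1) / real (Suc n)) (snd z)"])
  then show "(\<lambda>z. Z (r n (fst z)) (snd z)) \<in> borel_measurable P_time" unfolding r_def .
qed

text \<open>Beyond the exit time the process may be arbitrary, even in its dependence on \<open>\<omega>\<close>; replacing it there by
  a constant \<open>c\<close> gives right-continuous paths.\<close>

lemma killed_process_jointly_measurable:
  fixes X :: "real \<Rightarrow> 'w \<Rightarrow> 'a::euclidean_space"
  assumes X: "continuous_adapted X \<zeta>" and A: "open A" "- A \<noteq> {}"
    and start: "\<And>\<omega>. \<omega> \<in> space M \<Longrightarrow> X 0 \<omega> \<in> A"
  shows "jointly_measurable (\<lambda>s \<omega>. if 0 \<le> s \<and> ereal s < exit_time X \<zeta> A \<omega> then X s \<omega> else c)"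
proof (rule right_continuous_jointly_measurable)
  define \<theta> where "\<theta> \<omega> = exit_time X \<zeta> A \<omega>" for \<omega>
  have \<theta>\<zeta>: "\<theta> \<omega> \<le> \<zeta> \<omega>" if "\<omega> \<in> space M" for \<omega>
    unfolding \<theta>_def using X that by (intro exit_time_le_lifetime) (auto simp: continuous_adapted_def)
  fix s :: real
  show "(\<lambda>\<omega>. if 0 \<le> s \<and> ereal s < exit_time X \<zeta> A \<omega> then X s \<omega> else c) \<in> borel_measurable M"
  proof (cases "0 \<le> s")
    case False
    then show ?thesis by simp
  next
    case True
    have \<theta>m: "{\<omega>\<in>space M. ereal s < \<theta> \<omega>} \<in> sets M"
      using less_exit_time_adapted[OF X A start True] sets_F unfolding \<theta>_def by blast
    show ?thesis
    proof (rule borel_measurableI)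
      fix S :: "'a set" assume S: "open S"
      have "{\<omega>\<in>space M. ereal s < \<zeta> \<omega> \<and> X s \<omega> \<in> S} \<in> sets M"
        using alive_in_set_measurable[OF X True order_refl] S sets_F by (meson borel_open in_mono)
      then have "({\<omega>\<in>space M. ereal s < \<theta> \<omega>} \<inter> {\<omega>\<in>space M. ereal s < \<zeta> \<omega> \<and> X s \<omega> \<in> S}) \<union>
          (space M - {\<omega>\<in>space M. ereal s < \<theta> \<omega>}) \<inter> {\<omega>\<in>space M. c \<in> S} \<in> sets M"
        using \<theta>m by (intro sets.Un sets.Int sets.Diff) auto
      also have "({\<omega>\<in>space M. ereal s < \<theta> \<omega>} \<inter> {\<omega>\<in>space M. ereal s < \<zeta> \<omega> \<and> X s \<omega> \<in> S}) \<union>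
          (space M - {\<omega>\<in>space M. ereal s < \<theta> \<omega>}) \<inter> {\<omega>\<in>space M. c \<in> S} =
          (\<lambda>\<omega>. if 0 \<le> s \<and> ereal s < exit_time X \<zeta> A \<omega> then X s \<omega> else c) -` S \<inter> space M"
        using True \<theta>\<zeta> unfolding \<theta>_def by (auto intro: less_le_trans split: if_splits)
      finally show "(\<lambda>\<omega>. if 0 \<le> s \<and> ereal s < exit_time X \<zeta> A \<omega> then X s \<omega> else c) -` S \<inter> space M \<in> sets M" .
    qed
  qed
  fix \<omega> assume \<omega>: "\<omega> \<in> space M"
  let ?Z = "\<lambda>s. if 0 \<le> s \<and> ereal s < exit_time X \<zeta> A \<omega> then X s \<omega> else c"
  show "(?Z \<longlongrightarrow> ?Z s) (at_right s)"
  proof (cases "0 \<le> s \<and> ereal s < \<theta> \<omega>")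
    case True
    have lim: "((\<lambda>t. X t \<omega>) \<longlongrightarrow> X s \<omega>) (at s within {t. 0 \<le> t \<and> ereal t < \<zeta> \<omega>})"
      using X \<omega> True less_le_trans[OF _ \<theta>\<zeta>[OF \<omega>]] unfolding continuous_adapted_def continuous_on_def by auto
    obtain z where z: "s < z" "ereal z < \<theta> \<omega>"
      using ereal_dense2[of "ereal s" "\<theta> \<omega>"] True by auto
    have before: "ereal t < \<theta> \<omega>" if "t < z" for t
      by (rule less_trans[OF _ z(2)]) (use that in simp)
    have sub: "{s<..<z} \<subseteq> {t. 0 \<le> t \<and> ereal t < \<zeta> \<omega>}"
      using True less_le_trans[OF before \<theta>\<zeta>[OF \<omega>]] by auto
    from lim have "((\<lambda>t. X t \<omega>) \<longlongrightarrow> X s \<omega>) (at s within {s<..<z})"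
      by (rule tendsto_within_subset[OF _ sub])
    moreover have "at s within {s<..<z} = at_right s"
      by (rule at_within_nhd[of s "{..<z}"]) (use z(1) in auto)
    ultimately have "((\<lambda>t. X t \<omega>) \<longlongrightarrow> X s \<omega>) (at_right s)" by simp
    moreover have "eventually (\<lambda>t. X t \<omega> = ?Z t) (at_right s)"
      unfolding eventually_at_right[OF z(1)] using True before z(1) by (intro exI[of _ z]) (auto simp: \<theta>_def[symmetric])
    ultimately have "(?Z \<longlongrightarrow> X s \<omega>) (at_right s)"
      by (rule Lim_transform_eventually)
    then show ?thesis using True by (simp add: \<theta>_def[symmetric])
  next
    case False
    have ev: "eventually (\<lambda>t. ?Z t = c) (at_right s)"
    proof (cases "s < 0")
      case True
      then show ?thesis
        by (auto simp: eventually_at_right[OF True] intro!: exI[of _ 0])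
    next
      case F: False
      have "?Z t = c" if "t > s" for t
      proof -
        have "\<theta> \<omega> \<le> ereal s" using False F by auto
        also have "ereal s \<le> ereal t" using that by simp
        finally have "\<not> ereal t < \<theta> \<omega>" by simp
        then show ?thesis unfolding \<theta>_def by simp
      qed
      then show ?thesis by (rule eventually_mono[OF eventually_at_right_less])
    qed
    have "?Z s = c" using False unfolding \<theta>_def by auto
    then show ?thesis using tendsto_eventually[OF ev] by simp
  qed
qed

end

section \<open>Solutions stopped on leaving a ball\<close>

lemma Cinf_on_imp_continuous_on: "Cinf_on f D \<Longrightarrow> continuous_on D f"
  unfolding Cinf_on_def using Ck_on.simps(1) by blast

text \<open>The partial derivatives are bounded on a compact set; convexity allows the mean value
  inequality.\<close>

lemma Cinf_on_imp_lipschitz: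
  fixes f :: "'a::euclidean_space \<Rightarrow> 'b::real_normed_vector"
  assumes f: "Cinf_on f D" and K: "compact K" "convex K" "K \<subseteq> D"
  shows "\<exists>L\<ge>0. \<forall>x\<in>K. \<forall>y\<in>K. norm (f x - f y) \<le> L * norm (x - y)"
proof -
  have "Ck_on (Suc 0) f D" using f unfolding Cinf_on_def by blast
  then have diff: "\<And>x. x \<in> D \<Longrightarrow> f differentiable (at x)"
    and cont: "\<And>v. continuous_on D (\<lambda>x. frechet_derivative f (at x) v)"
    by auto
  have "\<exists>B. \<forall>x\<in>K. norm (frechet_derivative f (at x) i) \<le> B" for i
  proof -
    have "compact ((\<lambda>x. frechet_derivative f (at x) i) ` K)"
      using cont K by (intro compact_continuous_image) (auto intro: continuous_on_subset)
    from compact_imp_bounded[OF this] show ?thesis unfolding bounded_iff by auto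
  qed
  then have "\<forall>i. \<exists>B. \<forall>x\<in>K. norm (frechet_derivative f (at x) i) \<le> B" ..
  then have "\<exists>B. \<forall>i. \<forall>x\<in>K. norm (frechet_derivative f (at x) i) \<le> B i" by (rule choice)
  then obtain B where "\<forall>i. \<forall>x\<in>K. norm (frechet_derivative f (at x) i) \<le> B i" ..
  then have B: "norm (frechet_derivative f (at x) i) \<le> B i" if "x \<in> K" for i x using that by blast
  define L where "L = (\<Sum>i\<in>Basis. \<bar>B i\<bar>)"
  have on: "onorm (frechet_derivative f (at x)) \<le> L" if x: "x \<in> K" for x
  proof (rule onorm_le)
    fix v
    have lin: "linear (frechet_derivative f (at x))"
      using diff x K(3) by (intro linear_frechet_derivative) auto
    have "frechet_derivative f (at x) v = frechet_derivative f (at x) (\<Sum>i\<in>Basis. (v \<bullet> i) *\<^sub>R i)"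
      by (simp add: euclidean_representation)
    also have "\<dots> = (\<Sum>i\<in>Basis. (v \<bullet> i) *\<^sub>R frechet_derivative f (at x) i)"
      using lin by (simp add: linear_sum linear_cmul)
    also have "norm \<dots> \<le> (\<Sum>i\<in>Basis. norm v * \<bar>B i\<bar>)"
    proof (rule sum_norm_le)
      fix i :: 'a assume "i \<in> Basis"
      have "norm ((v \<bullet> i) *\<^sub>R frechet_derivative f (at x) i) = \<bar>v \<bullet> i\<bar> * norm (frechet_derivative f (at x) i)" by simp
      also have "\<dots> \<le> norm v * \<bar>B i\<bar>"
        using Basis_le_norm[OF \<open>i \<in> Basis\<close>] order_trans[OF B[OF x] abs_ge_self] by (intro mult_mono) auto
      finally show "norm ((v \<bullet> i) *\<^sub>R frechet_derivative f (at x) i) \<le> norm v * \<bar>B i\<bar>" .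
    qed
    also have "\<dots> = L * norm v" unfolding L_def by (simp add: sum_distrib_left mult.commute)
    finally show "norm (frechet_derivative f (at x) v) \<le> L * norm v" .
  qed
  have "norm (f x - f y) \<le> L * norm (x - y)" if "x \<in> K" "y \<in> K" for x y
  proof (rule differentiable_bound[OF K(2) _ on that])
    fix u assume "u \<in> K"
    then show "(f has_derivative frechet_derivative f (at u)) (at u within K)"
      using diff K(3) frechet_derivative_works has_derivative_at_withinI by blast
  qed
  moreover have "0 \<le> L" unfolding L_def by (simp add: sum_nonneg)
  ultimately show ?thesis by blast
qed

context brownian begin

lemma solution_continuous_adapted:
  "maximal_solution M F W b \<sigma> D x X \<zeta> \<Longrightarrow> continuous_adapted X \<zeta>"
  unfolding maximal_solution_def continuous_adapted_def by blast

lemma solution_start: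
  "maximal_solution M F W b \<sigma> D x X \<zeta> \<Longrightarrow> \<omega> \<in> space M \<Longrightarrow> X 0 \<omega> = x"
  unfolding maximal_solution_def by blast

end

text \<open>Around the point \<open>z\<close> the coefficients are bounded by \<open>K\<close> and Lipschitz with constant \<open>L\<close>.\<close>

locale localized_sde = brownian M F W
  for M :: "'w measure" and F :: "real \<Rightarrow> 'w measure" and W :: "real \<Rightarrow> 'w \<Rightarrow> real^'r" +
  fixes b :: "real^'m \<Rightarrow> real^'m" and \<sigma> :: "real^'m \<Rightarrow> real^'r^'m" and D :: "(real^'m) set"
    and z :: "real^'m" and R K L :: real
  assumes R: "0 < R" and cball: "cball z R \<subseteq> D"
    and cont: "continuous_on (ball z R) b" "continuous_on (ball z R) \<sigma>"
    and K: "0 \<le> K" "\<And>u. u \<in> ball z R \<Longrightarrow> norm (b u) \<le> K" "\<And>u. u \<in> ball z R \<Longrightarrow> norm (\<sigma> u) \<le> K"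
    and L: "0 \<le> L" "\<And>u v. u \<in> ball z R \<Longrightarrow> v \<in> ball z R \<Longrightarrow> norm (b u - b v) \<le> L * norm (u - v)"
      "\<And>u v. u \<in> ball z R \<Longrightarrow> v \<in> ball z R \<Longrightarrow> norm (\<sigma> u - \<sigma> v) \<le> L * norm (u - v)"
begin

lemma outside_ball: "- ball z R \<noteq> {}"
proof -
  have "\<not> (UNIV :: (real^'m) set) \<subseteq> ball z R" using bounded_subset[OF bounded_ball] not_bounded_UNIV by blast
  then show ?thesis by blast
qed

text \<open>A coefficient along a path, set to zero after the exit from the ball.\<close>

definition coeff :: "(real^'m \<Rightarrow> 'b::real_normed_vector) \<Rightarrow> (real \<Rightarrow> 'w \<Rightarrow> real^'m) \<Rightarrow> ('w \<Rightarrow> ereal) \<Rightarrow> real \<Rightarrow> 'w \<Rightarrow> 'b" where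
  "coeff \<phi> X \<zeta> s \<omega> = (if 0 \<le> s \<and> ereal s < exit_time X \<zeta> (ball z R) \<omega> then \<phi> (X s \<omega>) else 0)"

lemma solution_in_ball:
  assumes "maximal_solution M F W b \<sigma> D x X \<zeta>" "x \<in> ball z R" "\<omega> \<in> space M"
    and "0 \<le> s" "ereal s < exit_time X \<zeta> (ball z R) \<omega>"
  shows "X s \<omega> \<in> ball z R"
  using less_exit_timeD[OF assms(5), of s] solution_start[OF assms(1,3)] assms(2,4) by (cases "s = 0") auto

text \<open>With a point outside the ball as cemetery the coefficient is a Borel function of the killed
  process.\<close>

lemma coeff_jointly_measurable:
  fixes \<phi> :: "real^'m \<Rightarrow> 'b::{real_normed_vector, second_countable_topology}"
  assumes sol: "maximal_solution M F W b \<sigma> D x X \<zeta>" and x: "x \<in> ball z R"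
    and \<phi>: "continuous_on (ball z R) \<phi>"
  shows "jointly_measurable (coeff \<phi> X \<zeta>)"
proof -
  obtain c where c: "c \<notin> ball z R" using outside_ball by blast
  define Z where "Z s \<omega> = (if 0 \<le> s \<and> ereal s < exit_time X \<zeta> (ball z R) \<omega> then X s \<omega> else c)" for s \<omega>
  have "jointly_measurable Z"
    unfolding Z_def[abs_def]
    using killed_process_jointly_measurable[OF solution_continuous_adapted[OF sol] open_ball outside_ball]
      solution_start[OF sol] x by blast
  moreover have "(\<lambda>u. indicator (ball z R) u *\<^sub>R \<phi> u) \<in> borel_measurable borel"
    using \<phi> by (intro borel_measurable_continuous_on_indicator) auto
  ultimately have "(\<lambda>p. indicator (ball z R) (Z (fst p) (snd p)) *\<^sub>R \<phi> (Z (fst p) (snd p))) \<in> borel_measurable P_time"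
    unfolding jointly_measurable_def by (rule measurable_compose)
  also have "(\<lambda>p. indicator (ball z R) (Z (fst p) (snd p)) *\<^sub>R \<phi> (Z (fst p) (snd p))) \<in> borel_measurable P_time
    \<longleftrightarrow> (\<lambda>p. coeff \<phi> X \<zeta> (fst p) (snd p)) \<in> borel_measurable P_time"
  proof (rule measurable_cong)
    fix p :: "real \<times> 'w" assume "p \<in> space P_time"
    then have \<omega>: "snd p \<in> space M" by (auto simp: space_pair_measure)
    show "indicator (ball z R) (Z (fst p) (snd p)) *\<^sub>R \<phi> (Z (fst p) (snd p)) = coeff \<phi> X \<zeta> (fst p) (snd p)"
      unfolding Z_def coeff_def using c solution_in_ball[OF sol x \<omega>] by auto
  qed
  finally show ?thesis unfolding jointly_measurable_def .
qed

lemma coeff_bound: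
  assumes sol: "maximal_solution M F W b \<sigma> D x X \<zeta>" and x: "x \<in> ball z R" and \<omega>: "\<omega> \<in> space M"
  shows "norm (coeff b X \<zeta> s \<omega>) \<le> K" "norm (coeff \<sigma> X \<zeta> s \<omega>) \<le> K"
  unfolding coeff_def using solution_in_ball[OF sol x \<omega>, of s] K by auto

lemma path_measurable:
  assumes "jointly_measurable H" "\<omega> \<in> space M"
  shows "(\<lambda>s. H s \<omega>) \<in> borel_measurable lborel"
proof -
  have "(\<lambda>s. (s, \<omega>)) \<in> measurable lborel P_time" using assms(2) by measurable
  from measurable_compose[OF this assms(1)[unfolded jointly_measurable_def]] show ?thesis by simp
qed

text \<open>The drift integral is rewritten over the fixed interval \<open>(0, t]\<close>; the integrands differ at most at
  the two end points.\<close>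

lemma solution_integral_equation:
  assumes sol: "maximal_solution M F W b \<sigma> D x X \<zeta>" and x: "x \<in> ball z R" and t: "0 \<le> t"
  shows "\<exists>I. ito_limit (\<lambda>s \<omega>. indicator {0<..t} s *\<^sub>R coeff \<sigma> X \<zeta> s \<omega>) I \<and>
    (AE \<omega> in M. X (real_of_ereal (min (ereal t) (exit_time X \<zeta> (ball z R) \<omega>))) \<omega> =
       x + (LINT s|lborel. indicator {0<..t} s *\<^sub>R coeff b X \<zeta> s \<omega>) + I \<omega>)"
proof -
  have "open (ball z R) \<and> x \<in> ball z R \<and> compact (closure (ball z R)) \<and> closure (ball z R) \<subseteq> D \<and> 0 \<le> t"
    using x t cball R by simp
  with sol obtain I where I: "is_ito_integral M F W
        (\<lambda>s \<omega>. indicator {u. ereal u < exit_time X \<zeta> (ball z R) \<omega>} s *\<^sub>R \<sigma> (X s \<omega>)) t I"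
    and eq: "AE \<omega> in M. (let T = real_of_ereal (min (ereal t) (exit_time X \<zeta> (ball z R) \<omega>))
                in X T \<omega> = x + (LINT s:{0..T}|lborel. b (X s \<omega>)) + I \<omega>)"
    unfolding maximal_solution_def by blast
  have H: "indicator {u. ereal u < exit_time X \<zeta> (ball z R) \<omega>} s *\<^sub>R \<sigma> (X s \<omega>) = coeff \<sigma> X \<zeta> s \<omega>" if "0 \<le> s" for s \<omega>
    using that unfolding coeff_def by (simp add: indicator_def)
  have "ito_limit (\<lambda>s \<omega>. indicator {0<..t} s *\<^sub>R (indicator {u. ereal u < exit_time X \<zeta> (ball z R) \<omega>} s *\<^sub>R \<sigma> (X s \<omega>))) I"
    using coeff_bound(2)[OF sol x] H by (intro ito_integral_ito_limit[OF I t K(1)]) simp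
  also have "(\<lambda>s \<omega>. indicator {0<..t} s *\<^sub>R (indicator {u. ereal u < exit_time X \<zeta> (ball z R) \<omega>} s *\<^sub>R \<sigma> (X s \<omega>))) =
      (\<lambda>s \<omega>. indicator {0<..t} s *\<^sub>R coeff \<sigma> X \<zeta> s \<omega>)"
  proof (intro ext)
    fix s \<omega>
    show "indicator {0<..t} s *\<^sub>R (indicator {u. ereal u < exit_time X \<zeta> (ball z R) \<omega>} s *\<^sub>R \<sigma> (X s \<omega>)) =
        indicator {0<..t} s *\<^sub>R coeff \<sigma> X \<zeta> s \<omega>"
      using H[of s \<omega>] by (cases "0 < s \<and> s \<le> t") auto
  qed
  finally have lim: "ito_limit (\<lambda>s \<omega>. indicator {0<..t} s *\<^sub>R coeff \<sigma> X \<zeta> s \<omega>) I" .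
  have drift: "(LINT s:{0..T}|lborel. b (X s \<omega>)) = (LINT s|lborel. indicator {0<..t} s *\<^sub>R coeff b X \<zeta> s \<omega>)"
    if \<omega>: "\<omega> \<in> space M" and T: "T = real_of_ereal (min (ereal t) (exit_time X \<zeta> (ball z R) \<omega>))" for \<omega> T
  proof -
    define \<theta> where "\<theta> = exit_time X \<zeta> (ball z R) \<omega>"
    define f where "f s = indicator {0..T} s *\<^sub>R b (X s \<omega>)" for s
    define g where "g s = indicator {0<..t} s *\<^sub>R coeff b X \<zeta> s \<omega>" for s
    have "0 \<le> \<theta>" unfolding \<theta>_def by (rule exit_time_nonneg)
    then have eT: "ereal T = min (ereal t) \<theta>" using t unfolding T \<theta>_def[symmetric] by (cases \<theta>) (auto simp: min_def)
    have fg: "f s = g s" if s: "s \<noteq> 0" "s \<noteq> T" for s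
    proof (cases "0 < s \<and> s < T")
      case True
      then have "ereal s < min (ereal t) \<theta>" unfolding eT[symmetric] by simp
      then show ?thesis using True unfolding f_def g_def coeff_def \<theta>_def[symmetric] by auto
    next
      case False
      then have "s < 0 \<or> T < s" using s by auto
      moreover have "\<not> (s \<le> t \<and> ereal s < \<theta>)" if "T < s"
      proof -
        have "min (ereal t) \<theta> < ereal s" using that unfolding eT[symmetric] by simp
        then show ?thesis by (auto simp: min_less_iff_disj)
      qed
      ultimately show ?thesis unfolding f_def g_def coeff_def \<theta>_def[symmetric] by (auto simp: indicator_def)
    qed
    have gm: "g \<in> borel_measurable lborel"
      unfolding g_def using path_measurable[OF coeff_jointly_measurable[OF sol x cont(1)] \<omega>] by simp
    have "f = (\<lambda>s. if s = 0 then f 0 else if s = T then f T else g s)" using fg by auto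
    also have "\<dots> \<in> borel_measurable lborel" using gm by measurable
    finally have fm: "f \<in> borel_measurable lborel" .
    have "AE s in lborel. f s = g s"
      using AE_lborel_singleton[of 0] AE_lborel_singleton[of T] by eventually_elim (rule fg)
    then have "integral\<^sup>L lborel f = integral\<^sup>L lborel g" by (rule integral_cong_AE[OF fm gm])
    then show ?thesis unfolding f_def g_def set_lebesgue_integral_def .
  qed
  from eq have "AE \<omega> in M. X (real_of_ereal (min (ereal t) (exit_time X \<zeta> (ball z R) \<omega>))) \<omega> =
       x + (LINT s|lborel. indicator {0<..t} s *\<^sub>R coeff b X \<zeta> s \<omega>) + I \<omega>"
    using AE_space
  proof eventually_elim
    case (elim \<omega>)
    then show ?case using drift[OF elim(2) refl] unfolding Let_def by simp
  qed
  with lim show ?thesis by blast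
qed

text \<open>The lifetime is not reached inside the ball, because a solution with finite lifetime leaves the
  compact closed ball before; hence the path is defined and outside the open ball at the exit time.\<close>

lemma solution_exits_alive:
  assumes sol: "maximal_solution M F W b \<sigma> D x X \<zeta>" and x: "x \<in> ball z R"
  shows "AE \<omega> in M. \<forall>u. exit_time X \<zeta> (ball z R) \<omega> = ereal u \<longrightarrow> X u \<omega> \<notin> ball z R"
proof -
  have "AE \<omega> in M. \<zeta> \<omega> < \<infinity> \<longrightarrow> (\<forall>K. compact K \<and> K \<subseteq> D \<longrightarrow> (\<exists>t\<ge>0. ereal t < \<zeta> \<omega> \<and> X t \<omega> \<notin> K))"
    using sol unfolding maximal_solution_def by (elim conjE)
  then show ?thesis using AE_space
  proof eventually_elim
    case (elim \<omega>)
    have X: "continuous_adapted X \<zeta>" by (rule solution_continuous_adapted[OF sol])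
    then have pos: "0 < \<zeta> \<omega>" using elim(2) unfolding continuous_adapted_def by blast
    have start: "X 0 \<omega> \<in> ball z R" using solution_start[OF sol elim(2)] x by simp
    show ?case
    proof (intro allI impI notI)
      fix u assume u: "exit_time X \<zeta> (ball z R) \<omega> = ereal u" and in_ball: "X u \<omega> \<in> ball z R"
      have u0: "0 \<le> u" using exit_time_nonneg[of X \<zeta> "ball z R" \<omega>] u by simp
      have before: "X s \<omega> \<in> ball z R" if "0 \<le> s" "s < u" for s
        using solution_in_ball[OF sol x elim(2), of s] that u by simp
      have "ereal u < \<zeta> \<omega>"
      proof (rule ccontr)
        assume "\<not> ereal u < \<zeta> \<omega>"
        moreover have "ereal u \<le> \<zeta> \<omega>" using exit_time_le_lifetime[of \<zeta> \<omega> X "ball z R", OF pos] u by simp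
        ultimately have \<zeta>u: "\<zeta> \<omega> = ereal u" by simp
        then have "\<zeta> \<omega> < \<infinity>" by simp
        from elim(1)[rule_format, OF this, of "cball z R"] cball
        obtain t where "0 \<le> t" "ereal t < \<zeta> \<omega>" "X t \<omega> \<notin> cball z R"
          by (auto simp del: mem_cball)
        then show False using before[of t] \<zeta>u by auto
      qed
      moreover have "\<forall>s\<in>{0..u}. X s \<omega> \<in> ball z R"
      proof
        fix s assume "s \<in> {0..u}"
        then have "0 \<le> s" "s < u \<or> s = u" by auto
        then show "X s \<omega> \<in> ball z R" using before[of s] in_ball by blast
      qed
      ultimately have "ereal u < exit_time X \<zeta> (ball z R) \<omega>"
        using less_exit_time_iff[OF X elim(2) open_ball start u0] by blast
      then show False using u by simp
    qed
  qed
qed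

end

section \<open>The difference of two solutions on a time grid\<close>

text \<open>Increments are summed as long as \<open>P\<close> holds.\<close>

lemma telescope_until:
  fixes D :: "nat \<Rightarrow> 'a::real_vector"
  assumes dec: "\<And>j. P (Suc j) \<Longrightarrow> P j"
  shows "\<exists>J\<le>N. (\<forall>j<J. P j) \<and> (J = N \<or> \<not> P J) \<and> (\<Sum>j<N. if P j then D (Suc j) - D j else 0) = D J - D 0"
proof (induction N)
  case (Suc N)
  then obtain J where J: "J \<le> N" "\<forall>j<J. P j" "J = N \<or> \<not> P J"
    "(\<Sum>j<N. if P j then D (Suc j) - D j else 0) = D J - D 0" by blast
  show ?case
  proof (cases "P N")
    case True
    have "P j" if "j \<le> N" for j
      using that True by (induction rule: inc_induct) (auto intro: dec)
    then have "J = N" "\<forall>j<Suc N. P j" using J by auto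
    then show ?thesis using J(4) True by (intro exI[of _ "Suc N"]) simp
  next
    case False
    then show ?thesis using J by (intro exI[of _ J]) auto
  qed
qed simp

lemma indicator_diff_Ioc:
  fixes a b :: real
  assumes "0 \<le> a" "a \<le> b"
  shows "indicator {a<..b} s = (indicator {0<..b} s - indicator {0<..a} s :: real)"
  using assms by (auto simp: indicator_def)

context brownian begin

lemma section_measurable:
  assumes "jointly_measurable H" shows "H t \<in> borel_measurable M"
proof -
  have "(\<lambda>\<omega>. (t, \<omega>)) \<in> measurable M P_time" by measurable
  from measurable_compose[OF this assms[unfolded jointly_measurable_def]] show ?thesis by simp
qed

lemma path_integral_measurable:
  fixes H :: "real \<Rightarrow> 'w \<Rightarrow> 'b::{banach, second_countable_topology}"
  assumes "jointly_measurable H"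
  shows "(\<lambda>\<omega>. LINT s|lborel. H s \<omega>) \<in> borel_measurable M"
proof -
  have "(\<lambda>z. H (fst z) (snd z)) \<in> borel_measurable P_time"
    using assms unfolding jointly_measurable_def .
  then have "(\<lambda>(\<omega>, s). H s \<omega>) \<in> borel_measurable (M \<Otimes>\<^sub>M lborel)"
    by (subst measurable_pair_swap_iff) (simp add: case_prod_beta')
  then show ?thesis
    by (rule lborel.borel_measurable_lebesgue_integral)
qed

lemma jointly_measurable_scaleR:
  fixes H :: "real \<Rightarrow> 'w \<Rightarrow> 'b::{real_normed_vector, second_countable_topology}"
  assumes "jointly_measurable c" "jointly_measurable H"
  shows "jointly_measurable (\<lambda>s \<omega>. c s \<omega> *\<^sub>R H s \<omega>)"
  using assms unfolding jointly_measurable_def by (intro borel_measurable_scaleR)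

end

text \<open>The solution \<open>X\<close> starts at the centre \<open>z\<close> of the ball, the solution \<open>Y\<close> at a point \<open>y\<close> of the ball.\<close>

locale coupled_sde = localized_sde M F W b \<sigma> D z R K L
  for M :: "'w measure" and F :: "real \<Rightarrow> 'w measure" and W :: "real \<Rightarrow> 'w \<Rightarrow> real^'r"
    and b :: "real^'m \<Rightarrow> real^'m" and \<sigma> :: "real^'m \<Rightarrow> real^'r^'m" and D :: "(real^'m) set"
    and z :: "real^'m" and R K L :: real +
  fixes X Y :: "real \<Rightarrow> 'w \<Rightarrow> real^'m" and \<zeta> \<eta> :: "'w \<Rightarrow> ereal" and y :: "real^'m"
  assumes solX: "maximal_solution M F W b \<sigma> D z X \<zeta>"
    and solY: "maximal_solution M F W b \<sigma> D y Y \<eta>" and y: "y \<in> ball z R"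
begin

lemma centre_in_ball: "z \<in> ball z R" using R by simp

abbreviation "exitX \<equiv> exit_time X \<zeta> (ball z R)"
abbreviation "exitY \<equiv> exit_time Y \<eta> (ball z R)"

definition gap :: "real \<Rightarrow> 'w \<Rightarrow> real^'m" where
  "gap s \<omega> = (if 0 \<le> s \<and> ereal s < exitX \<omega> \<and> ereal s < exitY \<omega> then X s \<omega> - Y s \<omega> else 0)"

definition lag :: "(real^'m \<Rightarrow> 'b::real_normed_vector) \<Rightarrow> real \<Rightarrow> 'w \<Rightarrow> 'b" where
  "lag \<phi> s \<omega> = coeff \<phi> X \<zeta> s \<omega> - coeff \<phi> Y \<eta> s \<omega>"

lemma lag_jointly_measurable:
  fixes \<phi> :: "real^'m \<Rightarrow> 'b::{real_normed_vector, second_countable_topology}"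
  shows "continuous_on (ball z R) \<phi> \<Longrightarrow> jointly_measurable (lag \<phi>)"
  unfolding lag_def[abs_def]
  by (intro jointly_measurable_diff coeff_jointly_measurable[OF solX centre_in_ball] coeff_jointly_measurable[OF solY y])

lemma gap_jointly_measurable: "jointly_measurable gap"
proof -
  have "gap = (\<lambda>s \<omega>. coeff (\<lambda>_. 1::real) X \<zeta> s \<omega> *\<^sub>R (coeff (\<lambda>_. 1::real) Y \<eta> s \<omega> *\<^sub>R lag (\<lambda>u. u) s \<omega>))"
    unfolding gap_def coeff_def lag_def by (auto simp: fun_eq_iff)
  moreover have "jointly_measurable (\<lambda>s \<omega>. coeff (\<lambda>_. 1::real) X \<zeta> s \<omega> *\<^sub>R (coeff (\<lambda>_. 1::real) Y \<eta> s \<omega> *\<^sub>R lag (\<lambda>u. u) s \<omega>))"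
    by (intro jointly_measurable_scaleR lag_jointly_measurable coeff_jointly_measurable[OF solX centre_in_ball]
        coeff_jointly_measurable[OF solY y] continuous_intros)
  ultimately show ?thesis by (simp only:)
qed

definition gap_moment :: "real \<Rightarrow> ennreal" where
  "gap_moment s = second_moment (\<lambda>\<omega>. gap s \<omega>)"

definition gap_energy :: "real \<Rightarrow> ennreal" where
  "gap_energy t = energy (\<lambda>s \<omega>. indicator {0<..t} s *\<^sub>R gap s \<omega>)"

lemma indicator_gap_jointly_measurable: "jointly_measurable (\<lambda>s \<omega>. indicator {0<..t} s *\<^sub>R gap s \<omega>)"
  using gap_jointly_measurable unfolding jointly_measurable_def by simp

lemma gap_energy_eq:
  "gap_energy t = (\<integral>\<^sup>+s. gap_moment s * indicator {0<..t} s \<partial>lborel)"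
  unfolding gap_energy_def energy_eq_iterated(2)[OF indicator_gap_jointly_measurable] gap_moment_def
  by (intro nn_integral_cong) (auto simp: indicator_def)

definition grid :: "real \<Rightarrow> nat \<Rightarrow> nat \<Rightarrow> real" where
  "grid t N j = real j * (t / real N)"

definition both_alive :: "real \<Rightarrow> 'w set" where
  "both_alive s = {\<omega>\<in>space M. ereal s < exitX \<omega> \<and> ereal s < exitY \<omega>}"

text \<open>The indicator of the set of times in whose grid cell both solutions were alive at the
  beginning. It is a predictable approximation from above of the indicator of the stochastic interval
  up to the first exit.\<close>

definition window :: "real \<Rightarrow> nat \<Rightarrow> real \<Rightarrow> 'w \<Rightarrow> real" where
  "window t N s \<omega> = (\<Sum>j<N. indicator {grid t N j<..grid t N (Suc j)} s * indicator (both_alive (grid t N j)) \<omega>)"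

lemma both_alive_adapted: "0 \<le> s \<Longrightarrow> both_alive s \<in> sets (F s)"
proof -
  assume s: "0 \<le> s"
  have "{\<omega>\<in>space M. ereal s < exitX \<omega>} \<in> sets (F s)"
    using less_exit_time_adapted[OF solution_continuous_adapted[OF solX] open_ball outside_ball _ s]
      solution_start[OF solX] centre_in_ball by blast
  moreover have "{\<omega>\<in>space M. ereal s < exitY \<omega>} \<in> sets (F s)"
    using less_exit_time_adapted[OF solution_continuous_adapted[OF solY] open_ball outside_ball _ s]
      solution_start[OF solY] y by blast
  ultimately have "{\<omega>\<in>space M. ereal s < exitX \<omega>} \<inter> {\<omega>\<in>space M. ereal s < exitY \<omega>} \<in> sets (F s)" by blast
  also have "{\<omega>\<in>space M. ereal s < exitX \<omega>} \<inter> {\<omega>\<in>space M. ereal s < exitY \<omega>} = both_alive s"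
    unfolding both_alive_def by blast
  finally show ?thesis .
qed

lemma both_alive_measurable: "0 \<le> s \<Longrightarrow> both_alive s \<in> sets M"
  using both_alive_adapted sets_F by blast

context
  fixes t :: real and N :: nat
  assumes t: "0 < t" and N: "0 < N"
begin

lemma grid_nonneg: "0 \<le> grid t N j"
  and grid_Suc: "grid t N (Suc j) = grid t N j + t / real N"
  and grid_le_Suc: "grid t N j \<le> grid t N (Suc j)"
  and grid_0: "grid t N 0 = 0"
  and grid_N: "grid t N N = t"
  and grid_le: "j \<le> N \<Longrightarrow> grid t N j \<le> t"
  using t N unfolding grid_def by (auto simp: field_simps)

lemma window_cases:
  "window t N s \<omega> = 0 \<or>
   window t N s \<omega> = 1 \<and> (\<exists>j<N. grid t N j < s \<and> s \<le> grid t N (Suc j) \<and> \<omega> \<in> both_alive (grid t N j))"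
proof (cases "\<exists>j<N. s \<in> {grid t N j<..grid t N (Suc j)}")
  case False
  then show ?thesis unfolding window_def by (intro disjI1 sum.neutral) (auto simp: indicator_def)
next
  case True
  then obtain j where j: "j < N" "grid t N j < s" "s \<le> grid t N (Suc j)" by auto
  have other: "s \<notin> {grid t N i<..grid t N (Suc i)}" if "i < N" "i \<noteq> j" for i
  proof (cases "i < j")
    case True
    then have "grid t N (Suc i) \<le> grid t N j"
      using partition_mono[of N "grid t N" "Suc i" j] grid_le_Suc j(1) by auto
    then show ?thesis using j by auto
  next
    case False
    then have "grid t N (Suc j) \<le> grid t N i"
      using partition_mono[of N "grid t N" "Suc j" i] grid_le_Suc that by auto
    then show ?thesis using j by auto
  qed
  have "window t N s \<omega> = (\<Sum>i\<in>{j}. indicator {grid t N i<..grid t N (Suc i)} s * indicator (both_alive (grid t N i)) \<omega>)"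
    unfolding window_def using j(1) other by (intro sum.mono_neutral_right) (auto simp: indicator_def)
  also have "\<dots> = indicator (both_alive (grid t N j)) \<omega>" using j by simp
  finally show ?thesis using j by (auto simp: indicator_def)
qed

lemma window_jointly_measurable: "jointly_measurable (window t N)"
proof -
  have [measurable]: "both_alive (grid t N j) \<in> sets M" for j
    using both_alive_measurable[OF grid_nonneg] .
  show ?thesis unfolding jointly_measurable_def window_def by measurable
qed

text \<open>Before the first exit the Lipschitz condition applies. After it the window is open at most until
  the end of the current cell, that is for a time \<open>t/N\<close>, and the coefficients are bounded by \<open>K\<close>.\<close>

lemma window_lag_bound:
  assumes \<phi>: "\<And>u. u \<in> ball z R \<Longrightarrow> norm (\<phi> u) \<le> K"
    "\<And>u v. u \<in> ball z R \<Longrightarrow> v \<in> ball z R \<Longrightarrow> norm (\<phi> u - \<phi> v) \<le> L * norm (u - v)"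
    and \<omega>: "\<omega> \<in> space M"
  defines "\<theta> \<equiv> real_of_ereal (min (exitX \<omega>) (exitY \<omega>))"
  shows "(norm (window t N s \<omega> *\<^sub>R lag \<phi> s \<omega>))\<^sup>2 \<le>
    L\<^sup>2 * (norm (indicator {0<..t} s *\<^sub>R gap s \<omega>))\<^sup>2 + 4 * K\<^sup>2 * indicator {\<theta>..\<theta> + t / real N} s"
proof (cases "window t N s \<omega> = 0")
  case True
  then show ?thesis using R by simp
next
  case False
  then obtain j where w: "window t N s \<omega> = 1" and j: "j < N" "grid t N j < s" "s \<le> grid t N (Suc j)"
    "\<omega> \<in> both_alive (grid t N j)"
    using window_cases by blast
  have s: "0 < s" "s \<le> t" using j(1,2,3) grid_nonneg[of j] grid_le[of "Suc j"] by auto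
  show ?thesis
  proof (cases "ereal s < exitX \<omega> \<and> ereal s < exitY \<omega>")
    case True
    then have in_ball: "X s \<omega> \<in> ball z R" "Y s \<omega> \<in> ball z R"
      using solution_in_ball[OF solX centre_in_ball \<omega>, of s] solution_in_ball[OF solY y \<omega>, of s] s by auto
    have "norm (lag \<phi> s \<omega>) \<le> L * norm (gap s \<omega>)"
      unfolding lag_def gap_def coeff_def using True s \<phi>(2)[OF in_ball] by simp
    then have "(norm (lag \<phi> s \<omega>))\<^sup>2 \<le> (L * norm (gap s \<omega>))\<^sup>2" by (intro power_mono) auto
    moreover have "0 \<le> 4 * K\<^sup>2 * indicator {\<theta>..\<theta> + t / real N} s" by simp
    ultimately have "(norm (lag \<phi> s \<omega>))\<^sup>2 \<le> L\<^sup>2 * (norm (gap s \<omega>))\<^sup>2 + 4 * K\<^sup>2 * indicator {\<theta>..\<theta> + t / real N} s"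
      unfolding power_mult_distrib by linarith
    then show ?thesis using w s by simp
  next
    case False
    define m where "m = min (exitX \<omega>) (exitY \<omega>)"
    have m: "m \<le> ereal s" "ereal (grid t N j) < m" using False j(4) unfolding m_def both_alive_def by (auto simp: min_def)
    have "0 \<le> m" using m(2) grid_nonneg[of j] by (meson ereal_less_eq(5) less_imp_le order_trans)
    then have \<theta>: "m = ereal \<theta>" using m(1) unfolding \<theta>_def m_def[symmetric] by (cases m) auto
    have \<theta>s: "\<theta> \<le> s" "s \<le> \<theta> + t / real N" using m j(3) grid_Suc[of j] unfolding \<theta> by auto
    have c: "norm (coeff \<phi> X \<zeta> s \<omega>) \<le> K" "norm (coeff \<phi> Y \<eta> s \<omega>) \<le> K"
      unfolding coeff_def using solution_in_ball[OF solX centre_in_ball \<omega>, of s] solution_in_ball[OF solY y \<omega>, of s] \<phi>(1) K(1) by auto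
    have "norm (lag \<phi> s \<omega>) \<le> 2 * K"
      unfolding lag_def using norm_triangle_ineq4[of "coeff \<phi> X \<zeta> s \<omega>" "coeff \<phi> Y \<eta> s \<omega>"] c by simp
    then have "(norm (lag \<phi> s \<omega>))\<^sup>2 \<le> (2 * K)\<^sup>2" by (intro power_mono) auto
    then have "(norm (lag \<phi> s \<omega>))\<^sup>2 \<le> 4 * K\<^sup>2" by (simp add: power_mult_distrib)
    then have "(norm (lag \<phi> s \<omega>))\<^sup>2 \<le> L\<^sup>2 * (norm (indicator {0<..t} s *\<^sub>R gap s \<omega>))\<^sup>2 + 4 * K\<^sup>2"
      by (intro add_increasing mult_nonneg_nonneg zero_le_power2)
    moreover have "indicator {\<theta>..\<theta> + t / real N} s = (1::real)" using \<theta>s by simp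
    ultimately show ?thesis unfolding w by (simp only: scaleR_one mult_1_right)
  qed
qed

lemma window_lag_energy:
  fixes \<phi> :: "real^'m \<Rightarrow> 'b::{real_normed_vector, second_countable_topology}"
  assumes \<phi>: "\<And>u. u \<in> ball z R \<Longrightarrow> norm (\<phi> u) \<le> K"
    "\<And>u v. u \<in> ball z R \<Longrightarrow> v \<in> ball z R \<Longrightarrow> norm (\<phi> u - \<phi> v) \<le> L * norm (u - v)"
    and c: "continuous_on (ball z R) \<phi>"
  shows "energy (\<lambda>s \<omega>. window t N s \<omega> *\<^sub>R lag \<phi> s \<omega>) \<le> ennreal (L\<^sup>2) * gap_energy t + ennreal (4 * K\<^sup>2 * (t / real N))"
proof -
  let ?G = "\<lambda>s \<omega>. indicator {0<..t} s *\<^sub>R gap s \<omega>"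
  have jm: "jointly_measurable (\<lambda>s \<omega>. window t N s \<omega> *\<^sub>R lag \<phi> s \<omega>)"
    by (intro jointly_measurable_scaleR window_jointly_measurable lag_jointly_measurable c)
  have path: "square_integral (\<lambda>s. window t N s \<omega> *\<^sub>R lag \<phi> s \<omega>) \<le>
      ennreal (L\<^sup>2) * square_integral (\<lambda>s. ?G s \<omega>) + ennreal (4 * K\<^sup>2 * (t / real N))"
    if \<omega>: "\<omega> \<in> space M" for \<omega>
  proof -
    define \<theta> where "\<theta> = real_of_ereal (min (exitX \<omega>) (exitY \<omega>))"
    have "(\<lambda>s. ?G s \<omega>) \<in> borel_measurable lborel"
      by (rule path_measurable[OF indicator_gap_jointly_measurable \<omega>])
    then have [measurable]: "(\<lambda>s. ennreal ((norm (?G s \<omega>))\<^sup>2)) \<in> borel_measurable lborel"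
      by measurable
    have "square_integral (\<lambda>s. window t N s \<omega> *\<^sub>R lag \<phi> s \<omega>) \<le>
        (\<integral>\<^sup>+s. ennreal (L\<^sup>2) * ennreal ((norm (?G s \<omega>))\<^sup>2) + ennreal (4 * K\<^sup>2) * indicator {\<theta>..\<theta> + t / real N} s \<partial>lborel)"
    proof (rule nn_integral_mono)
      fix s
      have "ennreal ((norm (window t N s \<omega> *\<^sub>R lag \<phi> s \<omega>))\<^sup>2) \<le>
          ennreal (L\<^sup>2 * (norm (?G s \<omega>))\<^sup>2 + 4 * K\<^sup>2 * indicator {\<theta>..\<theta> + t / real N} s)"
        unfolding \<theta>_def by (intro ennreal_leI window_lag_bound[OF \<phi> \<omega>])
      also have "\<dots> = ennreal (L\<^sup>2 * (norm (?G s \<omega>))\<^sup>2) + ennreal (4 * K\<^sup>2 * indicator {\<theta>..\<theta> + t / real N} s)"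
        by (intro ennreal_plus) auto
      also have "ennreal (L\<^sup>2 * (norm (?G s \<omega>))\<^sup>2) = ennreal (L\<^sup>2) * ennreal ((norm (?G s \<omega>))\<^sup>2)"
        by (intro ennreal_mult) auto
      also have "ennreal (4 * K\<^sup>2 * indicator {\<theta>..\<theta> + t / real N} s) = ennreal (4 * K\<^sup>2) * indicator {\<theta>..\<theta> + t / real N} s"
        by (auto simp: indicator_def)
      finally show "ennreal ((norm (window t N s \<omega> *\<^sub>R lag \<phi> s \<omega>))\<^sup>2) \<le>
          ennreal (L\<^sup>2) * ennreal ((norm (?G s \<omega>))\<^sup>2) + ennreal (4 * K\<^sup>2) * indicator {\<theta>..\<theta> + t / real N} s" .
    qed
    also have "\<dots> = (\<integral>\<^sup>+s. ennreal (L\<^sup>2) * ennreal ((norm (?G s \<omega>))\<^sup>2) \<partial>lborel) +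
        (\<integral>\<^sup>+s. ennreal (4 * K\<^sup>2) * indicator {\<theta>..\<theta> + t / real N} s \<partial>lborel)"
      by (intro nn_integral_add) measurable
    also have "(\<integral>\<^sup>+s. ennreal (L\<^sup>2) * ennreal ((norm (?G s \<omega>))\<^sup>2) \<partial>lborel) =
        ennreal (L\<^sup>2) * square_integral (\<lambda>s. ?G s \<omega>)"
      by (intro nn_integral_cmult) measurable
    also have "(\<integral>\<^sup>+s. ennreal (4 * K\<^sup>2) * indicator {\<theta>..\<theta> + t / real N} s \<partial>lborel) = ennreal (4 * K\<^sup>2 * (t / real N))"
    proof -
      have "(\<integral>\<^sup>+s. ennreal (4 * K\<^sup>2) * indicator {\<theta>..\<theta> + t / real N} s \<partial>lborel) = ennreal (4 * K\<^sup>2) * emeasure lborel {\<theta>..\<theta> + t / real N}"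
        by (intro nn_integral_cmult_indicator) simp
      also have "emeasure lborel {\<theta>..\<theta> + t / real N} = ennreal (t / real N)" using t by simp
      also have "ennreal (4 * K\<^sup>2) * ennreal (t / real N) = ennreal (4 * K\<^sup>2 * (t / real N))"
        using t by (intro ennreal_mult[symmetric]) auto
      finally show ?thesis .
    qed
    finally show ?thesis .
  qed
  have pm: "(\<lambda>\<omega>. \<integral>\<^sup>+s. ennreal ((norm (?G s \<omega>))\<^sup>2) \<partial>lborel) \<in> borel_measurable M"
    by (rule path_energy_measurable[OF indicator_gap_jointly_measurable])
  have "energy (\<lambda>s \<omega>. window t N s \<omega> *\<^sub>R lag \<phi> s \<omega>) =
      (\<integral>\<^sup>+\<omega>. \<integral>\<^sup>+s. ennreal ((norm (window t N s \<omega> *\<^sub>R lag \<phi> s \<omega>))\<^sup>2) \<partial>lborel \<partial>M)"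
    by (rule energy_eq_iterated(1)[OF jm])
  also have "\<dots> \<le> (\<integral>\<^sup>+\<omega>. ennreal (L\<^sup>2) * square_integral (\<lambda>s. ?G s \<omega>) + ennreal (4 * K\<^sup>2 * (t / real N)) \<partial>M)"
    by (intro nn_integral_mono path)
  also have "\<dots> = (\<integral>\<^sup>+\<omega>. ennreal (L\<^sup>2) * square_integral (\<lambda>s. ?G s \<omega>) \<partial>M) + (\<integral>\<^sup>+\<omega>. ennreal (4 * K\<^sup>2 * (t / real N)) \<partial>M)"
    using pm by (intro nn_integral_add) simp_all
  also have "(\<integral>\<^sup>+\<omega>. ennreal (L\<^sup>2) * square_integral (\<lambda>s. ?G s \<omega>) \<partial>M) = ennreal (L\<^sup>2) * gap_energy t"
    unfolding gap_energy_def energy_eq_iterated(1)[OF indicator_gap_jointly_measurable] using pm by (intro nn_integral_cmult)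
  also have "(\<integral>\<^sup>+\<omega>. ennreal (4 * K\<^sup>2 * (t / real N)) \<partial>M) = ennreal (4 * K\<^sup>2 * (t / real N))"
    by (simp add: emeasure_space_1)
  finally show ?thesis .
qed

lemma coeff_drift_integrable:
  assumes sol: "maximal_solution M F W b \<sigma> D x X' \<zeta>'" and x: "x \<in> ball z R" and \<omega>: "\<omega> \<in> space M"
  shows "integrable lborel (\<lambda>s. indicator {p<..q} s *\<^sub>R coeff b X' \<zeta>' s \<omega>)"
proof (rule Bochner_Integration.integrable_bound[of _ "\<lambda>s. K * indicator {p<..q} s"])
  have "integrable lborel (indicator {p<..q} :: real \<Rightarrow> real)"
    by (cases "p \<le> q") (auto intro!: integrable_real_indicator)
  then show "integrable lborel (\<lambda>s. K * indicator {p<..q} s)" by simp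
  show "(\<lambda>s. indicator {p<..q} s *\<^sub>R coeff b X' \<zeta>' s \<omega>) \<in> borel_measurable lborel"
    using path_measurable[OF coeff_jointly_measurable[OF sol x cont(1)] \<omega>] by simp
  show "AE s in lborel. norm (indicator {p<..q} s *\<^sub>R coeff b X' \<zeta>' s \<omega>) \<le> norm (K * indicator {p<..q} s)"
    using coeff_bound(1)[OF sol x \<omega>] K(1) by (intro AE_I2) (auto simp: indicator_def)
qed

lemma lag_drift_integrable:
  assumes "\<omega> \<in> space M" shows "integrable lborel (\<lambda>s. indicator {p<..q} s *\<^sub>R lag b s \<omega>)"
  unfolding lag_def scaleR_diff_right
  by (intro Bochner_Integration.integrable_diff coeff_drift_integrable[OF solX centre_in_ball assms] coeff_drift_integrable[OF solY y assms])

lemma window_drift: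
  assumes \<omega>: "\<omega> \<in> space M"
  shows "integrable lborel (\<lambda>s. window t N s \<omega> *\<^sub>R lag b s \<omega>)"
    and "(LINT s|lborel. window t N s \<omega> *\<^sub>R lag b s \<omega>) =
      (\<Sum>j<N. indicator (both_alive (grid t N j)) \<omega> *\<^sub>R
        ((LINT s|lborel. indicator {0<..grid t N (Suc j)} s *\<^sub>R lag b s \<omega>) -
         (LINT s|lborel. indicator {0<..grid t N j} s *\<^sub>R lag b s \<omega>)))"
proof -
  have eq: "window t N s \<omega> *\<^sub>R lag b s \<omega> =
      (\<Sum>j<N. indicator (both_alive (grid t N j)) \<omega> *\<^sub>R (indicator {grid t N j<..grid t N (Suc j)} s *\<^sub>R lag b s \<omega>))" for s
    unfolding window_def scaleR_sum_left by (simp add: mult.commute)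
  note int = lag_drift_integrable[OF \<omega>]
  show "integrable lborel (\<lambda>s. window t N s \<omega> *\<^sub>R lag b s \<omega>)"
    unfolding eq by (intro Bochner_Integration.integrable_sum integrable_scaleR_right int)
  have cell: "(LINT s|lborel. indicator {grid t N j<..grid t N (Suc j)} s *\<^sub>R lag b s \<omega>) =
      (LINT s|lborel. indicator {0<..grid t N (Suc j)} s *\<^sub>R lag b s \<omega>) -
      (LINT s|lborel. indicator {0<..grid t N j} s *\<^sub>R lag b s \<omega>)" for j
    unfolding indicator_diff_Ioc[OF grid_nonneg grid_le_Suc] scaleR_diff_left
    by (intro Bochner_Integration.integral_diff int)
  show "(LINT s|lborel. window t N s \<omega> *\<^sub>R lag b s \<omega>) =
      (\<Sum>j<N. indicator (both_alive (grid t N j)) \<omega> *\<^sub>R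
        ((LINT s|lborel. indicator {0<..grid t N (Suc j)} s *\<^sub>R lag b s \<omega>) -
         (LINT s|lborel. indicator {0<..grid t N j} s *\<^sub>R lag b s \<omega>)))"
    unfolding eq cell[symmetric]
    by (simp only: Bochner_Integration.integral_sum[OF integrable_scaleR_right[OF int]] Bochner_Integration.integral_scaleR_right)
qed

text \<open>The Cauchy--Schwarz inequality in time.\<close>

lemma window_drift_second_moment:
  "second_moment (\<lambda>\<omega>. LINT s|lborel. window t N s \<omega> *\<^sub>R lag b s \<omega>) \<le>
    ennreal t * energy (\<lambda>s \<omega>. window t N s \<omega> *\<^sub>R lag b s \<omega>)"
proof -
  let ?H = "\<lambda>s \<omega>. window t N s \<omega> *\<^sub>R lag b s \<omega>"
  have jm: "jointly_measurable ?H"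
    by (intro jointly_measurable_scaleR window_jointly_measurable lag_jointly_measurable cont)
  have path: "ennreal ((norm (LINT s|lborel. ?H s \<omega>))\<^sup>2) \<le> ennreal t * square_integral (\<lambda>s. ?H s \<omega>)"
    if \<omega>: "\<omega> \<in> space M" for \<omega>
  proof -
    have "(\<lambda>s. ?H s \<omega>) \<in> borel_measurable lborel" by (rule path_measurable[OF jm \<omega>])
    then have m: "(\<lambda>s. ennreal (norm (?H s \<omega>))) \<in> borel_measurable lborel" by measurable
    have supp: "ennreal (norm (?H s \<omega>)) = ennreal (norm (?H s \<omega>)) * indicator {0<..t} s" for s
    proof (cases "window t N s \<omega> = 0")
      case False
      then obtain j where "j < N" "grid t N j < s" "s \<le> grid t N (Suc j)" using window_cases by blast
      then have "0 < s" "s \<le> t" using grid_nonneg[of j] grid_le[of "Suc j"] by auto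
      then show ?thesis by simp
    qed simp
    have "ennreal (norm (LINT s|lborel. ?H s \<omega>)) \<le> (\<integral>\<^sup>+s. ennreal (norm (?H s \<omega>)) \<partial>lborel)"
      by (rule integral_norm_bound_ennreal[OF window_drift(1)[OF \<omega>]])
    also have "\<dots> = (\<integral>\<^sup>+s. ennreal (norm (?H s \<omega>)) * indicator {0<..t} s \<partial>lborel)"
      by (subst supp) (rule refl)
    finally have "(ennreal (norm (LINT s|lborel. ?H s \<omega>)))\<^sup>2 \<le> (\<integral>\<^sup>+s. ennreal (norm (?H s \<omega>)) * indicator {0<..t} s \<partial>lborel)\<^sup>2"
      by (rule power_mono) simp
    also have "\<dots> \<le> (\<integral>\<^sup>+s. (ennreal (norm (?H s \<omega>)))\<^sup>2 \<partial>lborel) * (\<integral>\<^sup>+s. (indicator {0<..t} s)\<^sup>2 \<partial>lborel)"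
      using m by (intro Cauchy_Schwarz_nn_integral) auto
    also have "(\<integral>\<^sup>+s. (indicator {0<..t} s)\<^sup>2 \<partial>lborel) = (\<integral>\<^sup>+s. indicator {0<..t} s \<partial>lborel)"
      by (intro nn_integral_cong) (auto simp: indicator_def)
    also have "\<dots> = ennreal t" using t by (subst nn_integral_indicator) auto
    also have "(\<integral>\<^sup>+s. (ennreal (norm (?H s \<omega>)))\<^sup>2 \<partial>lborel) = square_integral (\<lambda>s. ?H s \<omega>)"
      by (simp only: ennreal_power[OF norm_ge_zero])
    finally show ?thesis by (simp only: ennreal_power[OF norm_ge_zero] mult.commute)
  qed
  have "second_moment (\<lambda>\<omega>. LINT s|lborel. ?H s \<omega>) \<le>
      (\<integral>\<^sup>+\<omega>. ennreal t * square_integral (\<lambda>s. ?H s \<omega>) \<partial>M)"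
    by (intro nn_integral_mono path)
  also have "\<dots> = ennreal t * energy ?H"
    unfolding energy_eq_iterated(1)[OF jm] by (intro nn_integral_cmult path_energy_measurable[OF jm])
  finally show ?thesis .
qed

lemma window_martingale:
  assumes I: "\<And>j. ito_limit (\<lambda>s \<omega>. indicator {0<..grid t N j} s *\<^sub>R lag \<sigma> s \<omega>) (I j)"
  shows "ito_limit (\<lambda>s \<omega>. window t N s \<omega> *\<^sub>R lag \<sigma> s \<omega>)
    (\<lambda>\<omega>. \<Sum>j<N. indicator (both_alive (grid t N j)) \<omega> *\<^sub>R (I (Suc j) \<omega> - I j \<omega>))"
proof -
  have "ito_limit (\<lambda>s \<omega>. (indicator {grid t N j<..} s * indicator (both_alive (grid t N j)) \<omega>) *\<^sub>R
      (indicator {0<..grid t N (Suc j)} s *\<^sub>R lag \<sigma> s \<omega>))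
      (\<lambda>\<omega>. indicator (both_alive (grid t N j)) \<omega> *\<^sub>R (I (Suc j) \<omega> - I j \<omega>))" for j
  proof (rule ito_limit_restrict[OF I _ grid_nonneg both_alive_adapted[OF grid_nonneg]])
    have "(\<lambda>s \<omega>. indicator {..grid t N j} s *\<^sub>R (indicator {0<..grid t N (Suc j)} s *\<^sub>R lag \<sigma> s \<omega>)) =
        (\<lambda>s \<omega>. indicator {0<..grid t N j} s *\<^sub>R lag \<sigma> s \<omega>)"
      using grid_le_Suc[of j] by (auto simp: indicator_def fun_eq_iff)
    then show "ito_limit (\<lambda>s \<omega>. indicator {..grid t N j} s *\<^sub>R (indicator {0<..grid t N (Suc j)} s *\<^sub>R lag \<sigma> s \<omega>)) (I j)"
      using I[of j] by simp
  qed
  from ito_limit_sum[of N, OF this]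
  have "ito_limit (\<lambda>s \<omega>. \<Sum>j<N. (indicator {grid t N j<..} s * indicator (both_alive (grid t N j)) \<omega>) *\<^sub>R
      (indicator {0<..grid t N (Suc j)} s *\<^sub>R lag \<sigma> s \<omega>))
    (\<lambda>\<omega>. \<Sum>j<N. indicator (both_alive (grid t N j)) \<omega> *\<^sub>R (I (Suc j) \<omega> - I j \<omega>))" .
  also have "(\<lambda>s \<omega>. \<Sum>j<N. (indicator {grid t N j<..} s * indicator (both_alive (grid t N j)) \<omega>) *\<^sub>R
      (indicator {0<..grid t N (Suc j)} s *\<^sub>R lag \<sigma> s \<omega>)) = (\<lambda>s \<omega>. window t N s \<omega> *\<^sub>R lag \<sigma> s \<omega>)"
    unfolding window_def scaleR_sum_left
  proof (intro ext sum.cong refl)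
    fix s \<omega> j
    show "(indicator {grid t N j<..} s * indicator (both_alive (grid t N j)) \<omega>) *\<^sub>R (indicator {0<..grid t N (Suc j)} s *\<^sub>R lag \<sigma> s \<omega>) =
        (indicator {grid t N j<..grid t N (Suc j)} s * indicator (both_alive (grid t N j)) \<omega>) *\<^sub>R lag \<sigma> s \<omega>"
      using grid_nonneg[of j] by (auto simp: indicator_def)
  qed
  finally show ?thesis .
qed

end

end

section \<open>Two solutions over a short time\<close>

lemma nn_integral_square_add3:
  fixes f g h :: "'a \<Rightarrow> 'b::{real_normed_vector, second_countable_topology}"
  assumes [measurable]: "f \<in> borel_measurable N" "g \<in> borel_measurable N" "h \<in> borel_measurable N"
  shows "(\<integral>\<^sup>+x. ennreal ((norm (f x + g x + h x))\<^sup>2) \<partial>N) \<le>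
    3 * (\<integral>\<^sup>+x. ennreal ((norm (f x))\<^sup>2) \<partial>N) + 3 * (\<integral>\<^sup>+x. ennreal ((norm (g x))\<^sup>2) \<partial>N) + 3 * (\<integral>\<^sup>+x. ennreal ((norm (h x))\<^sup>2) \<partial>N)"
proof -
  have le: "(norm (u + v + w))\<^sup>2 \<le> 3 * (norm u)\<^sup>2 + 3 * (norm v)\<^sup>2 + 3 * (norm w)\<^sup>2" for u v w :: 'b
  proof -
    have "norm (u + v + w) \<le> norm u + norm v + norm w"
      using norm_triangle_ineq[of "u + v" w] norm_triangle_ineq[of u v] by linarith
    then have "(norm (u + v + w))\<^sup>2 \<le> (norm u + norm v + norm w)\<^sup>2"
      by (intro power_mono) auto
    also have "\<dots> \<le> 3 * (norm u)\<^sup>2 + 3 * (norm v)\<^sup>2 + 3 * (norm w)\<^sup>2"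
      using sum_squares_ge_zero[of "norm u - norm v" "norm v - norm w"] zero_le_power2[of "norm u - norm w"]
      by (simp add: power2_eq_square algebra_simps)
    finally show ?thesis .
  qed
  have "(\<integral>\<^sup>+x. ennreal ((norm (f x + g x + h x))\<^sup>2) \<partial>N) \<le>
      (\<integral>\<^sup>+x. 3 * ennreal ((norm (f x))\<^sup>2) + 3 * ennreal ((norm (g x))\<^sup>2) + 3 * ennreal ((norm (h x))\<^sup>2) \<partial>N)"
  proof (rule nn_integral_mono)
    fix x
    have "ennreal ((norm (f x + g x + h x))\<^sup>2) \<le> ennreal (3 * (norm (f x))\<^sup>2 + 3 * (norm (g x))\<^sup>2 + 3 * (norm (h x))\<^sup>2)"
      by (intro ennreal_leI le)
    then show "ennreal ((norm (f x + g x + h x))\<^sup>2) \<le> 3 * ennreal ((norm (f x))\<^sup>2) + 3 * ennreal ((norm (g x))\<^sup>2) + 3 * ennreal ((norm (h x))\<^sup>2)"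
      by (simp add: ennreal_plus ennreal_mult)
  qed
  also have "\<dots> = 3 * (\<integral>\<^sup>+x. ennreal ((norm (f x))\<^sup>2) \<partial>N) + 3 * (\<integral>\<^sup>+x. ennreal ((norm (g x))\<^sup>2) \<partial>N) + 3 * (\<integral>\<^sup>+x. ennreal ((norm (h x))\<^sup>2) \<partial>N)"
    by (simp add: nn_integral_add nn_integral_cmult)
  finally show ?thesis .
qed

context coupled_sde begin

text \<open>Each solution is stopped at its own exit time.\<close>

definition stopped_difference :: "real \<Rightarrow> 'w \<Rightarrow> real^'m" where
  "stopped_difference s \<omega> = X (real_of_ereal (min (ereal s) (exitX \<omega>))) \<omega> - Y (real_of_ereal (min (ereal s) (exitY \<omega>))) \<omega>"

abbreviation telescoped :: "real \<Rightarrow> nat \<Rightarrow> ('w \<Rightarrow> real^'m) \<Rightarrow> 'w \<Rightarrow> bool" where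
  "telescoped t N S \<omega> \<equiv> \<exists>J\<le>N. (\<forall>j<J. \<omega> \<in> both_alive (grid t N j)) \<and>
    (J = N \<or> \<omega> \<notin> both_alive (grid t N J)) \<and> S \<omega> = stopped_difference (grid t N J) \<omega>"

abbreviation grid_bound :: "real \<Rightarrow> nat \<Rightarrow> ennreal" where
  "grid_bound t N \<equiv> ennreal (3 * (norm (z - y))\<^sup>2) +
    ennreal (3 * (t + 2)) * (ennreal (L\<^sup>2) * gap_energy t + ennreal (4 * K\<^sup>2 * (t / real N)))"

lemma both_alive_mono:
  assumes "p \<le> q" "\<omega> \<in> both_alive q" shows "\<omega> \<in> both_alive p"
proof -
  have pq: "ereal p \<le> ereal q" using assms(1) by simp
  show ?thesis using assms(2) le_less_trans[OF pq] unfolding both_alive_def by blast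
qed

text \<open>The variable \<open>S\<close> is the starting difference plus the drift and the stochastic integral over the
  window. By the integral equations it is a sum of increments of the stopped difference, which
  telescopes to its value at the first grid point \<open>J\<close> where one of the solutions has left the ball, or
  at \<open>t\<close> if there is none.\<close>

lemma grid_stopped_difference:
  assumes t: "0 < t" and N: "0 < N"
  shows "\<exists>S\<in>borel_measurable M.
    second_moment S \<le> grid_bound t N \<and>
    (AE \<omega> in M. telescoped t N S \<omega>)"
proof -
  note gn = grid_nonneg[OF t N]
  have "\<forall>j. \<exists>I. ito_limit (\<lambda>s \<omega>. indicator {0<..grid t N j} s *\<^sub>R coeff \<sigma> X \<zeta> s \<omega>) I \<and>
    (AE \<omega> in M. X (real_of_ereal (min (ereal (grid t N j)) (exitX \<omega>))) \<omega> =
       z + (LINT s|lborel. indicator {0<..grid t N j} s *\<^sub>R coeff b X \<zeta> s \<omega>) + I \<omega>)"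
    by (intro allI solution_integral_equation[OF solX centre_in_ball gn])
  from choice[OF this] obtain IX where IX: "\<forall>j. ito_limit (\<lambda>s \<omega>. indicator {0<..grid t N j} s *\<^sub>R coeff \<sigma> X \<zeta> s \<omega>) (IX j) \<and>
    (AE \<omega> in M. X (real_of_ereal (min (ereal (grid t N j)) (exitX \<omega>))) \<omega> =
       z + (LINT s|lborel. indicator {0<..grid t N j} s *\<^sub>R coeff b X \<zeta> s \<omega>) + IX j \<omega>)" ..
  have "\<forall>j. \<exists>I. ito_limit (\<lambda>s \<omega>. indicator {0<..grid t N j} s *\<^sub>R coeff \<sigma> Y \<eta> s \<omega>) I \<and>
    (AE \<omega> in M. Y (real_of_ereal (min (ereal (grid t N j)) (exitY \<omega>))) \<omega> =
       y + (LINT s|lborel. indicator {0<..grid t N j} s *\<^sub>R coeff b Y \<eta> s \<omega>) + I \<omega>)"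
    by (intro allI solution_integral_equation[OF solY y gn])
  from choice[OF this] obtain IY where IY: "\<forall>j. ito_limit (\<lambda>s \<omega>. indicator {0<..grid t N j} s *\<^sub>R coeff \<sigma> Y \<eta> s \<omega>) (IY j) \<and>
    (AE \<omega> in M. Y (real_of_ereal (min (ereal (grid t N j)) (exitY \<omega>))) \<omega> =
       y + (LINT s|lborel. indicator {0<..grid t N j} s *\<^sub>R coeff b Y \<eta> s \<omega>) + IY j \<omega>)" ..
  define I where "I j \<omega> = IX j \<omega> - IY j \<omega>" for j \<omega>
  define B where "B j \<omega> = (LINT s|lborel. indicator {0<..grid t N j} s *\<^sub>R lag b s \<omega>)" for j \<omega>
  have I: "ito_limit (\<lambda>s \<omega>. indicator {0<..grid t N j} s *\<^sub>R lag \<sigma> s \<omega>) (I j)" for j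
    using ito_limit_diff[OF conjunct1[OF IX[rule_format, of j]] conjunct1[OF IY[rule_format, of j]]]
    unfolding lag_def I_def[abs_def] scaleR_diff_right .
  define drift where "drift \<omega> = (LINT s|lborel. window t N s \<omega> *\<^sub>R lag b s \<omega>)" for \<omega>
  define mart where "mart \<omega> = (\<Sum>j<N. indicator (both_alive (grid t N j)) \<omega> *\<^sub>R (I (Suc j) \<omega> - I j \<omega>))" for \<omega>
  define S where "S \<omega> = (z - y) + drift \<omega> + mart \<omega>" for \<omega>
  define E where "E = ennreal (L\<^sup>2) * gap_energy t + ennreal (4 * K\<^sup>2 * (t / real N))"
  have lim: "ito_limit (\<lambda>s \<omega>. window t N s \<omega> *\<^sub>R lag \<sigma> s \<omega>) mart"
    unfolding mart_def[abs_def] by (rule window_martingale[OF t N I])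
  have mm: "mart \<in> borel_measurable M" using lim unfolding ito_limit_def by blast
  have dm: "drift \<in> borel_measurable M"
    unfolding drift_def[abs_def]
    by (intro path_integral_measurable jointly_measurable_scaleR window_jointly_measurable[OF t N] lag_jointly_measurable cont)
  have Sm: "S \<in> borel_measurable M" unfolding S_def[abs_def] using mm dm by simp
  have m2: "second_moment mart \<le> 2 * E"
    unfolding E_def
    by (rule order_trans[OF ito_limit_second_moment[OF lim] mult_left_mono[OF window_lag_energy[OF t N K(3) L(3) cont(2)]]]) auto
  have d2: "second_moment drift \<le> ennreal t * E"
    unfolding E_def drift_def
    by (rule order_trans[OF window_drift_second_moment[OF t N] mult_left_mono[OF window_lag_energy[OF t N K(2) L(2) cont(1)]]]) auto
  have "second_moment S \<le>
      3 * second_moment (\<lambda>\<omega>. z - y) + 3 * second_moment drift +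
      3 * second_moment mart"
    unfolding S_def using mm dm by (intro nn_integral_square_add3) auto
  also have "\<dots> \<le> 3 * ennreal ((norm (z - y))\<^sup>2) + 3 * (ennreal t * E) + 3 * (2 * E)"
    using m2 d2 by (intro add_mono mult_left_mono) (auto simp: emeasure_space_1)
  also have "\<dots> = ennreal (3 * (norm (z - y))\<^sup>2) + (3 * ennreal t + 6) * E"
    by (simp add: ennreal_mult algebra_simps)
  also have "3 * ennreal t + 6 = ennreal (3 * (t + 2))"
    using t by (simp add: ennreal_plus ennreal_mult distrib_left)
  finally have S2: "second_moment S \<le> ennreal (3 * (norm (z - y))\<^sup>2) + ennreal (3 * (t + 2)) * E" .
  have "AE \<omega> in M. \<forall>j. X (real_of_ereal (min (ereal (grid t N j)) (exitX \<omega>))) \<omega> =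
       z + (LINT s|lborel. indicator {0<..grid t N j} s *\<^sub>R coeff b X \<zeta> s \<omega>) + IX j \<omega>"
    unfolding AE_all_countable using IX by blast
  moreover have "AE \<omega> in M. \<forall>j. Y (real_of_ereal (min (ereal (grid t N j)) (exitY \<omega>))) \<omega> =
       y + (LINT s|lborel. indicator {0<..grid t N j} s *\<^sub>R coeff b Y \<eta> s \<omega>) + IY j \<omega>"
    unfolding AE_all_countable using IY by blast
  ultimately have "AE \<omega> in M. telescoped t N S \<omega>"
    using AE_space
  proof eventually_elim
    case (elim \<omega>)
    define \<Delta> where "\<Delta> j = stopped_difference (grid t N j) \<omega>" for j
    have B: "B j \<omega> = (LINT s|lborel. indicator {0<..grid t N j} s *\<^sub>R coeff b X \<zeta> s \<omega>) -
        (LINT s|lborel. indicator {0<..grid t N j} s *\<^sub>R coeff b Y \<eta> s \<omega>)" for j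
      unfolding B_def lag_def scaleR_diff_right
      by (intro Bochner_Integration.integral_diff coeff_drift_integrable[OF t N solX centre_in_ball elim(3)] coeff_drift_integrable[OF t N solY y elim(3)])
    have \<Delta>: "\<Delta> j = (z - y) + B j \<omega> + I j \<omega>" for j
      unfolding \<Delta>_def stopped_difference_def B I_def elim(1)[rule_format, of j] elim(2)[rule_format, of j]
      by (simp add: algebra_simps)
    have \<Delta>0: "\<Delta> 0 = z - y"
    proof -
      have "min (ereal 0) (exitX \<omega>) = 0" "min (ereal 0) (exitY \<omega>) = 0"
        using exit_time_nonneg[of X \<zeta> "ball z R" \<omega>] exit_time_nonneg[of Y \<eta> "ball z R" \<omega>]
        by (auto simp: min_def zero_ereal_def)
      then show ?thesis unfolding \<Delta>_def stopped_difference_def grid_0[OF t N]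
        using solution_start[OF solX elim(3)] solution_start[OF solY elim(3)] by simp
    qed
    have "\<exists>J\<le>N. (\<forall>j<J. \<omega> \<in> both_alive (grid t N j)) \<and> (J = N \<or> \<omega> \<notin> both_alive (grid t N J)) \<and>
        (\<Sum>j<N. if \<omega> \<in> both_alive (grid t N j) then \<Delta> (Suc j) - \<Delta> j else 0) = \<Delta> J - \<Delta> 0"
      by (rule telescope_until) (rule both_alive_mono[OF grid_le_Suc[OF t N]])
    then obtain J where J: "J \<le> N" "\<forall>j<J. \<omega> \<in> both_alive (grid t N j)" "J = N \<or> \<omega> \<notin> both_alive (grid t N J)"
        "(\<Sum>j<N. if \<omega> \<in> both_alive (grid t N j) then \<Delta> (Suc j) - \<Delta> j else 0) = \<Delta> J - \<Delta> 0"
      by (elim exE conjE) (rule that)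
    have "(\<Sum>j<N. if \<omega> \<in> both_alive (grid t N j) then \<Delta> (Suc j) - \<Delta> j else 0) =
        (\<Sum>j<N. indicator (both_alive (grid t N j)) \<omega> *\<^sub>R (B (Suc j) \<omega> - B j \<omega>) +
          indicator (both_alive (grid t N j)) \<omega> *\<^sub>R (I (Suc j) \<omega> - I j \<omega>))"
      unfolding \<Delta> by (intro sum.cong refl) (auto simp: indicator_def algebra_simps)
    also have "\<dots> = drift \<omega> + mart \<omega>"
      unfolding drift_def mart_def window_drift(2)[OF t N elim(3)] B_def by (rule sum.distrib)
    finally have "S \<omega> = \<Delta> J" using J(4) \<Delta>0 unfolding S_def by (simp add: algebra_simps)
    then show ?case using J(1-3) unfolding \<Delta>_def by blast
  qed
  then show ?thesis using Sm S2 unfolding E_def by blast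
qed

text \<open>If both solutions are alive at time \<open>t\<close>, the sum runs over the whole grid and \<open>S\<close> is their
  difference at \<open>t\<close>.\<close>

lemma gap_moment_le:
  assumes t: "0 < t" and N: "0 < N"
    and S: "AE \<omega> in M. telescoped t N S \<omega>"
  shows "gap_moment t \<le> second_moment S"
  unfolding gap_moment_def
proof (rule nn_integral_mono_AE, use S AE_space in eventually_elim)
  case (elim \<omega>)
  then obtain J where J: "J \<le> N" "J = N \<or> \<omega> \<notin> both_alive (grid t N J)" "S \<omega> = stopped_difference (grid t N J) \<omega>"
    by blast
  show ?case
  proof (cases "ereal t < exitX \<omega> \<and> ereal t < exitY \<omega>")
    case True
    then have "\<omega> \<in> both_alive t" unfolding both_alive_def using elim(2) by simp
    then have "\<omega> \<in> both_alive (grid t N J)" by (rule both_alive_mono[OF grid_le[OF t N J(1)]])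
    then have "J = N" using J(2) by blast
    then have "S \<omega> = X t \<omega> - Y t \<omega>"
      using True unfolding J(3) stopped_difference_def by (simp add: grid_N[OF t N] min_absorb1 less_imp_le)
    then show ?thesis using True t unfolding gap_def by simp
  next
    case False
    then have "gap t \<omega> = 0" unfolding gap_def by auto
    then show ?thesis by simp
  qed
qed

definition early_exit :: "real \<Rightarrow> 'w set" where
  "early_exit t = {\<omega>\<in>space M. exitY \<omega> \<le> ereal t \<and> ereal t < exit_time X \<zeta> (ball z (R / 2)) \<omega>}"

lemma early_exit_measurable: "early_exit t \<in> sets M"
proof -
  have "ball z (R / 2) \<subseteq> ball z R" using R by (intro subset_ball) simp
  then have "- ball z (R / 2) \<noteq> {}" using outside_ball by blast
  then have [measurable]: "(\<lambda>\<omega>. exit_time X \<zeta> (ball z (R / 2)) \<omega>) \<in> borel_measurable M"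
    by (intro exit_time_measurable solution_continuous_adapted[OF solX] open_ball)
  have [measurable]: "exitY \<in> borel_measurable M"
    by (intro exit_time_measurable solution_continuous_adapted[OF solY] open_ball outside_ball)
  show ?thesis unfolding early_exit_def by measurable
qed

text \<open>On this event \<open>S\<close> compares a value of \<open>X\<close> in the ball of radius \<open>R/2\<close> with the exit position of \<open>Y\<close>,
  which has distance at least \<open>R\<close> from the centre.\<close>

lemma early_exit_le:
  assumes t: "0 < t" and N: "0 < N"
    and S: "AE \<omega> in M. telescoped t N S \<omega>"
  shows "ennreal ((R / 2)\<^sup>2 * prob (early_exit t)) \<le> second_moment S"
proof -
  have "ennreal ((R / 2)\<^sup>2 * prob (early_exit t)) = (\<integral>\<^sup>+\<omega>. ennreal ((R / 2)\<^sup>2) * indicator (early_exit t) \<omega> \<partial>M)"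
    by (subst nn_integral_cmult_indicator[OF early_exit_measurable]) (simp only: emeasure_eq_measure ennreal_mult[OF zero_le_power2 measure_nonneg])
  also have "\<dots> \<le> second_moment S"
  proof (rule nn_integral_mono_AE, use S AE_space solution_exits_alive[OF solY y] in eventually_elim)
    case (elim \<omega>)
    then obtain J where J: "J \<le> N" "J = N \<or> \<omega> \<notin> both_alive (grid t N J)" "S \<omega> = stopped_difference (grid t N J) \<omega>"
      by blast
    show ?case
    proof (cases "\<omega> \<in> early_exit t")
      case True
      then have e: "exitY \<omega> \<le> ereal t" "ereal t < exit_time X \<zeta> (ball z (R / 2)) \<omega>" unfolding early_exit_def by auto
      define g where "g = grid t N J"
      have g: "0 \<le> g" "g \<le> t" unfolding g_def using grid_nonneg[OF t N] grid_le[OF t N J(1)] by auto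
      have "exit_time X \<zeta> (ball z (R / 2)) \<omega> \<le> exitX \<omega>" using R by (intro exit_time_mono subset_ball) simp
      then have gX: "ereal g < exitX \<omega>" using g e(2) by (auto intro: le_less_trans[of _ "ereal t"] less_le_trans)
      have gY: "exitY \<omega> \<le> ereal g"
      proof (rule ccontr)
        assume n: "\<not> exitY \<omega> \<le> ereal g"
        then have "\<omega> \<in> both_alive g" using gX elim(2) unfolding both_alive_def by simp
        then have "J = N" using J(2) unfolding g_def by blast
        then have "g = t" unfolding g_def using grid_N[OF t N] by simp
        then show False using n e(1) by simp
      qed
      have "0 \<le> exitY \<omega>" by (rule exit_time_nonneg)
      with e(1) obtain u where u: "exitY \<omega> = ereal u" by (cases "exitY \<omega>") auto
      have Yu: "R \<le> dist z (Y u \<omega>)" using elim(3) u by (auto simp: not_less)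
      have Xg: "dist z (X g \<omega>) < R / 2"
      proof (cases "g = 0")
        case True
        then show ?thesis using solution_start[OF solX elim(2)] R by simp
      next
        case False
        then show ?thesis using less_exit_timeD[OF e(2), of g] g by auto
      qed
      have "S \<omega> = X g \<omega> - Y u \<omega>"
        using gX gY unfolding J(3) stopped_difference_def g_def[symmetric] u
        by (simp add: min_absorb1 less_imp_le min_absorb2)
      then have "R / 2 \<le> norm (S \<omega>)"
        using Yu Xg dist_triangle[of z "Y u \<omega>" "X g \<omega>"] by (simp add: dist_norm)
      then have "(R / 2)\<^sup>2 \<le> (norm (S \<omega>))\<^sup>2" using R by (intro power_mono) auto
      then show ?thesis using True by (simp only: indicator_simps mult_1_right ennreal_leI)
    next
      case False
      then show ?thesis by simp
    qed
  qed
  finally show ?thesis .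
qed

text \<open>Finiteness is what allows a multiple of the supremum over short times to be absorbed into the
  supremum itself.\<close>

lemma gap_moment_finite: "gap_moment s \<le> ennreal (4 * R\<^sup>2)"
proof -
  have "(norm (gap s \<omega>))\<^sup>2 \<le> 4 * R\<^sup>2" if \<omega>: "\<omega> \<in> space M" for \<omega>
  proof (cases "0 \<le> s \<and> ereal s < exitX \<omega> \<and> ereal s < exitY \<omega>")
    case True
    then have "dist z (X s \<omega>) < R" "dist z (Y s \<omega>) < R"
      using solution_in_ball[OF solX centre_in_ball \<omega>, of s] solution_in_ball[OF solY y \<omega>, of s] by auto
    then have "norm (gap s \<omega>) \<le> 2 * R"
      using True dist_triangle3[of "X s \<omega>" "Y s \<omega>" z] unfolding gap_def by (simp add: dist_norm)
    then have "(norm (gap s \<omega>))\<^sup>2 \<le> (2 * R)\<^sup>2" by (intro power_mono) auto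
    then show ?thesis by (simp add: power_mult_distrib)
  next
    case False
    then have "gap s \<omega> = 0" unfolding gap_def by auto
    then show ?thesis by simp
  qed
  then have "gap_moment s \<le> (\<integral>\<^sup>+\<omega>. ennreal (4 * R\<^sup>2) \<partial>M)"
    unfolding gap_moment_def by (intro nn_integral_mono ennreal_leI)
  then show ?thesis by (simp add: emeasure_space_1)
qed

lemma gap_moment_grid_bound:
  assumes t: "0 < t" and N: "0 < N"
  shows "gap_moment t \<le> grid_bound t N"
    and "ennreal ((R / 2)\<^sup>2 * prob (early_exit t)) \<le> grid_bound t N"
proof -
  from grid_stopped_difference[OF t N] obtain S where
    S: "second_moment S \<le> grid_bound t N"
    "AE \<omega> in M. telescoped t N S \<omega>"
    by (elim bexE conjE) (rule that)
  show "gap_moment t \<le> grid_bound t N"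
    by (rule order_trans[OF gap_moment_le[OF t N S(2)] S(1)])
  show "ennreal ((R / 2)\<^sup>2 * prob (early_exit t)) \<le> grid_bound t N"
    by (rule order_trans[OF early_exit_le[OF t N S(2)] S(1)])
qed

lemma refine_grid:
  assumes Q: "\<And>N. 0 < N \<Longrightarrow> Q \<le> A + ennreal c * (B + ennreal (d * (u / real N)))"
  shows "Q \<le> A + ennreal c * B"
proof (rule LIMSEQ_le_const)
  have "(\<lambda>N. d * (u / real N)) \<longlonglongrightarrow> d * 0" by (intro tendsto_mult tendsto_const lim_const_over_n)
  then have "(\<lambda>N. ennreal (d * (u / real N))) \<longlonglongrightarrow> ennreal 0" using tendsto_ennrealI by fastforce
  then have "(\<lambda>N. A + ennreal c * (B + ennreal (d * (u / real N)))) \<longlonglongrightarrow> A + ennreal c * (B + ennreal 0)"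
    by (intro tendsto_add tendsto_const ennreal_tendsto_cmult) auto
  then show "(\<lambda>N. A + ennreal c * (B + ennreal (d * (u / real N)))) \<longlonglongrightarrow> A + ennreal c * B" by simp
  show "\<exists>N. \<forall>n\<ge>N. Q \<le> A + ennreal c * (B + ennreal (d * (u / real n)))"
    using Q by (intro exI[of _ 1]) auto
qed

text \<open>With \<open>s\<close> the supremum of the second moment over \<open>(0, T]\<close>, the integral term of the estimate is
  at most \<open>9 L\<^sup>2 T s \<le> s/2\<close>; hence \<open>s \<le> 3 |z - y|\<^sup>2 + s/2\<close>.\<close>

lemma short_time_moments:
  assumes T: "T \<le> 1" "18 * L\<^sup>2 * T \<le> 1" and t: "0 < t" "t \<le> T"
  shows "gap_moment t \<le> ennreal (6 * (norm (z - y))\<^sup>2)"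
    and "(R / 2)\<^sup>2 * prob (early_exit t) \<le> 6 * (norm (z - y))\<^sup>2"
proof -
  define a where "a = (norm (z - y))\<^sup>2"
  have a: "0 \<le> a" unfolding a_def by simp
  define \<Sigma> where "\<Sigma> = (SUP u\<in>{0<..T}. gap_moment u)"
  have "\<Sigma> \<le> ennreal (4 * R\<^sup>2)" unfolding \<Sigma>_def by (intro SUP_least gap_moment_finite)
  then obtain s where s: "\<Sigma> = ennreal s" "0 \<le> s"
    by (cases \<Sigma>) (auto simp: top_unique)
  have energy: "gap_energy u \<le> ennreal (s * T)" if u: "0 < u" "u \<le> T" for u
  proof -
    have "gap_energy u \<le> (\<integral>\<^sup>+v. ennreal s * indicator {0<..u} v \<partial>lborel)"
      unfolding gap_energy_eq
    proof (rule nn_integral_mono)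
      fix v
      show "gap_moment v * indicator {0<..u} v \<le> ennreal s * indicator {0<..u} v"
      proof (cases "v \<in> {0<..u}")
        case True
        then have "gap_moment v \<le> \<Sigma>" unfolding \<Sigma>_def using u by (intro SUP_upper) auto
        then show ?thesis using True s by simp
      qed simp
    qed
    also have "\<dots> = ennreal s * emeasure lborel {0<..u}" by (intro nn_integral_cmult_indicator) simp
    also have "\<dots> = ennreal (s * u)" using u s by (simp add: ennreal_mult)
    also have "\<dots> \<le> ennreal (s * T)" using u s by (intro ennreal_leI mult_left_mono) auto
    finally show ?thesis .
  qed
  have half: "Q \<le> ennreal (3 * a + s / 2)"
    if u: "0 < u" "u \<le> T" and Q: "\<And>N. 0 < N \<Longrightarrow> Q \<le> ennreal (3 * a) +
      ennreal (3 * (u + 2)) * (ennreal (L\<^sup>2) * gap_energy u + ennreal (4 * K\<^sup>2 * (u / real N)))" for u Q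
  proof -
    have "Q \<le> ennreal (3 * a) + ennreal (3 * (u + 2)) * (ennreal (L\<^sup>2) * gap_energy u)"
      by (rule refine_grid[OF Q])
    also have "\<dots> \<le> ennreal (3 * a) + ennreal 9 * (ennreal (L\<^sup>2) * ennreal (s * T))"
    proof (rule add_left_mono, rule mult_mono)
      show "ennreal (3 * (u + 2)) \<le> ennreal 9" using u T by (intro ennreal_leI) simp
      show "ennreal (L\<^sup>2) * gap_energy u \<le> ennreal (L\<^sup>2) * ennreal (s * T)" by (rule mult_left_mono[OF energy[OF u]]) simp
    qed simp_all
    also have "\<dots> = ennreal (3 * a + 9 * (L\<^sup>2 * (s * T)))"
    proof -
      have nn: "0 \<le> s * T" using s u by (intro mult_nonneg_nonneg) auto
      have "ennreal 9 * (ennreal (L\<^sup>2) * ennreal (s * T)) = ennreal (9 * (L\<^sup>2 * (s * T)))"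
        using nn by (simp only: ennreal_mult[symmetric] zero_le_power2 mult_nonneg_nonneg zero_le_numeral)
      moreover have "ennreal (3 * a) + ennreal (9 * (L\<^sup>2 * (s * T))) = ennreal (3 * a + 9 * (L\<^sup>2 * (s * T)))"
      proof (rule ennreal_plus[symmetric])
        show "0 \<le> 9 * (L\<^sup>2 * (s * T))" using nn by (intro mult_nonneg_nonneg[OF _ mult_nonneg_nonneg[OF zero_le_power2 nn]]) simp
      qed (use a in simp)
      ultimately show ?thesis by (simp only:)
    qed
    also have "\<dots> \<le> ennreal (3 * a + s / 2)"
    proof (rule ennreal_leI, rule add_left_mono)
      have "s * (18 * L\<^sup>2 * T) \<le> s * 1" using T s by (intro mult_left_mono) auto
      then show "9 * (L\<^sup>2 * (s * T)) \<le> s / 2" by (simp add: algebra_simps)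
    qed
    finally show ?thesis .
  qed
  have "\<Sigma> \<le> ennreal (3 * a + s / 2)"
    unfolding \<Sigma>_def
  proof (rule SUP_least)
    fix u assume "u \<in> {0<..T}"
    then have u: "0 < u" "u \<le> T" by auto
    show "gap_moment u \<le> ennreal (3 * a + s / 2)"
      by (rule half[OF u]) (use gap_moment_grid_bound(1)[OF u(1)] in \<open>simp only: a_def\<close>)
  qed
  moreover have nn: "0 \<le> 3 * a + s / 2" using s a by simp
  ultimately have "s \<le> 3 * a + s / 2" unfolding s(1) by (simp only: ennreal_le_iff)
  then have six: "3 * a + s / 2 \<le> 6 * a" by simp
  have "gap_moment t \<le> ennreal (3 * a + s / 2)"
    by (rule half[OF t]) (use gap_moment_grid_bound(1)[OF t(1)] in \<open>simp only: a_def\<close>)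
  also have "\<dots> \<le> ennreal (6 * a)" using six by (rule ennreal_leI)
  finally show "gap_moment t \<le> ennreal (6 * (norm (z - y))\<^sup>2)" unfolding a_def .
  have "ennreal ((R / 2)\<^sup>2 * prob (early_exit t)) \<le> ennreal (3 * a + s / 2)"
    by (rule half[OF t]) (use gap_moment_grid_bound(2)[OF t(1)] in \<open>simp only: a_def\<close>)
  also have "\<dots> \<le> ennreal (6 * a)" using six by (rule ennreal_leI)
  finally show "(R / 2)\<^sup>2 * prob (early_exit t) \<le> 6 * (norm (z - y))\<^sup>2"
    using a unfolding a_def by (simp add: ennreal_le_iff)
qed

text \<open>The deviation has two causes: \<open>Y\<close> leaves the ball while \<open>X\<close> is close to the centre, or both are alive
  and far apart. Each is controlled by \<open>short_time_moments\<close>.\<close>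

lemma short_time_deviation:
  assumes T: "T \<le> 1" "18 * L\<^sup>2 * T \<le> 1" and t: "0 < t" "t \<le> T" and \<epsilon>: "0 < \<epsilon>"
  shows "\<exists>E\<in>sets M. prob E \<le> (24 / R\<^sup>2 + 6 / \<epsilon>\<^sup>2) * (norm (z - y))\<^sup>2 \<and>
    {\<omega>\<in>space M. ereal t < exit_time X \<zeta> (ball z (R / 2)) \<omega> \<and>
      \<not> (ereal t < exitY \<omega> \<and> norm (X t \<omega> - Y t \<omega>) \<le> \<epsilon>)} \<subseteq> E"
proof (intro bexI conjI)
  define G where "G = {\<omega>\<in>space M. norm (gap t \<omega>) > \<epsilon>}"
  have gm: "gap t \<in> borel_measurable M" by (rule section_measurable[OF gap_jointly_measurable])
  then have Gm: "G \<in> sets M" unfolding G_def by measurable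
  show "early_exit t \<union> G \<in> sets M" using early_exit_measurable Gm by blast
  have "prob G \<le> (6 * (norm (z - y))\<^sup>2) / \<epsilon>\<^sup>2"
    unfolding G_def using short_time_moments(1)[OF T t] unfolding gap_moment_def
    by (intro prob_gt_le_second_moment gm \<epsilon>) auto
  moreover have "prob (early_exit t) \<le> 24 * (norm (z - y))\<^sup>2 / R\<^sup>2"
    using short_time_moments(2)[OF T t] R by (simp add: field_simps power_divide)
  moreover have "prob (early_exit t \<union> G) \<le> prob (early_exit t) + prob G"
    by (intro measure_Un_le early_exit_measurable Gm)
  ultimately show "prob (early_exit t \<union> G) \<le> (24 / R\<^sup>2 + 6 / \<epsilon>\<^sup>2) * (norm (z - y))\<^sup>2"
    by (simp add: algebra_simps)
  show "{\<omega>\<in>space M. ereal t < exit_time X \<zeta> (ball z (R / 2)) \<omega> \<and>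
      \<not> (ereal t < exitY \<omega> \<and> norm (X t \<omega> - Y t \<omega>) \<le> \<epsilon>)} \<subseteq> early_exit t \<union> G"
  proof
    fix \<omega>
    assume "\<omega> \<in> {\<omega>\<in>space M. ereal t < exit_time X \<zeta> (ball z (R / 2)) \<omega> \<and>
      \<not> (ereal t < exitY \<omega> \<and> norm (X t \<omega> - Y t \<omega>) \<le> \<epsilon>)}"
    then have \<omega>: "\<omega> \<in> space M" "ereal t < exit_time X \<zeta> (ball z (R / 2)) \<omega>"
      and dev: "\<not> (ereal t < exitY \<omega> \<and> norm (X t \<omega> - Y t \<omega>) \<le> \<epsilon>)" by auto
    show "\<omega> \<in> early_exit t \<union> G"
    proof (cases "ereal t < exitY \<omega>")
      case True
      have "exit_time X \<zeta> (ball z (R / 2)) \<omega> \<le> exitX \<omega>" using R by (intro exit_time_mono subset_ball) simp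
      then have "ereal t < exitX \<omega>" using \<omega>(2) by simp
      then have "gap t \<omega> = X t \<omega> - Y t \<omega>" using True t unfolding gap_def by simp
      then show ?thesis using True dev \<omega>(1) unfolding G_def by simp
    next
      case False
      then show ?thesis using \<omega> unfolding early_exit_def by (simp add: not_less)
    qed
  qed
qed

end

section \<open>Exit times near a regular boundary point\<close>

text \<open>If the path stays in \<open>V\<close> until it leaves \<open>U\<close>, the integrand is bounded by \<open>C\<close>. An integral that does
  not exist has the value zero by convention and satisfies the bound too.\<close>

lemma exit_integral_bound:
  fixes f :: "'a \<Rightarrow> real"
  assumes C: "0 \<le> C" "\<And>u. u \<in> V \<Longrightarrow> u \<in> U \<Longrightarrow> \<bar>f u\<bar> \<le> C"
    and V: "exit_time X \<zeta> U \<omega> \<le> exit_time X \<zeta> V \<omega>" and r: "exit_time X \<zeta> U \<omega> < ereal r"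
  shows "\<bar>exit_integral f X \<zeta> U \<omega>\<bar> \<le> C * r"
proof -
  define u where "u = real_of_ereal (exit_time X \<zeta> U \<omega>)"
  have u: "exit_time X \<zeta> U \<omega> = ereal u" "0 \<le> u" "u < r"
    using exit_time_nonneg[of X \<zeta> U \<omega>] r unfolding u_def by (cases "exit_time X \<zeta> U \<omega>"; auto)+
  define g where "g s = indicator {s. 0 < s \<and> ereal s < exit_time X \<zeta> U \<omega>} s *\<^sub>R f (X s \<omega>)" for s
  have g: "\<bar>g s\<bar> \<le> C * indicator {0<..<u} s" for s
  proof (cases "0 < s \<and> s < u")
    case True
    obtain p where p: "s < p" "p < u" using True dense by blast
    have "X s \<omega> \<in> U" by (rule less_exit_timeD[of p X \<zeta> U \<omega> s, THEN conjunct2]) (use p True u in auto)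
    moreover have "X s \<omega> \<in> V"
      by (rule less_exit_timeD[of p X \<zeta> V \<omega> s, THEN conjunct2]) (use p True u less_le_trans[OF _ V] in auto)
    ultimately show ?thesis using True C unfolding g_def u by simp
  next
    case False
    then show ?thesis unfolding g_def u by (auto simp: indicator_def)
  qed
  have "\<bar>integral\<^sup>L lborel g\<bar> \<le> C * u"
  proof (cases "integrable lborel g")
    case True
    have "\<bar>integral\<^sup>L lborel g\<bar> \<le> (LINT s|lborel. \<bar>g s\<bar>)" by (rule integral_abs_bound)
    also have "\<dots> \<le> (LINT s|lborel. C * indicator {0<..<u} s)"
    proof (rule integral_mono)
      have "integrable lborel (indicator {0<..<u} :: real \<Rightarrow> real)" using u by (intro integrable_real_indicator) auto
      then show "integrable lborel (\<lambda>s. C * indicator {0<..<u} s)" by simp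
    qed (use True g in auto)
    also have "\<dots> = C * u" using u by simp
    finally show ?thesis .
  next
    case False
    then show ?thesis using C u by (simp add: not_integrable_integral_eq)
  qed
  also have "\<dots> \<le> C * r" using u C by (intro mult_left_mono) auto
  finally show ?thesis unfolding exit_integral_def set_lebesgue_integral_def g_def .
qed

context brownian begin

text \<open>The closure is left at arbitrarily small times; since its complement is open and the path
  continuous, such a time can be moved to a rational one.\<close>

lemma regular_leaves_early:
  fixes X :: "real \<Rightarrow> 'w \<Rightarrow> 'a::euclidean_space"
  assumes X: "continuous_adapted X \<zeta>" and \<omega>: "\<omega> \<in> space M" and start: "X 0 \<omega> \<in> closure U"
    and regular: "closure_exit_time X \<zeta> U \<omega> = 0" and r: "0 < r" "ereal r \<le> \<zeta> \<omega>"
  shows "\<exists>q\<in>\<rat>. 0 < q \<and> q < r \<and> X q \<omega> \<notin> closure U"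
proof -
  have "\<not> (\<forall>t. 0 \<le> t \<and> (\<zeta> \<omega> \<le> ereal t \<or> X t \<omega> \<notin> closure U) \<longrightarrow> r \<le> t)"
  proof
    assume "\<forall>t. 0 \<le> t \<and> (\<zeta> \<omega> \<le> ereal t \<or> X t \<omega> \<notin> closure U) \<longrightarrow> r \<le> t"
    then have "ereal r \<le> closure_exit_time X \<zeta> U \<omega>"
      unfolding closure_exit_time_def by (intro INF_greatest) auto
    then show False using regular r by simp
  qed
  then obtain t where t: "0 \<le> t" "t < r" "\<zeta> \<omega> \<le> ereal t \<or> X t \<omega> \<notin> closure U" by force
  have alive: "ereal s < \<zeta> \<omega>" if "s < r" for s
    by (rule less_le_trans[OF _ r(2)]) (use that in simp)
  have out: "X t \<omega> \<in> - closure U" using t(3) alive[OF t(2)] by auto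
  have "((\<lambda>s. X s \<omega>) \<longlongrightarrow> X t \<omega>) (at t within {s. 0 \<le> s \<and> ereal s < \<zeta> \<omega>})"
    using X \<omega> t(1) alive[OF t(2)] unfolding continuous_adapted_def continuous_on_def by blast
  from topological_tendstoD[OF this _ out]
  have "eventually (\<lambda>s. X s \<omega> \<in> - closure U) (at t within {s. 0 \<le> s \<and> ereal s < \<zeta> \<omega>})" by auto
  then obtain d where d: "0 < d" "\<And>s. 0 \<le> s \<Longrightarrow> ereal s < \<zeta> \<omega> \<Longrightarrow> s \<noteq> t \<Longrightarrow> dist s t < d \<Longrightarrow> X s \<omega> \<in> - closure U"
    unfolding eventually_at by blast
  obtain q where q: "q \<in> \<rat>" "t < q" "q < min r (t + d)"
    using Rats_dense_in_real[of t "min r (t + d)"] t(2) d(1) by auto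
  then have "X q \<omega> \<in> - closure U" using t(1) alive[of q] by (intro d(2)) (auto simp: dist_real_def)
  then show ?thesis using q t(1) by (intro bexI[of _ q]) auto
qed

text \<open>Countably many rational times and distances are reduced to finitely many by continuity of the
  measure from below; at each of the finitely many times \<open>short_time_deviation\<close> applies.\<close>

lemma exit_time_small_near_regular_point:
  fixes b :: "real^'m \<Rightarrow> real^'m" and \<sigma> :: "real^'m \<Rightarrow> real^'r^'m"
    and X :: "real^'m \<Rightarrow> real \<Rightarrow> 'w \<Rightarrow> real^'m"
  assumes D: "open D" "Cinf_on b D" "Cinf_on \<sigma> D"
    and sol: "\<And>x. x \<in> D \<Longrightarrow> maximal_solution M F W b \<sigma> D x (X x) (\<zeta> x)"
    and U: "closure U \<subseteq> D" "z \<in> closure U"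
    and regular: "\<P>(\<omega> in M. closure_exit_time (X z) (\<zeta> z) U \<omega> = 0) = 1"
    and \<epsilon>: "0 < \<epsilon>" and \<delta>: "0 < \<delta>"
  shows "\<exists>d>0. \<forall>x\<in>U. norm (x - z) < d \<longrightarrow> \<P>(\<omega> in M. ereal \<epsilon> \<le> exit_time (X x) (\<zeta> x) U \<omega>) < \<delta>"
proof -
  have zD: "z \<in> D" using U by blast
  obtain R where R: "0 < R" "cball z R \<subseteq> D" using D(1) zD open_contains_cball by blast
  have cb: "continuous_on (cball z R) b" and cs: "continuous_on (cball z R) \<sigma>"
    using Cinf_on_imp_continuous_on[OF D(2)] Cinf_on_imp_continuous_on[OF D(3)] R(2) continuous_on_subset by blast+
  have "bounded (b ` cball z R)" "bounded (\<sigma> ` cball z R)"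
    using compact_continuous_image[OF cb] compact_continuous_image[OF cs] compact_imp_bounded by auto
  then obtain K1 K2 where K1: "\<forall>u\<in>cball z R. norm (b u) \<le> K1" and K2: "\<forall>u\<in>cball z R. norm (\<sigma> u) \<le> K2"
    unfolding bounded_iff by auto
  obtain L1 where L1: "0 \<le> L1" "\<forall>u\<in>cball z R. \<forall>v\<in>cball z R. norm (b u - b v) \<le> L1 * norm (u - v)"
    using Cinf_on_imp_lipschitz[OF D(2) compact_cball convex_cball R(2)] by blast
  obtain L2 where L2: "0 \<le> L2" "\<forall>u\<in>cball z R. \<forall>v\<in>cball z R. norm (\<sigma> u - \<sigma> v) \<le> L2 * norm (u - v)"
    using Cinf_on_imp_lipschitz[OF D(3) compact_cball convex_cball R(2)] by blast
  define K where "K = max 0 (max K1 K2)"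
  define L where "L = max L1 L2"
  interpret localized_sde M F W b \<sigma> D z R K L
  proof
    show "continuous_on (ball z R) b" "continuous_on (ball z R) \<sigma>"
      using cb cs ball_subset_cball continuous_on_subset by blast+
    show "0 \<le> K" "0 \<le> L" unfolding K_def L_def using L1 by auto
    show "norm (b u) \<le> K" "norm (\<sigma> u) \<le> K" if "u \<in> ball z R" for u
      using K1 K2 that unfolding K_def by (auto simp: le_max_iff_disj)
    fix u v assume uv: "u \<in> ball z R" "v \<in> ball z R"
    have "norm (b u - b v) \<le> L1 * norm (u - v)" "norm (\<sigma> u - \<sigma> v) \<le> L2 * norm (u - v)"
      using L1(2) L2(2) uv by auto
    then show "norm (b u - b v) \<le> L * norm (u - v)" "norm (\<sigma> u - \<sigma> v) \<le> L * norm (u - v)"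
      using mult_right_mono[of L1 L "norm (u - v)"] mult_right_mono[of L2 L "norm (u - v)"] unfolding L_def by auto
  qed (use R in auto)
  \<comment> \<open>The length of the time interval on which \<open>short_time_deviation\<close> holds.\<close>
  define T where "T = 1 / (18 * L\<^sup>2 + 1)"
  have Lp: "0 < 18 * L\<^sup>2 + 1" by (intro add_nonneg_pos mult_nonneg_nonneg) auto
  have T: "0 < T" "T \<le> 1" "18 * L\<^sup>2 * T \<le> 1" using Lp unfolding T_def by (auto simp: field_simps)
  define r where "r = min \<epsilon> T"
  have r: "0 < r" "r \<le> T" "r \<le> \<epsilon>" using \<epsilon> T unfolding r_def by auto
  note solz = sol[OF zD]
  have Xz: "continuous_adapted (X z) (\<zeta> z)" by (rule solution_continuous_adapted[OF solz])
  \<comment> \<open>The reference solution is observed only while it is in the ball of half the radius.\<close>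
  define \<theta> where "\<theta> = exit_time (X z) (\<zeta> z) (ball z (R / 2))"
  have \<theta>\<zeta>: "\<theta> \<omega> \<le> \<zeta> z \<omega>" and \<theta>0: "0 < \<theta> \<omega>" if \<omega>: "\<omega> \<in> space M" for \<omega>
  proof -
    have \<zeta>0: "0 < \<zeta> z \<omega>" using Xz \<omega> unfolding continuous_adapted_def by blast
    then show "\<theta> \<omega> \<le> \<zeta> z \<omega>" unfolding \<theta>_def by (rule exit_time_le_lifetime)
    have "X z 0 \<omega> \<in> ball z (R / 2)" using solution_start[OF solz \<omega>] R by simp
    then show "0 < \<theta> \<omega>"
      using less_exit_time_iff[OF Xz \<omega> open_ball, of z "R / 2" 0] \<zeta>0 unfolding \<theta>_def by (simp add: zero_ereal_def)
  qed
  have out2: "- ball z (R / 2) \<noteq> {}"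
    using outside_ball subset_ball[of "R / 2" R z] R(1) by auto
  have Une: "closure U \<noteq> {}"
  proof
    assume "closure U = {}"
    with U(2) have "z \<in> {}" by (simp only:)
    then show False by simp
  qed
  define Q where "Q = {q \<in> \<rat>. 0 < q \<and> q < r}"
  have Qc: "countable Q" unfolding Q_def using countable_rat by (rule countable_subset[rotated]) auto
  have Qne: "Q \<noteq> {}" using Rats_dense_in_real[OF r(1)] unfolding Q_def by auto
  define q where "q = from_nat_into Q"
  have q: "range q = Q" unfolding q_def by (rule range_from_nat_into[OF Qne Qc])
  have qQ: "0 < q i" "q i < r" for i using q unfolding Q_def by blast+
  define B where "B m = {u. 1 / real (Suc m) < infdist u (closure U)}" for m
  have Bm: "B m \<in> sets borel" for m
    unfolding B_def by (intro borel_open open_Collect_less continuous_intros)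
  define A where "A i m = {\<omega>\<in>space M. ereal (q i) < \<theta> \<omega> \<and> X z (q i) \<omega> \<in> B m}" for i m
  define C where "C m = (\<Union>i\<in>{..m}. A i m)" for m
  have Am: "A i m \<in> sets M" for i m
  proof -
    have "{\<omega>\<in>space M. ereal (q i) < \<theta> \<omega>} \<in> sets M"
      using less_exit_time_adapted[OF Xz open_ball out2, of "q i"] solution_start[OF solz] R(1) qQ(1)[of i] sets_F
      unfolding \<theta>_def by (auto simp: less_imp_le)
    moreover have "{\<omega>\<in>space M. ereal (q i) < \<zeta> z \<omega> \<and> X z (q i) \<omega> \<in> B m} \<in> sets M"
      using alive_in_set_measurable[OF Xz less_imp_le[OF qQ(1)] order_refl Bm] sets_F by blast
    ultimately have "{\<omega>\<in>space M. ereal (q i) < \<theta> \<omega>} \<inter> {\<omega>\<in>space M. ereal (q i) < \<zeta> z \<omega> \<and> X z (q i) \<omega> \<in> B m} \<in> sets M"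
      by (rule sets.Int)
    also have "{\<omega>\<in>space M. ereal (q i) < \<theta> \<omega>} \<inter> {\<omega>\<in>space M. ereal (q i) < \<zeta> z \<omega> \<and> X z (q i) \<omega> \<in> B m} = A i m"
      unfolding A_def using less_le_trans[OF _ \<theta>\<zeta>] by blast
    finally show ?thesis .
  qed
  have Cm: "C m \<in> sets M" for m unfolding C_def using Am by (intro sets.finite_UN) auto
  have Bmono: "B m \<subseteq> B n" if "m \<le> n" for m n
  proof -
    have "1 / real (Suc n) \<le> 1 / real (Suc m)" using that by (intro divide_left_mono) auto
    then show ?thesis unfolding B_def by (auto intro: le_less_trans)
  qed
  have Cinc: "incseq C"
    unfolding incseq_def C_def A_def using Bmono by (auto intro: order_trans)
  have ae: "AE \<omega> in M. \<omega> \<in> (\<Union>m. C m)"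
  proof -
    \<comment> \<open>A set that is not measurable has measure \<open>0\<close> by convention, so probability \<open>1\<close> implies measurability.\<close>
    have "{\<omega>\<in>space M. closure_exit_time (X z) (\<zeta> z) U \<omega> = 0} \<in> events"
    proof (rule ccontr)
      assume "{\<omega>\<in>space M. closure_exit_time (X z) (\<zeta> z) U \<omega> = 0} \<notin> events"
      then show False using regular measure_notin_sets by (metis zero_neq_one)
    qed
    then have "AE \<omega> in M. \<omega> \<in> {\<omega>\<in>space M. closure_exit_time (X z) (\<zeta> z) U \<omega> = 0}"
      using regular prob_eq_1 by blast
    then show ?thesis
    proof eventually_elim
      case (elim \<omega>)
      then have \<omega>: "\<omega> \<in> space M" and reg: "closure_exit_time (X z) (\<zeta> z) U \<omega> = 0" by auto
      obtain p where p: "0 < p" "ereal p < \<theta> \<omega>"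
        using ereal_dense2[OF \<theta>0[OF \<omega>]] by (auto simp: zero_ereal_def)
      define r' where "r' = min r p"
      have r': "0 < r'" "r' \<le> r" "ereal r' \<le> \<theta> \<omega>"
        using p r(1) unfolding r'_def by (auto simp: min_def intro: less_imp_le order_trans[of _ "ereal p"])
      have "X z 0 \<omega> \<in> closure U" using solution_start[OF solz \<omega>] U(2) by simp
      from regular_leaves_early[OF Xz \<omega> this reg r'(1) order_trans[OF r'(3) \<theta>\<zeta>[OF \<omega>]]]
      obtain v where v: "v \<in> \<rat>" "0 < v" "v < r'" "X z v \<omega> \<notin> closure U" by blast
      then have "v \<in> Q" using r'(2) unfolding Q_def by auto
      then obtain i where i: "v = q i" using q by blast
      have v\<theta>: "ereal v < \<theta> \<omega>" by (rule less_le_trans[OF _ r'(3)]) (use v in simp)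
      have "infdist (X z v \<omega>) (closure U) \<noteq> 0"
        using in_closed_iff_infdist_zero[OF closed_closure Une, of "X z v \<omega>"] v(4) by simp
      then have "0 < infdist (X z v \<omega>) (closure U)" using infdist_nonneg[of "X z v \<omega>" "closure U"] by simp
      then obtain k where k: "1 / real (Suc k) < infdist (X z v \<omega>) (closure U)" by (rule nat_approx_posE)
      then have "X z v \<omega> \<in> B k" unfolding B_def by simp
      then have "X z v \<omega> \<in> B (max i k)" using Bmono[of k "max i k"] by auto
      then have "\<omega> \<in> A i (max i k)" unfolding A_def i[symmetric] using \<omega> v\<theta> by simp
      then have "\<omega> \<in> C (max i k)" unfolding C_def by auto
      then show ?case by blast
    qed
  qed
  have UC: "(\<Union>m. C m) \<in> events" using Cm by blast
  have "prob (\<Union>m. C m) = 1" using prob_eq_1[OF UC] ae by blast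
  then have "(\<lambda>m. prob (C m)) \<longlonglongrightarrow> 1"
    using finite_Lim_measure_incseq[OF _ Cinc] Cm by auto
  from order_tendstoD(1)[OF this, of "1 - \<delta> / 2"] \<delta>
  obtain m where m: "1 - \<delta> / 2 < prob (C m)" by (auto simp: eventually_sequentially)
  define \<kappa> where "\<kappa> = 1 / real (Suc m)"
  have \<kappa>: "0 < \<kappa>" unfolding \<kappa>_def by simp
  define c where "c = 24 / R\<^sup>2 + 6 / \<kappa>\<^sup>2"
  have c: "0 \<le> c" unfolding c_def by simp
  define k where "k = real (Suc m) * c"
  have k: "0 \<le> k" unfolding k_def using c by simp
  \<comment> \<open>As \<open>d \<le> 1\<close>, the squared distance of the starting points is at most \<open>d\<close>, and \<open>k d \<le> \<delta>/2\<close>.\<close>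
  define d where "d = min (min 1 R) (\<delta> / (2 * (k + 1)))"
  have d: "0 < d" "d \<le> 1" "d \<le> R" "d \<le> \<delta> / (2 * (k + 1))"
    using R(1) \<delta> k unfolding d_def by (auto simp: min_le_iff_disj)
  have "\<P>(\<omega> in M. ereal \<epsilon> \<le> exit_time (X x) (\<zeta> x) U \<omega>) < \<delta>"
    if x: "x \<in> U" "norm (x - z) < d" for x
  proof -
    have xball: "x \<in> ball z R" using x(2) d(3) by (simp add: dist_norm norm_minus_commute)
    have xD: "x \<in> D" using x(1) U(1) closure_subset by blast
    interpret coupled_sde M F W b \<sigma> D z R K L "X z" "X x" "\<zeta> z" "\<zeta> x" x
      by unfold_locales (rule solz, rule sol[OF xD], rule xball)
    define dev where "dev i = {\<omega>\<in>space M. ereal (q i) < \<theta> \<omega> \<and>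
        \<not> (ereal (q i) < exit_time (X x) (\<zeta> x) (ball z R) \<omega> \<and> norm (X z (q i) \<omega> - X x (q i) \<omega>) \<le> \<kappa>)}" for i
    have "\<exists>E. E \<in> events \<and> prob E \<le> c * (norm (z - x))\<^sup>2 \<and> dev i \<subseteq> E" for i
      using short_time_deviation[OF T(2,3) qQ(1)[of i] less_imp_le[OF less_le_trans[OF qQ(2)[of i] r(2)]] \<kappa>]
      unfolding c_def \<theta>_def dev_def Bex_def .
    then have "\<forall>i. \<exists>E. E \<in> events \<and> prob E \<le> c * (norm (z - x))\<^sup>2 \<and> dev i \<subseteq> E" ..
    from choice[OF this] obtain E where E': "\<forall>i. E i \<in> events \<and> prob (E i) \<le> c * (norm (z - x))\<^sup>2 \<and> dev i \<subseteq> E i" ..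
    have E: "E i \<in> events" "prob (E i) \<le> c * (norm (z - x))\<^sup>2" "dev i \<subseteq> E i" for i
      using E' by blast+
    have sub: "{\<omega>\<in>space M. ereal \<epsilon> \<le> exit_time (X x) (\<zeta> x) U \<omega>} \<subseteq> (space M - C m) \<union> (\<Union>i\<in>{..m}. E i)"
    proof
      fix \<omega> assume "\<omega> \<in> {\<omega>\<in>space M. ereal \<epsilon> \<le> exit_time (X x) (\<zeta> x) U \<omega>}"
      then have \<omega>: "\<omega> \<in> space M" and late: "ereal \<epsilon> \<le> exit_time (X x) (\<zeta> x) U \<omega>" by auto
      show "\<omega> \<in> (space M - C m) \<union> (\<Union>i\<in>{..m}. E i)"
      proof (rule ccontr)
        assume n: "\<omega> \<notin> (space M - C m) \<union> (\<Union>i\<in>{..m}. E i)"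
        then obtain i where i: "i \<le> m" "\<omega> \<in> A i m" using \<omega> unfolding C_def by auto
        then have "\<omega> \<notin> E i" using n by auto
        with E(3)[of i] have "\<omega> \<notin> dev i" by blast
        with i(2) have near: "norm (X z (q i) \<omega> - X x (q i) \<omega>) \<le> \<kappa>" unfolding A_def dev_def by simp
        have far: "\<kappa> < infdist (X z (q i) \<omega>) (closure U)" using i(2) unfolding A_def B_def \<kappa>_def by auto
        have "X x (q i) \<omega> \<notin> closure U"
        proof
          assume "X x (q i) \<omega> \<in> closure U"
          then have "infdist (X z (q i) \<omega>) (closure U) \<le> dist (X z (q i) \<omega>) (X x (q i) \<omega>)" by (rule infdist_le)
          then show False using near far by (simp add: dist_norm)
        qed
        then have "X x (q i) \<omega> \<notin> U" using closure_subset[of U] by blast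
        then have "exit_time (X x) (\<zeta> x) U \<omega> \<le> ereal (q i)"
          by (rule exit_time_le[of "q i" "\<zeta> x" \<omega> "X x" U, OF qQ(1) disjI2])
        with late have "ereal \<epsilon> \<le> ereal (q i)" by (rule order_trans)
        then show False using qQ(2)[of i] r(3) by simp
      qed
    qed
    have "\<P>(\<omega> in M. ereal \<epsilon> \<le> exit_time (X x) (\<zeta> x) U \<omega>) \<le> prob ((space M - C m) \<union> (\<Union>i\<in>{..m}. E i))"
      using Cm E(1) by (intro finite_measure_mono[OF sub]) auto
    also have "\<dots> \<le> prob (space M - C m) + prob (\<Union>i\<in>{..m}. E i)"
      using Cm E(1) by (intro measure_Un_le) auto
    also have "prob (space M - C m) = 1 - prob (C m)" by (rule prob_compl[OF Cm])
    also have "prob (\<Union>i\<in>{..m}. E i) \<le> (\<Sum>i\<in>{..m}. prob (E i))"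
      using E(1) by (intro finite_measure_subadditive_finite) auto
    also have "\<dots> \<le> (\<Sum>i\<in>{..m}. c * (norm (z - x))\<^sup>2)" by (intro sum_mono E(2))
    also have "\<dots> = k * (norm (x - z))\<^sup>2" unfolding k_def by (simp add: norm_minus_commute)
    also have "\<dots> \<le> k * d"
    proof (rule mult_left_mono[OF _ k])
      have "(norm (x - z))\<^sup>2 \<le> norm (x - z) * 1"
        unfolding power2_eq_square using x(2) d(2) by (intro mult_left_mono) auto
      then show "(norm (x - z))\<^sup>2 \<le> d" using x(2) by simp
    qed
    also have "\<dots> \<le> k * (\<delta> / (2 * (k + 1)))" by (rule mult_left_mono[OF d(4) k])
    also have "\<dots> \<le> \<delta> / 2" using k \<delta> by (simp add: field_simps)
    finally show ?thesis using m by simp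
  qed
  then show ?thesis using d(1) by blast
qed

end

section \<open>The limit of the expected integral\<close>

text \<open>The values of \<open>|Y|\<close> are split at \<open>\<eta>\<close> and \<open>c\<close>.\<close>

lemma (in prob_space) expectation_le_split:
  fixes Y :: "'a \<Rightarrow> real"
  assumes Y: "Y \<in> borel_measurable M" and nonneg: "0 \<le> c" "0 \<le> \<eta>" "0 \<le> \<gamma>"
    and tail: "(\<integral>\<^sup>+\<omega>\<in>{\<omega>. \<bar>Y \<omega>\<bar> > c}. ennreal \<bar>Y \<omega>\<bar> \<partial>M) \<le> ennreal \<gamma>"
  shows "\<bar>expectation Y\<bar> \<le> \<eta> + c * \<P>(\<omega> in M. \<bar>Y \<omega>\<bar> > \<eta>) + \<gamma>"
proof -
  let ?S = "{\<omega>\<in>space M. \<bar>Y \<omega>\<bar> > \<eta>}"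
  note Y[measurable]
  have b: "0 \<le> \<eta> + c * prob ?S + \<gamma>" using nonneg by (intro add_nonneg_nonneg mult_nonneg_nonneg) auto
  have "(\<integral>\<^sup>+\<omega>. ennreal \<bar>Y \<omega>\<bar> \<partial>M) \<le>
      (\<integral>\<^sup>+\<omega>. ennreal \<eta> + ennreal c * indicator ?S \<omega> + ennreal \<bar>Y \<omega>\<bar> * indicator {\<omega>. \<bar>Y \<omega>\<bar> > c} \<omega> \<partial>M)"
  proof (rule nn_integral_mono)
    fix \<omega> assume \<omega>: "\<omega> \<in> space M"
    consider "\<bar>Y \<omega>\<bar> > c" | "\<bar>Y \<omega>\<bar> \<le> c" "\<bar>Y \<omega>\<bar> > \<eta>" | "\<bar>Y \<omega>\<bar> \<le> \<eta>" by linarith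
    then show "ennreal \<bar>Y \<omega>\<bar> \<le> ennreal \<eta> + ennreal c * indicator ?S \<omega> + ennreal \<bar>Y \<omega>\<bar> * indicator {\<omega>. \<bar>Y \<omega>\<bar> > c} \<omega>"
    proof cases
      case 1
      then show ?thesis by simp
    next
      case 2
      then have "ennreal \<bar>Y \<omega>\<bar> \<le> ennreal c * indicator ?S \<omega>" using \<omega> by (simp add: ennreal_leI)
      then show ?thesis by (rule order_trans) (simp add: add.assoc add_increasing)
    next
      case 3
      then have "ennreal \<bar>Y \<omega>\<bar> \<le> ennreal \<eta>" by (rule ennreal_leI)
      then show ?thesis by (rule order_trans) (simp add: add.assoc)
    qed
  qed
  also have "\<dots> = ennreal \<eta> + ennreal c * emeasure M ?S + (\<integral>\<^sup>+\<omega>\<in>{\<omega>. \<bar>Y \<omega>\<bar> > c}. ennreal \<bar>Y \<omega>\<bar> \<partial>M)"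
    by (simp add: nn_integral_add nn_integral_cmult_indicator emeasure_space_1)
  also have "\<dots> \<le> ennreal \<eta> + ennreal c * emeasure M ?S + ennreal \<gamma>" by (rule add_left_mono[OF tail])
  also have "\<dots> = ennreal (\<eta> + c * prob ?S + \<gamma>)"
    unfolding emeasure_eq_measure ennreal_mult[OF nonneg(1) measure_nonneg, symmetric]
    using nonneg by (subst ennreal_plus[symmetric]; (intro add_nonneg_nonneg mult_nonneg_nonneg measure_nonneg)?)+ auto
  finally have nn: "(\<integral>\<^sup>+\<omega>. ennreal \<bar>Y \<omega>\<bar> \<partial>M) \<le> ennreal (\<eta> + c * prob ?S + \<gamma>)" .
  show ?thesis
  proof (cases "integrable M Y")
    case True
    from order_trans[OF integral_norm_bound_ennreal[OF True]] nn
    have "ennreal \<bar>expectation Y\<bar> \<le> ennreal (\<eta> + c * prob ?S + \<gamma>)" by simp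
    then show ?thesis by (simp only: ennreal_le_iff[OF b])
  next
    case False
    then show ?thesis using b by (simp add: not_integrable_integral_eq)
  qed
qed

theorem theorem6p8:
  fixes M :: "'w measure" and F :: "real \<Rightarrow> 'w measure"
    and W :: "real \<Rightarrow> 'w \<Rightarrow> real^'r"
    and b :: "real^'m \<Rightarrow> real^'m" and \<sigma> :: "real^'m \<Rightarrow> real^'r^'m"
    and \<X> :: "(real^'m) set" and \<X>\<^sub>n :: "nat \<Rightarrow> (real^'m) set"
    and X :: "real^'m \<Rightarrow> real \<Rightarrow> 'w \<Rightarrow> real^'m" and \<zeta> :: "real^'m \<Rightarrow> 'w \<Rightarrow> ereal"
    and U :: "(real^'m) set" and x\<^sub>0 :: "real^'m" and f :: "real^'m \<Rightarrow> real"
  assumes "open \<X>" and "Cinf_on b \<X>" and "Cinf_on \<sigma> \<X>"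
    and "\<And>n. open (\<X>\<^sub>n n)" and "\<And>n. bounded (\<X>\<^sub>n n)"
    and "\<And>n. closure (\<X>\<^sub>n n) \<subseteq> \<X>\<^sub>n (Suc n)" and "(\<Union>n. \<X>\<^sub>n n) = \<X>"
    and "brownian_motion M F W"
    and "\<And>x. x \<in> \<X> \<Longrightarrow> maximal_solution M F W b \<sigma> \<X> x (X x) (\<zeta> x)"
    and "nonexplosive M \<X> \<X>\<^sub>n X \<zeta>"
    and "open U" and "U \<noteq> {}" and "- U \<noteq> {}" and "closure U \<subseteq> \<X>"
    and "x\<^sub>0 \<in> frontier U"
    and regular: "\<P>(\<omega> in M. closure_exit_time (X x\<^sub>0) (\<zeta> x\<^sub>0) U \<omega> = 0) = 1"
    and "f \<in> borel_measurable (restrict_space borel U)"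
    and "\<And>n. bounded (f ` (\<X>\<^sub>n n \<inter> U))"
    and a: "\<exists>\<delta>>0. uniformly_integrable M {x \<in> U. norm (x - x\<^sub>0) < \<delta>}
              (\<lambda>x. exit_integral f (X x) (\<zeta> x) U)"
    and b: "\<And>\<delta>\<^sub>1. 0 < \<delta>\<^sub>1 \<Longrightarrow> \<exists>n. \<exists>\<delta>\<^sub>2>0. \<forall>x\<in>U. norm (x - x\<^sub>0) < \<delta>\<^sub>2 \<longrightarrow>
              \<P>(\<omega> in M. exit_time (X x) (\<zeta> x) (\<X>\<^sub>n n) \<omega> < exit_time (X x) (\<zeta> x) U \<omega>) < \<delta>\<^sub>1"
    and "\<And>x. x \<in> U \<Longrightarrow> \<P>(\<omega> in M. exit_time (X x) (\<zeta> x) U \<omega> < \<infinity>) = 1"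
  shows "((\<lambda>x. LINT \<omega>|M. exit_integral f (X x) (\<zeta> x) U \<omega>) \<longlongrightarrow> 0) (at x\<^sub>0 within U)"
  unfolding Lim_within
proof (intro allI impI)
  interpret brownian M F W by unfold_locales (rule assms(8))
  note sol = assms(9)
  have UD: "closure U \<subseteq> \<X>" by (rule assms(14))
  have x0: "x\<^sub>0 \<in> closure U" using assms(15) unfolding frontier_def by blast
  fix e :: real assume e: "0 < e"
  define Y where "Y x = exit_integral f (X x) (\<zeta> x) U" for x
  obtain d1 where d1: "0 < d1" and UI: "uniformly_integrable M {x \<in> U. norm (x - x\<^sub>0) < d1} Y"
    using a unfolding Y_def by blast
  have "((\<lambda>c::real. SUP x\<in>{x \<in> U. norm (x - x\<^sub>0) < d1}. \<integral>\<^sup>+\<omega>\<in>{\<omega>. \<bar>Y x \<omega>\<bar> > c}. ennreal \<bar>Y x \<omega>\<bar> \<partial>M) \<longlongrightarrow> 0) at_top"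
    using UI unfolding uniformly_integrable_def by (rule conjunct2)
  from order_tendstoD(2)[OF this, of "ennreal (e / 4)"] e
  have "eventually (\<lambda>c. (SUP x\<in>{x \<in> U. norm (x - x\<^sub>0) < d1}. \<integral>\<^sup>+\<omega>\<in>{\<omega>. \<bar>Y x \<omega>\<bar> > c}. ennreal \<bar>Y x \<omega>\<bar> \<partial>M) < ennreal (e / 4)) at_top"
    by simp
  then obtain c0 where c0: "\<And>c. c0 \<le> c \<Longrightarrow> (SUP x\<in>{x \<in> U. norm (x - x\<^sub>0) < d1}. \<integral>\<^sup>+\<omega>\<in>{\<omega>. \<bar>Y x \<omega>\<bar> > c}. ennreal \<bar>Y x \<omega>\<bar> \<partial>M) < ennreal (e / 4)"
    unfolding eventually_at_top_linorder by blast
  define c where "c = max c0 1"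
  have c: "1 \<le> c" "0 \<le> c" unfolding c_def by auto
  have Ym: "Y x \<in> borel_measurable M"
    and tail: "(\<integral>\<^sup>+\<omega>\<in>{\<omega>. \<bar>Y x \<omega>\<bar> > c}. ennreal \<bar>Y x \<omega>\<bar> \<partial>M) \<le> ennreal (e / 4)"
    if "x \<in> U" "norm (x - x\<^sub>0) < d1" for x
  proof -
    have x: "x \<in> {x \<in> U. norm (x - x\<^sub>0) < d1}" using that by simp
    then show "Y x \<in> borel_measurable M" using UI unfolding uniformly_integrable_def by blast
    have "(\<integral>\<^sup>+\<omega>\<in>{\<omega>. \<bar>Y x \<omega>\<bar> > c}. ennreal \<bar>Y x \<omega>\<bar> \<partial>M) \<le>
        (SUP x\<in>{x \<in> U. norm (x - x\<^sub>0) < d1}. \<integral>\<^sup>+\<omega>\<in>{\<omega>. \<bar>Y x \<omega>\<bar> > c}. ennreal \<bar>Y x \<omega>\<bar> \<partial>M)"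
      by (rule SUP_upper[OF x])
    also have "\<dots> \<le> ennreal (e / 4)" by (rule less_imp_le[OF c0]) (simp add: c_def)
    finally show "(\<integral>\<^sup>+\<omega>\<in>{\<omega>. \<bar>Y x \<omega>\<bar> > c}. ennreal \<bar>Y x \<omega>\<bar> \<partial>M) \<le> ennreal (e / 4)" .
  qed
  \<comment> \<open>Two exceptional events of probability at most \<open>\<delta>\<close> together contribute at most \<open>2 c \<delta> = e/4\<close>.\<close>
  define \<delta> where "\<delta> = e / (8 * c)"
  have \<delta>: "0 < \<delta>" "c * (2 * \<delta>) = e / 4" using e c unfolding \<delta>_def by auto
  obtain n d2 where d2: "0 < d2" and B: "\<And>x. x \<in> U \<Longrightarrow> norm (x - x\<^sub>0) < d2 \<Longrightarrow>
      \<P>(\<omega> in M. exit_time (X x) (\<zeta> x) (\<X>\<^sub>n n) \<omega> < exit_time (X x) (\<zeta> x) U \<omega>) < \<delta>"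
    using b[OF \<delta>(1)] by blast
  obtain C0 where C0: "\<forall>u\<in>\<X>\<^sub>n n \<inter> U. \<bar>f u\<bar> \<le> C0"
    using assms(18)[of n] unfolding bounded_iff by auto
  define C where "C = max C0 0"
  have C: "0 \<le> C" "\<And>u. u \<in> \<X>\<^sub>n n \<Longrightarrow> u \<in> U \<Longrightarrow> \<bar>f u\<bar> \<le> C"
    using C0 unfolding C_def by (auto simp: le_max_iff_disj)
  \<comment> \<open>An exit before time \<open>r\<close> inside the \<open>n\<close>-th set makes the integral at most \<open>C r \<le> e/4\<close>.\<close>
  define r where "r = e / (4 * (C + 1))"
  have r: "0 < r" "C * r \<le> e / 4"
    using e C(1) unfolding r_def by (auto simp: field_simps)
  obtain d3 where d3: "0 < d3" and A: "\<And>x. x \<in> U \<Longrightarrow> norm (x - x\<^sub>0) < d3 \<Longrightarrow>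
      \<P>(\<omega> in M. ereal r \<le> exit_time (X x) (\<zeta> x) U \<omega>) < \<delta>"
    using exit_time_small_near_regular_point[OF assms(1-3) sol UD x0 regular r(1) \<delta>(1)] by blast
  define d where "d = min d1 (min d2 d3)"
  have d: "0 < d" unfolding d_def using d1 d2 d3 by simp
  have "\<bar>expectation (Y x)\<bar> < e" if x: "x \<in> U" "norm (x - x\<^sub>0) < d" for x
  proof -
    have near: "norm (x - x\<^sub>0) < d1" "norm (x - x\<^sub>0) < d2" "norm (x - x\<^sub>0) < d3"
      using x(2) unfolding d_def by auto
    have xD: "x \<in> \<X>" using x(1) UD closure_subset[of U] by blast
    have Xx: "continuous_adapted (X x) (\<zeta> x)" by (rule solution_continuous_adapted[OF sol[OF xD]])
    have "- \<X>\<^sub>n n \<noteq> {}"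
    proof
      assume "- \<X>\<^sub>n n = {}"
      then have "\<X>\<^sub>n n = UNIV" by auto
      then show False using assms(5)[of n] not_bounded_UNIV by metis
    qed
    then have [measurable]: "(\<lambda>\<omega>. exit_time (X x) (\<zeta> x) (\<X>\<^sub>n n) \<omega>) \<in> borel_measurable M"
      by (rule exit_time_measurable[OF Xx assms(4)])
    have [measurable]: "(\<lambda>\<omega>. exit_time (X x) (\<zeta> x) U \<omega>) \<in> borel_measurable M"
      by (rule exit_time_measurable[OF Xx assms(11) assms(13)])
    let ?late = "{\<omega>\<in>space M. ereal r \<le> exit_time (X x) (\<zeta> x) U \<omega>}"
    let ?far = "{\<omega>\<in>space M. exit_time (X x) (\<zeta> x) (\<X>\<^sub>n n) \<omega> < exit_time (X x) (\<zeta> x) U \<omega>}"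
    have "{\<omega>\<in>space M. \<bar>Y x \<omega>\<bar> > e / 4} \<subseteq> ?late \<union> ?far"
    proof (rule subsetI, rule ccontr)
      fix \<omega> assume \<omega>: "\<omega> \<in> {\<omega>\<in>space M. \<bar>Y x \<omega>\<bar> > e / 4}" and n: "\<omega> \<notin> ?late \<union> ?far"
      have "\<bar>Y x \<omega>\<bar> \<le> C * r"
        unfolding Y_def by (rule exit_integral_bound[OF C]) (use n \<omega> in auto)
      then show False using \<omega> r(2) by simp
    qed
    then have "\<P>(\<omega> in M. \<bar>Y x \<omega>\<bar> > e / 4) \<le> prob (?late \<union> ?far)"
      by (intro finite_measure_mono) auto
    also have "\<dots> \<le> prob ?late + prob ?far" by (intro measure_Un_le) auto
    also have "\<dots> \<le> 2 * \<delta>" using A[OF x(1) near(3)] B[OF x(1) near(2)] by simp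
    finally have "c * \<P>(\<omega> in M. \<bar>Y x \<omega>\<bar> > e / 4) \<le> e / 4"
      using mult_left_mono[OF _ c(2)] unfolding \<delta>(2)[symmetric] by blast
    moreover have "\<bar>expectation (Y x)\<bar> \<le> e / 4 + c * \<P>(\<omega> in M. \<bar>Y x \<omega>\<bar> > e / 4) + e / 4"
      by (rule expectation_le_split[OF Ym[OF x(1) near(1)] c(2) _ _ tail[OF x(1) near(1)]]) (use e in auto)
    ultimately show ?thesis using e by linarith
  qed
  then show "\<exists>d>0. \<forall>x\<in>U. 0 < dist x x\<^sub>0 \<and> dist x x\<^sub>0 < d \<longrightarrow>
      dist (LINT \<omega>|M. exit_integral f (X x) (\<zeta> x) U \<omega>) 0 < e"
    using d unfolding Y_def by (intro exI[of _ d]) (auto simp: dist_norm)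
qed

end
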